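(* Let $V$ be a vector space over $\mathbb{K}$ with finite positive dimension and let $A,A^{*},A^{\varepsilon}$ be a Leonard triple on $V$ that is of Bannai/Ito type, has diameter $d\geq 3$, and is totally bipartite or totally almost bipartite. Then there exist an irreducible $\mathcal{A}$-module structure on $V$ and nonzero scalars $\xi,\xi^{*},\xi^{\varepsilon}\in\mathbb{K}$ such that $A,A^{*},A^{\varepsilon}$ act on $V$ as $\xi x,\xi^{*}y,\xi^{\varepsilon}z$ respectively. If $A,A^{*},A^{\varepsilon}$ is totally bipartite then $V$ is of type $B$, and if $A,A^{*},A^{\varepsilon}$ is totally almost bipartite then $V$ is of type $AB$. There exist exactly four choices for the scalars $\xi,\xi^{*},\xi^{\varepsilon}$ and the $\mathcal{A}$-module structure. The scalars $\xi,\xi^{*}$ are each unique up to sign, and the scalar $\xi^{\varepsilon}$ and the $\mathcal{A}$-module structure are uniquely determined by $\xi,\xi^{*}$.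
   Context: $\mathbb{K}$ is an algebraically closed field of characteristic zero. $\mathcal{A}$ is the unital associative $\mathbb{K}$-algebra with generators $x,y,z$ and relations $xy+yx=2z$, $yz+zy=2x$, $zx+xz=2y$. Type $B(d)$ ($d\ge 0$ even): an $\mathcal{A}$-module is of type $B(d)$ if it is isomorphic to the irreducible module with basis $\{v_i\}_{i=0}^d$ and, for $0\le i\le d$: $x.v_i=(-1)^i(d-2i)v_i$, $y.v_i=(d-i+1)v_{i-1}+(i+1)v_{i+1}$, $z.v_i=(-1)^{i-1}(d-i+1)v_{i-1}+(-1)^i(i+1)v_{i+1}$, with $v_{-1}=0=v_{d+1}$. Type $AB(d,n)$ ($d\ge 0$ an integer, $n\in\{0,x,y,z\}$): for $a\in\{x,y,z\}$ put $\widehat a(n)=1$ if $n\in\{0,a\}$ and $\widehat a(n)=-1$ otherwise. An $\mathcal{A}$-module is of type $AB(d,n)$ if it is isomorphic to the irreducible module with basis $\{v_i\}_{i=0}^d$ and, for $0\le i\le d$: $x.v_i=\widehat x(n)(-1)^{d+i}(2d-2i+1)v_i$, $y.v_i=\widehat y(n)(-1)^d\big((2d-i+2)v_{i-1}+(i+1)v_{i+1}\big)$, $z.v_i=\widehat z(n)\big((-1)^{i-1}(2d-i+2)v_{i-1}+(-1)^i(i+1)v_{i+1}\big)$, with $v_{-1}=0$, $v_{d+1}=v_d$. A module is of type $B$ if it is of type $B(d)$ for some even $d\ge0$, and of type $AB$ if it is of type $AB(d,n)$ for some $d\ge 0$, $n\in\{0,x,y,z\}$. A tridiagonal matrix is irreducible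 if every subdiagonal and superdiagonal entry is nonzero. A tridiagonal matrix $B$ indexed by $0,\dots,d$ is bipartite if $B_{ii}=0$ for all $i$; it is almost bipartite if exactly one of $B_{00},B_{dd}$ is nonzero and $B_{ii}=0$ for $1\le i\le d-1$. A Leonard pair on a $\mathbb{K}$-vector space $V$ of dimension $d+1$ is an ordered pair of linear maps $A,A^*:V\to V$ such that there is a basis $\{v_i\}_{i=0}^d$ in which $A$ is diagonal and $A^*$ is irreducible tridiagonal, and a basis $\{v_i^*\}_{i=0}^d$ in which $A^*$ is diagonal and $A$ is irreducible tridiagonal. With $\theta_i,\theta_i^*$ the eigenvalues of $A,A^*$ for $v_i,v_i^*$ respectively, it is known that the expressions $\frac{\theta_{i-2}-\theta_{i+1}}{\theta_{i-1}-\theta_i}$, $\frac{\theta^*_{i-2}-\theta^*_{i+1}}{\theta^*_{i-1}-\theta^*_i}$ are equal and independent of $i$ for $2\le i\le d-1$; the Leonard pair is of Bannai/Ito type if this common value is $-1$. A Leonard triple on $V$ is an ordered triple of linear maps $A,A^*,A^\varepsilon:V\to V$ such that for each of the three maps there is a basis of $V$ in which that map is diagonal and the other two are irreducible tridiagonal; its diameter is $\dim V-1$. It is totally bipartite (resp. totally almost bipartite) if all six tridiagonal matrices so arising are bipartite (resp. almost bipartite). Any two of the three maps (in either order) form a Leonard pair; the triple is of Bannai/Ito type if all these Leonard pairs are. *)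

theory Defs
  imports Complex_Main "HOL-Library.Poly_Mapping" "HOL-Computational_Algebra.Polynomial"
begin

datatype gen = GX | GY | GZ

text \<open>Words form the free monoid on the generators, written additively so that finitely supported
  functions on words, with the convolution product of \<^typ>\<open>'a \<Rightarrow>\<^sub>0 'b\<close>, form the free
  unital associative algebra.\<close>

datatype word = Word "gen list"

instantiation word :: monoid_add
begin

definition zero_word :: word where "zero_word = Word []"

fun plus_word :: "word \<Rightarrow> word \<Rightarrow> word" where
  "plus_word (Word u) (Word v) = Word (u @ v)"

instance
proof
  fix a b c :: word
  show "a + b + c = a + (b + c)" by (cases a; cases b; cases c) simp
  show "0 + a = a" by (cases a) (simp add: zero_word_def)
  show "a + 0 = a" by (cases a) (simp add: zero_word_def)
qed

end

type_synonym 'k free_alg = "word \<Rightarrow>\<^sub>0 'k"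

definition free_const :: "'k::field \<Rightarrow> 'k free_alg" where
  "free_const c = Poly_Mapping.single 0 c"

definition free_gen :: "gen \<Rightarrow> 'k::field free_alg" where
  "free_gen g = Poly_Mapping.single (Word [g]) 1"

definition relators :: "'k::field free_alg set" where
  "relators =
    {free_gen GX * free_gen GY + free_gen GY * free_gen GX - 2 * free_gen GZ,
     free_gen GY * free_gen GZ + free_gen GZ * free_gen GY - 2 * free_gen GX,
     free_gen GZ * free_gen GX + free_gen GX * free_gen GZ - 2 * free_gen GY}"

text \<open>The two-sided ideal generated by the relators; closure under negation and scalars comes from
  multiplication by constants.\<close>

inductive_set rel_ideal :: "'k::field free_alg set" where
  rel_ideal_zero: "0 \<in> rel_ideal"
| rel_ideal_relator: "r \<in> relators \<Longrightarrow> a * r * b \<in> rel_ideal"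
| rel_ideal_add: "p \<in> rel_ideal \<Longrightarrow> q \<in> rel_ideal \<Longrightarrow> p + q \<in> rel_ideal"

lemma rel_ideal_mult_left: "p \<in> rel_ideal \<Longrightarrow> c * p \<in> rel_ideal"
proof (induction rule: rel_ideal.induct)
  case (rel_ideal_relator r a b)
  then show ?case using rel_ideal.rel_ideal_relator[of r "c * a" b] by (simp add: mult.assoc)
qed (auto simp: distrib_left intro: rel_ideal.intros)

lemma rel_ideal_mult_right: "p \<in> rel_ideal \<Longrightarrow> p * c \<in> rel_ideal"
proof (induction rule: rel_ideal.induct)
  case (rel_ideal_relator r a b)
  then show ?case using rel_ideal.rel_ideal_relator[of r a "b * c"] by (simp add: mult.assoc)
qed (auto simp: distrib_right intro: rel_ideal.intros)

lemma rel_ideal_uminus: "p \<in> rel_ideal \<Longrightarrow> - p \<in> rel_ideal"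
  using rel_ideal_mult_left[of p "- 1"] by simp

definition free_cong :: "'k::field free_alg \<Rightarrow> 'k free_alg \<Rightarrow> bool" where
  "free_cong p q \<longleftrightarrow> p - q \<in> rel_ideal"

lemma equivp_free_cong: "equivp free_cong"
proof (rule equivpI)
  show "reflp free_cong"
    by (auto simp: reflp_def free_cong_def intro: rel_ideal_zero)
  show "symp free_cong"
    unfolding symp_def free_cong_def using rel_ideal_uminus by (metis minus_diff_eq)
  show "transp free_cong"
    unfolding transp_def free_cong_def using rel_ideal_add by (metis diff_add_cancel add_diff_eq)
qed

text \<open>The anticommutator spin algebra: the quotient of the free algebra by the ideal.\<close>

quotient_type (overloaded) 'k acs_alg = "('k::field) free_alg" / free_cong
  by (rule equivp_free_cong)

lemma word_add_eq_zero: "(0 = l + q) \<longleftrightarrow> l = 0 \<and> q = (0::word)"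
  by (cases l; cases q) (auto simp: zero_word_def)

lemma lookup_times_zero:
  fixes p q :: "'k::field free_alg"
  shows "Poly_Mapping.lookup (p * q) 0 = Poly_Mapping.lookup p 0 * Poly_Mapping.lookup q 0"
proof -
  have *: "(\<Sum>x. Poly_Mapping.lookup q x when 0 = l + x) = (Poly_Mapping.lookup q 0 when l = 0)" for l
  proof -
    have "(\<lambda>x. Poly_Mapping.lookup q x when 0 = l + x) = (\<lambda>x. (Poly_Mapping.lookup q 0 when l = 0) when x = 0)"
      by (rule ext) (auto simp: when_def word_add_eq_zero)
    then show ?thesis by (simp only: Sum_any_when_equal)
  qed
  have "(\<lambda>l. Poly_Mapping.lookup p l * (Poly_Mapping.lookup q 0 when l = 0)) = (\<lambda>l. Poly_Mapping.lookup p 0 * Poly_Mapping.lookup q 0 when l = 0)"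
    by (rule ext) (auto simp: when_def)
  then show ?thesis unfolding lookup_mult * by (simp only: Sum_any_when_equal)
qed

lemma lookup_rel_ideal: "p \<in> rel_ideal \<Longrightarrow> Poly_Mapping.lookup p 0 = 0"
proof (induction rule: rel_ideal.induct)
  case (rel_ideal_relator r a b)
  have "Poly_Mapping.lookup (free_gen g :: 'a free_alg) 0 = 0" for g
    by (simp add: free_gen_def lookup_single zero_word_def)
  with rel_ideal_relator have "Poly_Mapping.lookup r 0 = 0"
    by (auto simp: relators_def lookup_minus lookup_add lookup_times_zero)
  then show ?case by (simp add: lookup_times_zero)
qed (auto simp: lookup_add)

instantiation acs_alg :: (field) ring_1
begin

lift_definition zero_acs_alg :: "'a acs_alg" is 0 .
lift_definition one_acs_alg :: "'a acs_alg" is 1 .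

lift_definition plus_acs_alg :: "'a acs_alg \<Rightarrow> 'a acs_alg \<Rightarrow> 'a acs_alg" is "(+)"
  unfolding free_cong_def using rel_ideal_add by (metis add_diff_add)

lift_definition uminus_acs_alg :: "'a acs_alg \<Rightarrow> 'a acs_alg" is uminus
  unfolding free_cong_def using rel_ideal_uminus by (metis minus_diff_minus)

lift_definition minus_acs_alg :: "'a acs_alg \<Rightarrow> 'a acs_alg \<Rightarrow> 'a acs_alg" is "(-)"
proof -
  fix p p' q q' :: "'a free_alg"
  assume "free_cong p p'" "free_cong q q'"
  then have "(p - p') + - (q - q') \<in> rel_ideal"
    unfolding free_cong_def by (intro rel_ideal_add rel_ideal_uminus)
  then show "free_cong (p - q) (p' - q')" by (simp add: free_cong_def algebra_simps)
qed

lift_definition times_acs_alg :: "'a acs_alg \<Rightarrow> 'a acs_alg \<Rightarrow> 'a acs_alg" is "(*)"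
proof -
  fix p p' q q' :: "'a free_alg"
  assume "free_cong p p'" "free_cong q q'"
  then have "(p - p') * q + p' * (q - q') \<in> rel_ideal"
    unfolding free_cong_def by (intro rel_ideal_add rel_ideal_mult_left rel_ideal_mult_right)
  then show "free_cong (p * q) (p' * q')" by (simp add: free_cong_def algebra_simps)
qed

instance
proof
  fix a b c :: "'a acs_alg"
  show "a + b + c = a + (b + c)"
    by (transfer, simp add: add.assoc equivp_reflp[OF equivp_free_cong])
  show "a + b = b + a"
    by (transfer, simp add: add.commute equivp_reflp[OF equivp_free_cong])
  show "0 + a = a"
    by (transfer, simp add: equivp_reflp[OF equivp_free_cong])
  show "- a + a = 0"
    by (transfer, simp add: equivp_reflp[OF equivp_free_cong])
  show "a - b = a + - b"
    by (transfer, simp add: equivp_reflp[OF equivp_free_cong])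
  show "a * b * c = a * (b * c)"
    by (transfer, simp add: mult.assoc equivp_reflp[OF equivp_free_cong])
  show "1 * a = a"
    by (transfer, simp add: equivp_reflp[OF equivp_free_cong])
  show "a * 1 = a"
    by (transfer, simp add: equivp_reflp[OF equivp_free_cong])
  show "(a + b) * c = a * c + b * c"
    by (transfer, simp add: distrib_right equivp_reflp[OF equivp_free_cong])
  show "a * (b + c) = a * b + a * c"
    by (transfer, simp add: distrib_left equivp_reflp[OF equivp_free_cong])
  show "(0 :: 'a acs_alg) \<noteq> 1"
  proof (transfer, rule notI)
    assume "free_cong (0 :: 'a free_alg) 1"
    then have "Poly_Mapping.lookup (0 - 1 :: 'a free_alg) 0 = 0"
      unfolding free_cong_def by (rule lookup_rel_ideal)
    then show False by (simp add: lookup_minus lookup_one)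
  qed
qed

end

lift_definition acs_const :: "'k::field \<Rightarrow> 'k acs_alg" is free_const .
lift_definition acs_gen :: "gen \<Rightarrow> 'k::field acs_alg" is free_gen .

abbreviation acs_x :: "'k::field acs_alg" where "acs_x \<equiv> acs_gen GX"
abbreviation acs_y :: "'k::field acs_alg" where "acs_y \<equiv> acs_gen GY"
abbreviation acs_z :: "'k::field acs_alg" where "acs_z \<equiv> acs_gen GZ"

text \<open>A matrix is a function \<^typ>\<open>nat \<Rightarrow> nat \<Rightarrow> 'k\<close> of which only the entries with both
  indices at most \<open>d\<close> are relevant.\<close>

definition diagonal_mat :: "nat \<Rightarrow> (nat \<Rightarrow> nat \<Rightarrow> 'k::field) \<Rightarrow> bool" where
  "diagonal_mat d B \<longleftrightarrow> (\<forall>i\<le>d. \<forall>j\<le>d. i \<noteq> j \<longrightarrow> B i j = 0)"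

definition tridiagonal_mat :: "nat \<Rightarrow> (nat \<Rightarrow> nat \<Rightarrow> 'k::field) \<Rightarrow> bool" where
  "tridiagonal_mat d B \<longleftrightarrow> (\<forall>i\<le>d. \<forall>j\<le>d. i + 1 < j \<or> j + 1 < i \<longrightarrow> B i j = 0)"

definition irreducible_tridiagonal_mat :: "nat \<Rightarrow> (nat \<Rightarrow> nat \<Rightarrow> 'k::field) \<Rightarrow> bool" where
  "irreducible_tridiagonal_mat d B \<longleftrightarrow>
     tridiagonal_mat d B \<and> (\<forall>i<d. B (i + 1) i \<noteq> 0 \<and> B i (i + 1) \<noteq> 0)"

definition bipartite_mat :: "nat \<Rightarrow> (nat \<Rightarrow> nat \<Rightarrow> 'k::field) \<Rightarrow> bool" where
  "bipartite_mat d B \<longleftrightarrow> tridiagonal_mat d B \<and> (\<forall>i\<le>d. B i i = 0)"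

definition almost_bipartite_mat :: "nat \<Rightarrow> (nat \<Rightarrow> nat \<Rightarrow> 'k::field) \<Rightarrow> bool" where
  "almost_bipartite_mat d B \<longleftrightarrow>
     tridiagonal_mat d B \<and> (B 0 0 \<noteq> 0) \<noteq> (B d d \<noteq> 0) \<and> (\<forall>i. 1 \<le> i \<and> i < d \<longrightarrow> B i i = 0)"

text \<open>\<open>hat a n\<close> is the sign attached to the generator \<open>a\<close>; the value 0 of the
  parameter \<open>n\<close> is represented by \<^term>\<open>None\<close>.\<close>

definition hat :: "gen \<Rightarrow> gen option \<Rightarrow> 'k::field" where
  "hat a n = (if n = None \<or> n = Some a then 1 else - 1)"

context
  fixes scale :: "'k::field \<Rightarrow> 'v::ab_group_add \<Rightarrow> 'v"
begin

text \<open>The vector space is the whole type \<^typ>\<open>'v\<close> with scalar multiplication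
  \<open>scale\<close>.\<close>

definition diameter :: nat where
  "diameter = vector_space.dim scale (UNIV :: 'v set) - 1"

definition indexed_basis :: "nat \<Rightarrow> (nat \<Rightarrow> 'v) \<Rightarrow> bool" where
  "indexed_basis d v \<longleftrightarrow>
     inj_on v {..d} \<and> module.independent scale (v ` {..d}) \<and> module.span scale (v ` {..d}) = UNIV"

text \<open>Column \<open>j\<close> of the matrix representing \<open>A\<close> consists of the coordinates of
  \<open>A (v j)\<close>.\<close>

definition mat_of :: "nat \<Rightarrow> (nat \<Rightarrow> 'v) \<Rightarrow> ('v \<Rightarrow> 'v) \<Rightarrow> nat \<Rightarrow> nat \<Rightarrow> 'k" where
  "mat_of d v A i j = module.representation scale (v ` {..d}) (A (v j)) (v i)"

definition leonard_basis :: "('v \<Rightarrow> 'v) \<Rightarrow> ('v \<Rightarrow> 'v) \<Rightarrow> (nat \<Rightarrow> 'v) \<Rightarrow> bool" where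
  "leonard_basis A As v \<longleftrightarrow>
     indexed_basis diameter v \<and>
     diagonal_mat diameter (mat_of diameter v A) \<and>
     irreducible_tridiagonal_mat diameter (mat_of diameter v As)"

definition leonard_pair :: "('v \<Rightarrow> 'v) \<Rightarrow> ('v \<Rightarrow> 'v) \<Rightarrow> bool" where
  "leonard_pair A As \<longleftrightarrow>
     Vector_Spaces.linear scale scale A \<and> Vector_Spaces.linear scale scale As \<and>
     (\<exists>v. leonard_basis A As v) \<and> (\<exists>v. leonard_basis As A v)"

text \<open>The diagonal entries \<open>mat_of diameter v A i i\<close> are the eigenvalues of \<open>A\<close>.
  The range of \<open>i\<close> is empty for diameter less than 3, so the notion is meaningful only for
  diameter at least 3.\<close>

definition bannai_ito_pair :: "('v \<Rightarrow> 'v) \<Rightarrow> ('v \<Rightarrow> 'v) \<Rightarrow> bool" where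
  "bannai_ito_pair A As \<longleftrightarrow>
     leonard_pair A As \<and>
     (\<forall>v vs. leonard_basis A As v \<and> leonard_basis As A vs \<longrightarrow>
        (let \<theta> = (\<lambda>i. mat_of diameter v A i i); \<theta>s = (\<lambda>i. mat_of diameter vs As i i) in
          \<forall>i. 2 \<le> i \<and> i + 1 \<le> diameter \<longrightarrow>
            (\<theta> (i - 2) - \<theta> (i + 1)) / (\<theta> (i - 1) - \<theta> i) = - 1 \<and>
            (\<theta>s (i - 2) - \<theta>s (i + 1)) / (\<theta>s (i - 1) - \<theta>s i) = - 1))"

definition triple_basis ::
  "('v \<Rightarrow> 'v) \<Rightarrow> ('v \<Rightarrow> 'v) \<Rightarrow> ('v \<Rightarrow> 'v) \<Rightarrow> (nat \<Rightarrow> 'v) \<Rightarrow> bool" where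
  "triple_basis A B C v \<longleftrightarrow> leonard_basis A B v \<and> leonard_basis A C v"

definition leonard_triple :: "('v \<Rightarrow> 'v) \<Rightarrow> ('v \<Rightarrow> 'v) \<Rightarrow> ('v \<Rightarrow> 'v) \<Rightarrow> bool" where
  "leonard_triple A As Ae \<longleftrightarrow>
     Vector_Spaces.linear scale scale A \<and> Vector_Spaces.linear scale scale As \<and>
     Vector_Spaces.linear scale scale Ae \<and>
     (\<exists>v. triple_basis A As Ae v) \<and> (\<exists>v. triple_basis As Ae A v) \<and> (\<exists>v. triple_basis Ae A As v)"

definition bannai_ito_triple :: "('v \<Rightarrow> 'v) \<Rightarrow> ('v \<Rightarrow> 'v) \<Rightarrow> ('v \<Rightarrow> 'v) \<Rightarrow> bool" where
  "bannai_ito_triple A As Ae \<longleftrightarrow>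
     leonard_triple A As Ae \<and>
     bannai_ito_pair A As \<and> bannai_ito_pair As A \<and>
     bannai_ito_pair As Ae \<and> bannai_ito_pair Ae As \<and>
     bannai_ito_pair Ae A \<and> bannai_ito_pair A Ae"

definition all_triple_mats ::
  "(nat \<Rightarrow> (nat \<Rightarrow> nat \<Rightarrow> 'k) \<Rightarrow> bool) \<Rightarrow> ('v \<Rightarrow> 'v) \<Rightarrow> ('v \<Rightarrow> 'v) \<Rightarrow> ('v \<Rightarrow> 'v) \<Rightarrow> bool" where
  "all_triple_mats P A As Ae \<longleftrightarrow>
     (\<forall>v. triple_basis A As Ae v \<longrightarrow>
        P diameter (mat_of diameter v As) \<and> P diameter (mat_of diameter v Ae)) \<and>
     (\<forall>v. triple_basis As Ae A v \<longrightarrow>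
        P diameter (mat_of diameter v Ae) \<and> P diameter (mat_of diameter v A)) \<and>
     (\<forall>v. triple_basis Ae A As v \<longrightarrow>
        P diameter (mat_of diameter v A) \<and> P diameter (mat_of diameter v As))"

definition totally_bipartite :: "('v \<Rightarrow> 'v) \<Rightarrow> ('v \<Rightarrow> 'v) \<Rightarrow> ('v \<Rightarrow> 'v) \<Rightarrow> bool" where
  "totally_bipartite A As Ae \<longleftrightarrow>
     leonard_triple A As Ae \<and> all_triple_mats bipartite_mat A As Ae"

definition totally_almost_bipartite :: "('v \<Rightarrow> 'v) \<Rightarrow> ('v \<Rightarrow> 'v) \<Rightarrow> ('v \<Rightarrow> 'v) \<Rightarrow> bool" where
  "totally_almost_bipartite A As Ae \<longleftrightarrow>
     leonard_triple A As Ae \<and> all_triple_mats almost_bipartite_mat A As Ae"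

text \<open>A module structure on the vector space, compatible with its scalar multiplication: a unital
  algebra homomorphism into the linear endomorphisms.\<close>

definition acs_module :: "('k acs_alg \<Rightarrow> 'v \<Rightarrow> 'v) \<Rightarrow> bool" where
  "acs_module act \<longleftrightarrow>
     (\<forall>a. Vector_Spaces.linear scale scale (act a)) \<and>
     (\<forall>a b v. act (a + b) v = act a v + act b v) \<and>
     (\<forall>a b v. act (a * b) v = act a (act b v)) \<and>
     (\<forall>v. act 1 v = v) \<and>
     (\<forall>c v. act (acs_const c) v = scale c v)"

definition irreducible_acs_module :: "('k acs_alg \<Rightarrow> 'v \<Rightarrow> 'v) \<Rightarrow> bool" where
  "irreducible_acs_module act \<longleftrightarrow>
     acs_module act \<and> (UNIV :: 'v set) \<noteq> {0} \<and>
     (\<forall>W. module.subspace scale W \<and> (\<forall>a. \<forall>w\<in>W. act a w \<in> W) \<longrightarrow> W = {0} \<or> W = UNIV)"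

text \<open>Being isomorphic to the module with a basis on which the generators act by given formulas is
  expressed by having such a basis. In both definitions \<open>low i\<close> and \<open>up i\<close> stand for
  \<open>v\<close> at \<open>i - 1\<close> and \<open>i + 1\<close> with the respective boundary conventions, and
  \<open>(-1) ^ (i + 1)\<close> is the sign with exponent \<open>i - 1\<close>.\<close>

definition module_type_B_at :: "nat \<Rightarrow> ('k acs_alg \<Rightarrow> 'v \<Rightarrow> 'v) \<Rightarrow> bool" where
  "module_type_B_at d act \<longleftrightarrow>
     irreducible_acs_module act \<and>
     (\<exists>v. indexed_basis d v \<and>
       (let low = (\<lambda>i. if i = 0 then 0 else v (i - 1));
            up = (\<lambda>i. if i = d then 0 else v (i + 1)) in
        \<forall>i\<le>d.
          act acs_x (v i) = scale ((- 1) ^ i * (of_nat d - 2 * of_nat i)) (v i) \<and>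
          act acs_y (v i) =
            scale (of_nat (d - i + 1)) (low i) + scale (of_nat (i + 1)) (up i) \<and>
          act acs_z (v i) =
            scale ((- 1) ^ (i + 1) * of_nat (d - i + 1)) (low i) +
            scale ((- 1) ^ i * of_nat (i + 1)) (up i)))"

definition module_type_AB_at :: "nat \<Rightarrow> gen option \<Rightarrow> ('k acs_alg \<Rightarrow> 'v \<Rightarrow> 'v) \<Rightarrow> bool" where
  "module_type_AB_at d n act \<longleftrightarrow>
     irreducible_acs_module act \<and>
     (\<exists>v. indexed_basis d v \<and>
       (let low = (\<lambda>i. if i = 0 then 0 else v (i - 1));
            up = (\<lambda>i. if i = d then v d else v (i + 1)) in
        \<forall>i\<le>d.
          act acs_x (v i) =
            scale (hat GX n * (- 1) ^ (d + i) * (2 * of_nat d - 2 * of_nat i + 1)) (v i) \<and>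
          act acs_y (v i) =
            scale (hat GY n * (- 1) ^ d)
              (scale (of_nat (2 * d - i + 2)) (low i) + scale (of_nat (i + 1)) (up i)) \<and>
          act acs_z (v i) =
            scale (hat GZ n)
              (scale ((- 1) ^ (i + 1) * of_nat (2 * d - i + 2)) (low i) +
               scale ((- 1) ^ i * of_nat (i + 1)) (up i))))"

definition module_type_B :: "('k acs_alg \<Rightarrow> 'v \<Rightarrow> 'v) \<Rightarrow> bool" where
  "module_type_B act \<longleftrightarrow> (\<exists>d. even d \<and> module_type_B_at d act)"

definition module_type_AB :: "('k acs_alg \<Rightarrow> 'v \<Rightarrow> 'v) \<Rightarrow> bool" where
  "module_type_AB act \<longleftrightarrow> (\<exists>d n. module_type_AB_at d n act)"

text \<open>The choices of nonzero scalars together with an irreducible module structure for which the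
  three maps act as the corresponding multiples of the generators.\<close>

definition realizations ::
  "('v \<Rightarrow> 'v) \<Rightarrow> ('v \<Rightarrow> 'v) \<Rightarrow> ('v \<Rightarrow> 'v) \<Rightarrow> ('k \<times> 'k \<times> 'k \<times> ('k acs_alg \<Rightarrow> 'v \<Rightarrow> 'v)) set" where
  "realizations A As Ae =
     {(\<xi>, \<xi>s, \<xi>e, act). \<xi> \<noteq> 0 \<and> \<xi>s \<noteq> 0 \<and> \<xi>e \<noteq> 0 \<and> irreducible_acs_module act \<and>
        (\<forall>v. A v = scale \<xi> (act acs_x v)) \<and>
        (\<forall>v. As v = scale \<xi>s (act acs_y v)) \<and>
        (\<forall>v. Ae v = scale \<xi>e (act acs_z v))}"

end

end

theory Submission
  imports Defs
begin

text \<open>Let \<open>A\<close> be diagonal with eigenvalues \<open>\<theta>\<^sub>i\<close>. The Bannai/Ito condition says that \<open>\<theta>\<^sub>i + \<theta>\<^sub>i\<^sub>+\<^sub>1\<close> takes two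
  alternating values \<open>s\<^sub>1, s\<^sub>2\<close>, so \<open>A\<^sup>2B + 2ABA + BA\<^sup>2 - (s\<^sub>1 + s\<^sub>2)(AB + BA) + s\<^sub>1s\<^sub>2B\<close> is a multiple of
  an eigenprojection of \<open>A\<close>; for \<open>d \<ge> 3\<close> its corner entry in an eigenbasis of \<open>B\<close> is zero, so it
  vanishes. Applied to both orders this gives \<open>s\<^sub>2 = - s\<^sub>1\<close> and \<open>{A, {A, B}} = s\<^sub>1\<^sup>2 B\<close>. Comparing entries of these relations
  for the pairs \<open>(B, A)\<close>, \<open>(C, A)\<close>, \<open>(B, C)\<close> in the eigenbasis of \<open>A\<close> determines the spectrum and the
  products of off-diagonal entries, and forces \<open>AB + BA = \<nu> C\<close> with \<open>\<nu> \<noteq> 0\<close>. The other two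
  anticommutators follow, and rescaling \<open>A\<close> and \<open>B\<close> (each up to sign) and then \<open>C\<close> yields the module.\<close>

subsection \<open>Evaluation of the free algebra and modules over the anticommutator spin algebra\<close>

text \<open>The hypothesis allows one nonzero diagonal entry, at either end, separately for every
  map and basis. Reversing the eigenbasis of \<open>A\<close> moves that of \<open>B\<close> to
  index \<open>d\<close>; that the entry of \<open>C\<close> lies at the same end must be proved
  from the relation of \<open>C\<close> with \<open>A\<close>. The spectrum has one unknown,
  \<open>m = 2 * \<theta>\<^sub>0 / (\<theta>\<^sub>0 + \<theta>\<^sub>1)\<close>. The last row of
  the relation leaves \<open>m = d\<close> if the end entry is zero and \<open>m = 2 * d + 1\<close>
  otherwise: the constants of types B and AB. \<open>B\<close> and \<open>C\<close> share
  \<open>m\<close>, so the ratios of their subdiagonals and of their superdiagonals have a constant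
  product. Each satisfies a recurrence with characteristic polynomial (1 + X)^2, so only (-1)^n
  survives; this is also the sign of
  \<open>\<theta>\<^sub>n + \<theta>\<^sub>n\<^sub>+\<^sub>1\<close>, whence AB + BA is a multiple
  of \<open>C\<close>. In the bipartite case both signs of the scalars are absorbed by the basis,
  one by reversal and one by rescaling. In the almost bipartite case the end entry fixes the
  orientation, and the two signs become the parameter \<open>n\<close> of type AB.\<close>

lemma poly_mapping_single_induct [case_names zero single add]:
  fixes p :: "'a \<Rightarrow>\<^sub>0 'b::comm_monoid_add"
  assumes zero: "P 0"
    and single: "\<And>w c. P (Poly_Mapping.single w c)"
    and add: "\<And>p q. P p \<Longrightarrow> P q \<Longrightarrow> P (p + q)"
  shows "P p"
proof (induction p rule: update_induct)
  case const
  then show ?case by (rule zero)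
next
  case (update f a b)
  have "Poly_Mapping.update a b f = Poly_Mapping.single a b + f"
    using update.hyps
    by (intro poly_mapping_eqI)
       (auto simp: lookup_add lookup_single Poly_Mapping.lookup_update in_keys_iff when_def)
  then show ?case using add[OF single update.IH] by simp
qed

fun word_op :: "(gen \<Rightarrow> 'v \<Rightarrow> 'v) \<Rightarrow> word \<Rightarrow> 'v \<Rightarrow> 'v" where
  "word_op f (Word gs) = foldr f gs"

lemma word_op_add: "word_op f (u + w) v = word_op f u (word_op f w v)"
  by (cases u; cases w) simp

lemma word_op_zero [simp]: "word_op f 0 v = v"
  by (simp add: zero_word_def)

locale vspace = vector_space scale
  for scale :: "'a::field \<Rightarrow> 'b::ab_group_add \<Rightarrow> 'b"
begin

abbreviation lin :: "('b \<Rightarrow> 'b) \<Rightarrow> bool" where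
  "lin \<equiv> Vector_Spaces.linear scale scale"

lemma lin_iff:
  "lin f \<longleftrightarrow> (\<forall>x y. f (x + y) = f x + f y) \<and> (\<forall>c x. f (scale c x) = scale c (f x))"
  using vector_space_axioms by (simp add: Vector_Spaces.linear_iff)

lemma lin_0: "lin f \<Longrightarrow> f 0 = 0"
  by (metis lin_iff add_cancel_right_left add_0)

definition free_eval :: "(gen \<Rightarrow> 'b \<Rightarrow> 'b) \<Rightarrow> 'a free_alg \<Rightarrow> 'b \<Rightarrow> 'b" where
  "free_eval f p v = (\<Sum>w\<in>Poly_Mapping.keys p. scale (Poly_Mapping.lookup p w) (word_op f w v))"

text \<open>Allows the evaluations of several elements to be compared over one common index set,
  even if terms cancel in their sum.\<close>

lemma free_eval_superset:
  fixes p :: "'a free_alg"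
  assumes "finite S" "Poly_Mapping.keys p \<subseteq> S"
  shows "free_eval f p v = (\<Sum>w\<in>S. scale (Poly_Mapping.lookup p w) (word_op f w v))"
  unfolding free_eval_def using assms
  by (intro sum.mono_neutral_left) (auto simp: in_keys_iff)

lemma free_eval_0 [simp]: "free_eval f 0 v = 0"
  by (simp add: free_eval_def)

lemma free_eval_add: "free_eval f (p + q) v = free_eval f p v + free_eval f q v"
proof -
  let ?S = "Poly_Mapping.keys p \<union> Poly_Mapping.keys q"
  have "free_eval f r v = (\<Sum>w\<in>?S. scale (Poly_Mapping.lookup r w) (word_op f w v))"
    if "r \<in> {p, q, p + q}" for r
    using that Poly_Mapping.keys_add[of p q] by (intro free_eval_superset) auto
  then show ?thesis by (simp add: lookup_add scale_left_distrib sum.distrib)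
qed

lemma free_eval_single: "free_eval f (Poly_Mapping.single w c) v = scale c (word_op f w v)"
  using free_eval_superset[of "{w}" "Poly_Mapping.single w c"] by simp

lemma linear_word_op:
  assumes "\<And>g. lin (f g)"
  shows "lin (word_op f w)"
proof -
  have "lin (foldr f gs)" for gs
    using assms by (induction gs) (auto simp: lin_iff)
  then show ?thesis by (cases w) simp
qed

lemma linear_free_eval:
  assumes "\<And>g. lin (f g)"
  shows "lin (free_eval f p)"
proof (induction p rule: poly_mapping_single_induct)
  case zero
  then show ?case by (simp add: lin_iff)
next
  case (single w c)
  then show ?case
    using linear_word_op[of f, OF assms]
    by (simp add: free_eval_single lin_iff scale_right_distrib scale_left_commute)
next
  case (add p q)
  then show ?case
    by (simp add: lin_iff free_eval_add scale_right_distrib algebra_simps)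
qed

text \<open>Both sides are additive in \<open>p\<close> and in \<open>q\<close>, which reduces the
  claim to single words. There the convolution is concatenation, and linearity of the generators
  moves the coefficient of the second word past the first word.\<close>

lemma free_eval_mult:
  assumes lin: "\<And>g. lin (f g)"
  shows "free_eval f (p * q) v = free_eval f p (free_eval f q v)"
proof (induction p rule: poly_mapping_single_induct)
  case (single w c)
  show ?case
  proof (induction q rule: poly_mapping_single_induct)
    case zero
    then show ?case using linear_free_eval[OF lin] by (simp add: lin_0)
  next
    case (single u b)
    then show ?case
      using linear_word_op[of f, OF lin]
      by (simp add: mult_single free_eval_single word_op_add lin_iff)
  next
    case (add p q)
    then show ?case using linear_free_eval[OF lin]
      by (simp add: distrib_left free_eval_add lin_iff)
  qed
qed (simp_all add: distrib_right free_eval_add)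

lemma free_eval_const: "free_eval f (free_const c) v = scale c v"
  by (simp add: free_const_def free_eval_single)

lemma free_eval_gen: "free_eval f (free_gen g) v = f g v"
  by (simp add: free_gen_def free_eval_single)

lemma free_eval_diff: "free_eval f (p - q) v = free_eval f p v - free_eval f q v"
  using free_eval_add[of f "p - q" q v] by simp

section \<open>Modules over the quotient algebra\<close>

definition acs_rels :: "(gen \<Rightarrow> 'b \<Rightarrow> 'b) \<Rightarrow> bool" where
  "acs_rels f \<longleftrightarrow> (\<forall>v.
     f GX (f GY v) + f GY (f GX v) = scale 2 (f GZ v) \<and>
     f GY (f GZ v) + f GZ (f GY v) = scale 2 (f GX v) \<and>
     f GZ (f GX v) + f GX (f GZ v) = scale 2 (f GY v))"

text \<open>By multiplicativity the value of \<open>a * r * b\<close> passes through that of the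
  relator \<open>r\<close>, and the vanishing of each relator is one of the three equations in
  \<open>acs_rels\<close>.\<close>

lemma free_eval_rel_ideal:
  assumes lin: "\<And>g. lin (f g)" and rels: "acs_rels f"
  assumes "p \<in> rel_ideal"
  shows "free_eval f p v = 0"
  using assms(3)
proof (induction arbitrary: v rule: rel_ideal.induct)
  case (rel_ideal_relator r a b)
  \<comment> \<open>The numeral of the free algebra is a constant polynomial and therefore acts as
    \<open>scale 2\<close>.\<close>
  have 2: "(2 :: 'a free_alg) = free_const 2"
    by (simp add: free_const_def single_numeral)
  have "free_eval f r u = 0" for u
    using rel_ideal_relator rels
    by (auto simp: relators_def free_eval_diff free_eval_add free_eval_mult[OF lin] free_eval_gen
        acs_rels_def 2 free_eval_const)
  then show ?case
    using linear_free_eval[OF lin] by (simp add: free_eval_mult[OF lin] lin_0)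
qed (simp_all add: free_eval_add)

text \<open>A chosen representative is evaluated instead of lifting \<open>free_eval\<close>:
  independence of the representative needs \<open>acs_rels f\<close>, whereas the definition must
  make sense for every \<open>f\<close>.\<close>

definition acs_eval :: "(gen \<Rightarrow> 'b \<Rightarrow> 'b) \<Rightarrow> 'a acs_alg \<Rightarrow> 'b \<Rightarrow> 'b" where
  "acs_eval f a = free_eval f (rep_acs_alg a)"

lemma acs_eval_abs:
  assumes lin: "\<And>g. lin (f g)" and rels: "acs_rels f"
  shows "acs_eval f (abs_acs_alg p) = free_eval f p"
proof -
  have "free_cong (rep_acs_alg (abs_acs_alg p)) p"
    using Quotient3_rep_abs[OF Quotient3_acs_alg] equivp_reflp[OF equivp_free_cong] by blast
  then have "free_eval f (rep_acs_alg (abs_acs_alg p) - p) v = 0" for v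
    unfolding free_cong_def by (intro free_eval_rel_ideal[OF lin rels])
  then show ?thesis by (auto simp: acs_eval_def free_eval_diff)
qed

lemma acs_alg_cases: obtains p where "a = abs_acs_alg p"
  by (metis Quotient3_abs_rep Quotient3_acs_alg)

lemma acs_eval_gen:
  assumes lin: "\<And>g. lin (f g)" and rels: "acs_rels f"
  shows "acs_eval f (acs_gen g) = f g"
  by (auto simp: acs_gen.abs_eq acs_eval_abs[OF lin rels] free_eval_gen)

lemma acs_module_acs_eval:
  assumes lin: "\<And>g. lin (f g)" and rels: "acs_rels f"
  shows "acs_module scale (acs_eval f)"
proof -
  note ev = acs_eval_abs[OF lin rels]
  have one: "(1 :: 'a free_alg) = free_const 1"
    by (simp add: free_const_def)
  have "acs_eval f (a + b) v = acs_eval f a v + acs_eval f b v" for a b v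
    by (rule acs_alg_cases[of a]; rule acs_alg_cases[of b])
       (simp add: plus_acs_alg.abs_eq ev free_eval_add)
  moreover have "acs_eval f (a * b) v = acs_eval f a (acs_eval f b v)" for a b v
    by (rule acs_alg_cases[of a]; rule acs_alg_cases[of b])
       (simp add: times_acs_alg.abs_eq ev free_eval_mult[OF lin])
  moreover have eval_lin: "lin (acs_eval f a)" for a
    using linear_free_eval[OF lin] by (simp add: acs_eval_def)
  ultimately show ?thesis
    by (simp add: acs_module_def one_acs_alg.abs_eq acs_const.abs_eq ev free_eval_const one
        eval_lin)
qed

lemma acs_module_zero:
  assumes "acs_module scale act"
  shows "act 0 v = 0"
proof -
  have "act (0 + 0) v = act 0 v + act 0 v"
    using assms unfolding acs_module_def by blast
  then show ?thesis by simp
qed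

text \<open>An action is multiplicative, additive and scalar on constants, so its values on the
  generators determine it, on words by induction on the length and then on sums. This is what makes
  the module structure unique once the scalars are fixed.\<close>

lemma acs_module_unique:
  assumes "acs_module scale act"
  shows "act (abs_acs_alg p) v = free_eval (\<lambda>g. act (acs_gen g)) p v"
proof -
  define f where "f = (\<lambda>g. act (acs_gen g))"
  have lin: "lin (f g)" for g
    using assms by (simp add: f_def acs_module_def)
  have word: "act (abs_acs_alg (Poly_Mapping.single (Word gs) 1)) u = word_op f (Word gs) u" for gs u
  proof (induction gs arbitrary: u)
    case Nil
    have "abs_acs_alg (Poly_Mapping.single (Word []) 1) = (1 :: 'a acs_alg)"
      by (simp add: one_acs_alg.abs_eq flip: zero_word_def)
    then show ?case using assms by (simp add: acs_module_def)
  next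
    case (Cons g gs)
    have "abs_acs_alg (Poly_Mapping.single (Word (g # gs)) 1) =
        acs_gen g * (abs_acs_alg (Poly_Mapping.single (Word gs) 1) :: 'a acs_alg)"
      by (simp add: acs_gen.abs_eq times_acs_alg.abs_eq free_gen_def mult_single)
    then show ?case using assms Cons by (simp add: acs_module_def f_def)
  qed
  have "act (abs_acs_alg p) v = free_eval f p v"
  proof (induction p rule: poly_mapping_single_induct)
    case zero
    then show ?case using acs_module_zero[OF assms] by (simp flip: zero_acs_alg.abs_eq)
  next
    case (single w c)
    have "abs_acs_alg (Poly_Mapping.single w c) = acs_const c * abs_acs_alg (Poly_Mapping.single w 1)"
      by (simp add: acs_const.abs_eq times_acs_alg.abs_eq free_const_def mult_single)
    then show ?case using assms word by (cases w) (simp add: acs_module_def free_eval_single)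
  next
    case (add p q)
    then show ?case
      using assms by (simp add: acs_module_def free_eval_add flip: plus_acs_alg.abs_eq)
  qed
  then show ?thesis by (simp add: f_def)
qed

lemma acs_module_eqI:
  assumes "acs_module scale act" "acs_module scale act'"
    and "\<And>g. act (acs_gen g) = act' (acs_gen g)"
  shows "act = act'"
proof (intro ext)
  fix a v
  show "act a v = act' a v"
    by (rule acs_alg_cases[of a]) (simp add: acs_module_unique assms(1,2) assms(3))
qed

text \<open>The relators represent 0 in the quotient and hence act as 0; expanding their action
  through the generators gives the three equations.\<close>

lemma acs_rels_acs_module:
  assumes "acs_module scale act"
  shows "acs_rels (\<lambda>g. act (acs_gen g))"
proof -
  have "act (abs_acs_alg p) v = 0" if "p \<in> rel_ideal" for p v
  proof -
    have "abs_acs_alg p = (0 :: 'a acs_alg)"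
      using that by (simp add: zero_acs_alg.abs_eq acs_alg.abs_eq_iff free_cong_def)
    then show ?thesis
      by (simp add: acs_module_zero[OF assms])
  qed
  moreover have "r \<in> rel_ideal" if "r \<in> relators" for r :: "'a free_alg"
    using rel_ideal_relator[OF that, of 1 1] by simp
  ultimately have rel: "free_eval (\<lambda>g. act (acs_gen g)) r v = 0" if "r \<in> relators" for r v
    using that acs_module_unique[OF assms] by metis
  have lin: "lin (act (acs_gen g))" for g
    using assms by (simp add: acs_module_def)
  have 2: "(2 :: 'a free_alg) = free_const 2"
    by (simp add: free_const_def single_numeral)
  note rels = rel[unfolded relators_def, simplified insert_iff empty_iff HOL.simp_thms]
  note ev = free_eval_diff free_eval_add free_eval_mult[OF lin] free_eval_gen 2 free_eval_const
  show ?thesis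
    unfolding acs_rels_def
    using rels[OF disjI1[OF refl]] rels[OF disjI2[OF disjI1[OF refl]]]
      rels[OF disjI2[OF disjI2[OF refl]]]
    by (simp add: ev)
qed

end

subsection \<open>Coordinates and tridiagonal matrices\<close>

definition tri_int :: "(int \<Rightarrow> int \<Rightarrow> 'k::field) \<Rightarrow> bool" where
  "tri_int M \<longleftrightarrow> (\<forall>i j. 1 < \<bar>i - j\<bar> \<longrightarrow> M i j = 0)"

definition irr_tri_int :: "nat \<Rightarrow> (int \<Rightarrow> int \<Rightarrow> 'k::field) \<Rightarrow> bool" where
  "irr_tri_int d M \<longleftrightarrow> tri_int M \<and> (\<forall>i. 0 \<le> i \<and> i < int d \<longrightarrow> M (i + 1) i \<noteq> 0 \<and> M i (i + 1) \<noteq> 0)"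

definition diag_int :: "(int \<Rightarrow> int \<Rightarrow> 'k::field) \<Rightarrow> bool" where
  "diag_int M \<longleftrightarrow> (\<forall>i j. i \<noteq> j \<longrightarrow> M i j = 0)"

lemma tri_intD: "tri_int M \<Longrightarrow> 1 < \<bar>i - j\<bar> \<Longrightarrow> M i j = 0"
  by (simp add: tri_int_def)

lemma diag_intD: "diag_int M \<Longrightarrow> i \<noteq> j \<Longrightarrow> M i j = 0"
  by (simp add: diag_int_def)

lemma diag_int_tri: "diag_int M \<Longrightarrow> tri_int M"
  by (auto simp: diag_int_def tri_int_def)

lemma irr_tri_int_tri: "irr_tri_int d M \<Longrightarrow> tri_int M"
  by (simp add: irr_tri_int_def)

text \<open>An eigenvector of an irreducible tridiagonal matrix is determined by its first coordinate;
  here the columns of \<open>D\<close> are eigenvectors and its rows are left eigenvectors.\<close>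

lemma irr_tri_eigen_corner_zero:
  fixes A D :: "int \<Rightarrow> int \<Rightarrow> 'k::field"
  assumes irr: "irr_tri_int d A"
    and supp: "\<And>i j. \<not> (0 \<le> i \<and> i \<le> int d \<and> 0 \<le> j \<and> j \<le> int d) \<Longrightarrow> D i j = 0"
    and AD: "\<And>i j. A i (i - 1) * D (i - 1) j + A i i * D i j + A i (i + 1) * D (i + 1) j = t * D i j"
    and DA: "\<And>i j. D i (j - 1) * A (j - 1) j + D i j * A j j + D i (j + 1) * A (j + 1) j = t * D i j"
    and corner: "D 0 (int d) = 0"
  shows "D i j = 0"
proof -
  \<comment> \<open>The last column is computed from the top: row \<open>m\<close> of the equation
    \<open>AD\<close> expresses entry \<open>m + 1\<close> through the two entries above it, because
    the superdiagonal of \<open>A\<close> does not vanish.\<close>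
  have col: "D (int n) (int d) = 0" for n
  proof (induction n rule: less_induct)
    case (less n)
    show ?case
    proof (cases "n = 0 \<or> d < n")
      case True
      then show ?thesis using corner supp by auto
    next
      case False
      then obtain m where n: "n = Suc m" by (cases n) auto
      have "D (int m - 1) (int d) = 0"
        using less.IH[of "m - 1"] supp n by (cases m) auto
      then have "A (int m) (int m + 1) * D (int m + 1) (int d) = 0"
        using AD[of "int m" "int d"] less.IH[of m] n by simp
      moreover have "A (int m) (int m + 1) \<noteq> 0"
        using irr False n unfolding irr_tri_int_def by simp
      ultimately show ?thesis using n by (simp add: add.commute)
    qed
  qed
  \<comment> \<open>Each row now ends in 0 and is solved from right to left by \<open>DA\<close> in
    the same way.\<close>
  have row: "D i (int d - int n) = 0" if i: "0 \<le> i" for i n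
  proof (induction n rule: less_induct)
    case (less n)
    show ?case
    proof (cases "n = 0 \<or> d < n")
      case True
      then show ?thesis using col[of "nat i"] i supp by auto
    next
      case False
      then obtain m where n: "n = Suc m" by (cases n) auto
      have "D i (int d - int m + 1) = 0"
        using less.IH[of "m - 1"] supp n by (cases m) auto
      then have "D i (int d - int m - 1) * A (int d - int m - 1) (int d - int m) = 0"
        using DA[of i "int d - int m"] less.IH[of m] n by simp
      moreover have "A (int d - int m - 1) (int d - int m) \<noteq> 0"
        using irr[unfolded irr_tri_int_def, THEN conjunct2, rule_format, of "int d - int m - 1"]
          False n by simp
      ultimately show ?thesis using n by (simp add: algebra_simps)
    qed
  qed
  show ?thesis
    using row[of i "nat (int d - j)"] supp[of i j]
    by (cases "0 \<le> i \<and> i \<le> int d \<and> 0 \<le> j \<and> j \<le> int d") auto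
qed

section \<open>Coordinates with respect to an indexed basis\<close>

locale vbasis = vspace scale
  for scale :: "'a::field \<Rightarrow> 'b::ab_group_add \<Rightarrow> 'b" +
  fixes d :: nat and v :: "nat \<Rightarrow> 'b"
  assumes indexed_basis: "indexed_basis scale d v"
begin

definition co :: "'b \<Rightarrow> nat \<Rightarrow> 'a" where
  "co x i = representation (v ` {..d}) x (v i)"

lemma inj_v: "inj_on v {..d}" and indep_v: "independent (v ` {..d})"
  and span_v: "span (v ` {..d}) = UNIV"
  using indexed_basis by (auto simp: indexed_basis_def)

lemma co_add [simp]: "co (x + y) i = co x i + co y i"
  by (simp add: co_def representation_add indep_v span_v)

lemma co_scale [simp]: "co (scale c x) i = c * co x i"
  by (simp add: co_def representation_scale indep_v span_v)

lemma co_diff [simp]: "co (x - y) i = co x i - co y i"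
  by (simp add: co_def representation_diff indep_v span_v)

lemma co_0 [simp]: "co 0 i = 0"
  by (simp add: co_def representation_zero)

lemma co_sum [simp]: "co (sum f S) i = (\<Sum>s\<in>S. co (f s) i)"
  by (induction S rule: infinite_finite_induct) auto

lemma co_basis: "i \<le> d \<Longrightarrow> j \<le> d \<Longrightarrow> co (v j) i = (if i = j then 1 else 0)"
  using inj_v by (auto simp: co_def representation_basis indep_v inj_on_eq_iff)

lemma expand: "x = (\<Sum>i\<le>d. scale (co x i) (v i))"
proof -
  have "x = (\<Sum>b\<in>v ` {..d}. scale (representation (v ` {..d}) x b) b)"
    by (rule sum_representation_eq[symmetric]) (simp_all add: indep_v span_v)
  also have "\<dots> = (\<Sum>i\<le>d. scale (co x i) (v i))"
    by (simp add: sum.reindex inj_v co_def)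
  finally show ?thesis .
qed

lemma co_eqI: "(\<And>i. i \<le> d \<Longrightarrow> co x i = co y i) \<Longrightarrow> x = y"
  using expand[of x] expand[of y] by simp

lemma mat_of_co: "mat_of scale d v X i j = co (X (v j)) i"
  by (simp add: mat_of_def co_def)

lemma lin_sum: "lin X \<Longrightarrow> X (sum f S) = (\<Sum>s\<in>S. X (f s))"
  by (induction S rule: infinite_finite_induct) (auto simp: lin_0 lin_iff)

lemma co_lin: "lin X \<Longrightarrow> co (X x) i = (\<Sum>j\<le>d. mat_of scale d v X i j * co x j)"
  by (subst expand[of x]) (simp add: lin_sum lin_iff mat_of_co mult.commute)

text \<open>The matrix of \<open>X\<close>, extended by zero to all integer indices, so that products of tridiagonal
  matrices need no case distinction at the boundary.\<close>

definition M :: "('b \<Rightarrow> 'b) \<Rightarrow> int \<Rightarrow> int \<Rightarrow> 'a" where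
  "M X i j = (if 0 \<le> i \<and> i \<le> int d \<and> 0 \<le> j \<and> j \<le> int d then mat_of scale d v X (nat i) (nat j) else 0)"

lemma M_outside: "\<not> (0 \<le> i \<and> i \<le> int d \<and> 0 \<le> j \<and> j \<le> int d) \<Longrightarrow> M X i j = 0"
  by (auto simp: M_def)

lemma M_add: "M (\<lambda>x. X x + Y x) i j = M X i j + M Y i j"
  and M_diff: "M (\<lambda>x. X x - Y x) i j = M X i j - M Y i j"
  and M_scale: "M (\<lambda>x. scale c (X x)) i j = c * M X i j"
  by (simp_all add: M_def mat_of_co)

lemma M_eqI:
  assumes "lin X" "lin Y" "\<And>i j. M X i j = M Y i j"
  shows "X = Y"
proof
  fix x
  have "mat_of scale d v X i j = mat_of scale d v Y i j" if "i \<le> d" "j \<le> d" for i j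
    using assms(3)[of "int i" "int j"] that by (simp add: M_def)
  then show "X x = Y x"
    by (intro co_eqI) (simp add: co_lin assms(1,2))
qed

lemma M_comp:
  assumes "lin X"
  shows "M (\<lambda>x. X (Y x)) i j = (\<Sum>k\<in>{0..int d}. M X i k * M Y k j)"
proof (cases "0 \<le> i \<and> i \<le> int d \<and> 0 \<le> j \<and> j \<le> int d")
  case True
  have "(\<Sum>k\<in>{0..int d}. M X i k * M Y k j) = (\<Sum>k\<in>int ` {..d}. M X i k * M Y k j)"
    by (simp add: atMost_atLeast0 image_int_atLeastAtMost)
  also have "\<dots> = (\<Sum>k\<le>d. mat_of scale d v X (nat i) k * co (Y (v (nat j))) k)"
    using True by (simp add: sum.reindex M_def mat_of_co)
  finally show ?thesis
    using True by (simp add: M_def mat_of_co[of "\<lambda>x. X (Y x)"] co_lin[OF assms])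
qed (auto simp: M_outside)

text \<open>Since \<open>f\<close> vanishes outside \<open>{0..int d}\<close>, the range may be
  enlarged by \<open>i - 1\<close> and \<open>i + 1\<close> even where these leave it, and then cut
  down to three indices.\<close>

lemma sum_three:
  fixes f :: "int \<Rightarrow> 'a"
  assumes "\<And>k. k \<notin> {0..int d} \<Longrightarrow> f k = 0" "\<And>k. 1 < \<bar>i - k\<bar> \<Longrightarrow> f k = 0"
  shows "(\<Sum>k\<in>{0..int d}. f k) = f (i - 1) + f i + f (i + 1)"
proof -
  have "(\<Sum>k\<in>{0..int d}. f k) = (\<Sum>k\<in>{0..int d} \<union> {i - 1, i, i + 1}. f k)"
    using assms(1) by (intro sum.mono_neutral_left) auto
  also have "\<dots> = (\<Sum>k\<in>{i - 1, i, i + 1}. f k)"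
  proof (intro sum.mono_neutral_right ballI)
    fix k assume "k \<in> {0..int d} \<union> {i - 1, i, i + 1} - {i - 1, i, i + 1}"
    then have "1 < \<bar>i - k\<bar>" by auto
    then show "f k = 0" by (rule assms(2))
  qed auto
  finally show ?thesis by (simp add: algebra_simps)
qed

lemma M_comp_tri_left:
  assumes "lin X" "tri_int (M X)"
  shows "M (\<lambda>x. X (Y x)) i j =
    M X i (i - 1) * M Y (i - 1) j + M X i i * M Y i j + M X i (i + 1) * M Y (i + 1) j"
proof (subst M_comp[OF assms(1)], rule sum_three[where f = "\<lambda>k. M X i k * M Y k j" and i = i])
  show "M X i k * M Y k j = 0" if "k \<notin> {0..int d}" for k
    using that M_outside[of i k X] by auto
  show "M X i k * M Y k j = 0" if "1 < \<bar>i - k\<bar>" for k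
    using that tri_intD[OF assms(2), of i k] by auto
qed

lemma M_comp_tri_right:
  assumes "lin X" "tri_int (M Y)"
  shows "M (\<lambda>x. X (Y x)) i j =
    M X i (j - 1) * M Y (j - 1) j + M X i j * M Y j j + M X i (j + 1) * M Y (j + 1) j"
proof (subst M_comp[OF assms(1)], rule sum_three[where f = "\<lambda>k. M X i k * M Y k j" and i = j])
  show "M X i k * M Y k j = 0" if "k \<notin> {0..int d}" for k
    using that M_outside[of i k X] by auto
  show "M X i k * M Y k j = 0" if "1 < \<bar>j - k\<bar>" for k
    using that tri_intD[OF assms(2), of k j] by auto
qed

lemma M_comp_diag_left:
  assumes "lin X" "diag_int (M X)"
  shows "M (\<lambda>x. X (Y x)) i j = M X i i * M Y i j"
  using M_comp_tri_left[OF assms(1) diag_int_tri[OF assms(2)], of Y i j]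
  by (simp add: diag_intD[OF assms(2)])

lemma M_comp_diag_right:
  assumes "lin X" "diag_int (M Y)"
  shows "M (\<lambda>x. X (Y x)) i j = M X i j * M Y j j"
  using M_comp_tri_right[OF assms(1) diag_int_tri[OF assms(2)], of i j]
  by (simp add: diag_intD[OF assms(2)])

lemma M_nat: "i \<le> d \<Longrightarrow> j \<le> d \<Longrightarrow> M X (int i) (int j) = mat_of scale d v X i j"
  by (simp add: M_def)

lemma diag_int_M: "diagonal_mat d (mat_of scale d v X) \<Longrightarrow> diag_int (M X)"
  by (auto simp: diagonal_mat_def diag_int_def M_def)

lemma irr_tri_int_M:
  assumes "irreducible_tridiagonal_mat d (mat_of scale d v X)"
  shows "irr_tri_int d (M X)"
proof -
  have "M X i j = 0" if "1 < \<bar>i - j\<bar>" for i j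
  proof -
    have "nat i + 1 < nat j \<or> nat j + 1 < nat i" if "0 \<le> i" "0 \<le> j"
      using that \<open>1 < \<bar>i - j\<bar>\<close> by linarith
    then show ?thesis
      using assms unfolding M_def irreducible_tridiagonal_mat_def tridiagonal_mat_def by auto
  qed
  moreover have "M X (i + 1) i \<noteq> 0 \<and> M X i (i + 1) \<noteq> 0" if "0 \<le> i" "i < int d" for i
    using that assms by (auto simp: M_def irreducible_tridiagonal_mat_def nat_add_distrib)
  ultimately show ?thesis by (simp add: irr_tri_int_def tri_int_def)
qed

end

section \<open>The cubic relation between two maps\<close>

lemma (in vspace) lin_comp: "lin X \<Longrightarrow> lin Y \<Longrightarrow> lin (\<lambda>x. X (Y x))"
  by (simp add: lin_iff)
lemma (in vspace) lin_add: "lin X \<Longrightarrow> lin Y \<Longrightarrow> lin (\<lambda>x. X x + Y x)"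
  by (simp add: lin_iff scale_right_distrib add_ac)
lemma (in vspace) lin_diff: "lin X \<Longrightarrow> lin Y \<Longrightarrow> lin (\<lambda>x. X x - Y x)"
  by (simp add: lin_iff scale_right_diff_distrib)
lemma (in vspace) lin_scale: "lin X \<Longrightarrow> lin (\<lambda>x. scale c (X x))"
  by (simp add: lin_iff scale_right_distrib mult.commute)
lemma (in vspace) lin_zero: "lin (\<lambda>x. 0)"
  by (simp add: lin_iff)

text \<open>The hypothesis is the quotient condition with value -1 after clearing the denominator;
  read as a statement on sums of neighbours, it says that they have period two.\<close>

lemma bannai_ito_sums:
  fixes \<theta> :: "int \<Rightarrow> 'k::field"
  assumes "\<And>i. 2 \<le> i \<Longrightarrow> i + 1 \<le> int d \<Longrightarrow> \<theta> (i - 2) + \<theta> (i - 1) = \<theta> i + \<theta> (i + 1)"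
    and "n < d"
  shows "\<theta> (int n) + \<theta> (int n + 1) = (if even n then \<theta> 0 + \<theta> 1 else \<theta> 1 + \<theta> 2)"
  using assms(2)
proof (induction n rule: nat_less_induct)
  case (1 n)
  consider "n = 0" | "n = 1" | m where "n = Suc (Suc m)"
    by (metis One_nat_def not0_implies_Suc)
  then show ?case
  proof cases
    case 3
    then show ?thesis
      using 1 assms(1)[of "int m + 2"] by (simp add: algebra_simps)
  qed auto
qed

text \<open>In the first basis the cubic expression \<open>D\<close> vanishes off the diagonal, and on it except for one
  place, so that \<open>A D = D A = \<theta>\<^sub>p D\<close>; in the second basis \<open>D\<close> has too small a bandwidth to
  have a nonzero corner entry.\<close>

lemma (in vspace) half_askey_wilson:
  fixes A B :: "'b \<Rightarrow> 'b"
  assumes "vbasis scale d v" "vbasis scale d w" and linA: "lin A" and linB: "lin B" and d: "3 \<le> d"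
    and dA: "diag_int (vbasis.M scale d v A)" and tB: "irr_tri_int d (vbasis.M scale d v B)"
    and dB: "diag_int (vbasis.M scale d w B)" and tA: "irr_tri_int d (vbasis.M scale d w A)"
    and th: "\<And>i. \<theta> i = vbasis.M scale d v A i i"
    and bi: "\<And>i. 2 \<le> i \<Longrightarrow> i + 1 \<le> int d \<Longrightarrow> \<theta> (i - 2) + \<theta> (i - 1) = \<theta> i + \<theta> (i + 1)"
    and p: "\<And>i. i \<noteq> p \<Longrightarrow> vbasis.M scale d v B i i = 0"
  defines "s1 \<equiv> \<theta> 0 + \<theta> 1" and "s2 \<equiv> \<theta> 1 + \<theta> 2"
  shows "A (A (B x)) + scale 2 (A (B (A x))) + B (A (A x))
      - scale (s1 + s2) (A (B x) + B (A x)) + scale (s1 * s2) (B x) = 0" (is "?D x = 0")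
    and "vbasis.M scale d w B 0 0 + 2 * vbasis.M scale d w B 1 1 + vbasis.M scale d w B 2 2 = 0"
proof -
  interpret V: vbasis scale d v by fact
  interpret W: vbasis scale d w by fact
  note tA' = irr_tri_int_tri[OF tA]
  define D where "D = ?D"
  have linD: "lin D"
    unfolding D_def
    by (rule lin_add[OF lin_diff[OF lin_add[OF lin_add[OF
            lin_comp[OF linA lin_comp[OF linA linB]]
            lin_scale[OF lin_comp[OF linA lin_comp[OF linB linA]]]]
            lin_comp[OF linB lin_comp[OF linA linA]]]
            lin_scale[OF lin_add[OF lin_comp[OF linA linB] lin_comp[OF linB linA]]]]
          lin_scale[OF linB]])
  note VA = V.M_comp_diag_left[OF linA dA, of "\<lambda>x. A (B x)"]
      V.M_comp_diag_left[OF linA dA, of "\<lambda>x. B (A x)"] V.M_comp_diag_left[OF linA dA, of B]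
    and VBA = V.M_comp_diag_right[OF linB dA]
    and VBAA = V.M_comp_diag_right[OF lin_comp[OF linB linA] dA]
    and WA = W.M_comp_tri_left[OF linA tA', of "\<lambda>x. A (B x)"]
      W.M_comp_tri_left[OF linA tA', of "\<lambda>x. B (A x)"] W.M_comp_tri_left[OF linA tA', of A]
      W.M_comp_tri_left[OF linA tA', of B]
    and WB = W.M_comp_diag_left[OF linB dB, of A] W.M_comp_diag_left[OF linB dB, of "\<lambda>x. A (A x)"]
  \<comment> \<open>In an eigenbasis of \<open>A\<close>, multiplication by \<open>A\<close> from
    the left and from the right is by \<open>\<theta> i\<close> and \<open>\<theta> j\<close>, so
    the expression is a quadratic polynomial in \<open>\<theta> i + \<theta> j\<close>; its
    coefficients were chosen to give the roots \<open>s1\<close> and \<open>s2\<close>.\<close>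
  have VM: "V.M D i j = (\<theta> i + \<theta> j - s1) * (\<theta> i + \<theta> j - s2) * V.M B i j" for i j
    unfolding D_def V.M_add V.M_diff V.M_scale VA VBA VBAA th by (simp add: algebra_simps)
  have VD: "V.M D i j = 0" if ij: "i \<noteq> p \<or> j \<noteq> p" for i j
  proof (cases "0 \<le> i \<and> i \<le> int d \<and> 0 \<le> j \<and> j \<le> int d \<and> \<bar>i - j\<bar> \<le> 1 \<and> i \<noteq> j")
    case False
    then consider "\<not> (0 \<le> i \<and> i \<le> int d \<and> 0 \<le> j \<and> j \<le> int d)" | "1 < \<bar>i - j\<bar>" | "i = j" "i \<noteq> p"
      using ij by (cases "i = j") auto
    then have "V.M B i j = 0"
      by cases (auto simp: V.M_outside tri_intD[OF irr_tri_int_tri[OF tB]] p)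
    then show ?thesis by (simp add: VM)
  next
    case True
    define n where "n = nat (min i j)"
    have "(i = int n \<and> j = int n + 1) \<or> (j = int n \<and> i = int n + 1)" "n < d"
      using True by (auto simp: n_def)
    then have "\<theta> i + \<theta> j = s1 \<or> \<theta> i + \<theta> j = s2"
      using bannai_ito_sums[of d \<theta> n, OF bi] by (auto simp: s1_def s2_def add.commute)
    then show ?thesis by (auto simp: VM)
  qed
  have AD: "(\<lambda>x. A (D x)) = (\<lambda>x. scale (\<theta> p) (D x))"
  proof (rule V.M_eqI[OF lin_comp[OF linA linD] lin_scale[OF linD]])
    show "V.M (\<lambda>x. A (D x)) i j = V.M (\<lambda>x. scale (\<theta> p) (D x)) i j" for i j
      using VD[of i j] by (cases "i = p") (auto simp: V.M_comp_diag_left[OF linA dA, of D] V.M_scale th)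
  qed
  have DA: "(\<lambda>x. D (A x)) = (\<lambda>x. scale (\<theta> p) (D x))"
  proof (rule V.M_eqI[OF lin_comp[OF linD linA] lin_scale[OF linD]])
    show "V.M (\<lambda>x. D (A x)) i j = V.M (\<lambda>x. scale (\<theta> p) (D x)) i j" for i j
      using VD[of i j] by (cases "j = p") (auto simp: V.M_comp_diag_right[OF linD dA] V.M_scale th)
  qed
  have corner: "W.M D 0 (int d) = 0"
    unfolding D_def W.M_add W.M_diff W.M_scale WA WB
    using d by (simp add: tri_intD[OF tA'] diag_intD[OF dB])
  have WD: "W.M D i j = 0" for i j
  proof (rule irr_tri_eigen_corner_zero[where D = "W.M D" and t = "\<theta> p", OF tA])
    show "W.M D i j = 0" if "\<not> (0 \<le> i \<and> i \<le> int d \<and> 0 \<le> j \<and> j \<le> int d)" for i j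
      using that by (rule W.M_outside)
    show "W.M A i (i - 1) * W.M D (i - 1) j + W.M A i i * W.M D i j + W.M A i (i + 1) * W.M D (i + 1) j
        = \<theta> p * W.M D i j" for i j
      using W.M_comp_tri_left[OF linA tA', of D i j] unfolding AD W.M_scale by (rule sym)
    show "W.M D i (j - 1) * W.M A (j - 1) j + W.M D i j * W.M A j j + W.M D i (j + 1) * W.M A (j + 1) j
        = \<theta> p * W.M D i j" for i j
      using W.M_comp_tri_right[OF linD tA', of i j] unfolding DA W.M_scale by (rule sym)
  qed (rule corner)
  have "D = (\<lambda>x. 0)"
    using WD by (intro W.M_eqI linD lin_zero) (auto simp: W.M_def W.mat_of_co)
  then show "?D x = 0" unfolding D_def by (rule fun_cong)
  \<comment> \<open>At position \<open>(0, 2)\<close> only the terms quadratic in \<open>A\<close>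
    contribute, and each of them runs along the path 0, 1, 2. The weights 1, 2, 1 belong to the
    three places at which the diagonal \<open>B\<close> can stand.\<close>
  have "W.M A 0 1 * W.M A 1 2 * (W.M B 0 0 + 2 * W.M B 1 1 + W.M B 2 2) = W.M D 0 2"
    unfolding D_def W.M_add W.M_diff W.M_scale WA WB
    by (simp add: tri_intD[OF tA'] diag_intD[OF dB] algebra_simps)
  moreover have "W.M A 0 1 \<noteq> 0" "W.M A 1 2 \<noteq> 0"
    using tA d by (auto simp: irr_tri_int_def dest: spec[of _ 0] spec[of _ 1])
  ultimately show "W.M B 0 0 + 2 * W.M B 1 1 + W.M B 2 2 = 0"
    using WD by simp
qed

subsection \<open>The spectrum in the normalised basis\<close>

text \<open>The matrix product for a tridiagonal left factor. In \<open>cubic\<close> every left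
  factor is \<open>P\<close> or \<open>Q\<close>, so three terms suffice although the right factors
  have wider bands.\<close>

definition mm :: "(int \<Rightarrow> int \<Rightarrow> 'k::field) \<Rightarrow> (int \<Rightarrow> int \<Rightarrow> 'k) \<Rightarrow> int \<Rightarrow> int \<Rightarrow> 'k" where
  "mm P Q i j = P i (i - 1) * Q (i - 1) j + P i i * Q i j + P i (i + 1) * Q (i + 1) j"

text \<open>The double anticommutator {P, {P, Q}}, expanded.\<close>

definition cubic :: "(int \<Rightarrow> int \<Rightarrow> 'k::field) \<Rightarrow> (int \<Rightarrow> int \<Rightarrow> 'k) \<Rightarrow> int \<Rightarrow> int \<Rightarrow> 'k" where
  "cubic P Q i j = mm P (mm P Q) i j + 2 * mm P (mm Q P) i j + mm Q (mm P P) i j"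

lemma cubic_diag:
  assumes dA: "diag_int A" and tB: "tri_int B"
  shows
  "cubic B A i i = 2 * (A (i - 1) (i - 1) + A i i) * (B i (i - 1) * B (i - 1) i) +
    2 * (A i i + A (i + 1) (i + 1)) * (B (i + 1) i * B i (i + 1)) + 4 * A i i * (B i i)\<^sup>2"
  by (simp add: cubic_def mm_def diag_intD[OF dA] tri_intD[OF tB] algebra_simps power2_eq_square)

lemma cubic_subdiag:
  assumes dA: "diag_int A" and tB: "tri_int B"
  shows
  "cubic B A (i + 1) i = B (i + 1) i *
    (B i i * (3 * A i i + A (i + 1) (i + 1)) + B (i + 1) (i + 1) * (A i i + 3 * A (i + 1) (i + 1)))"
  by (simp add: cubic_def mm_def diag_intD[OF dA] tri_intD[OF tB] algebra_simps)

lemma cubic_far_down: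
  assumes tB: "tri_int B" and tC: "tri_int C"
  shows
  "cubic B C (i + 3) i = B (i + 3) (i + 2) * B (i + 2) (i + 1) * C (i + 1) i +
     2 * B (i + 3) (i + 2) * C (i + 2) (i + 1) * B (i + 1) i +
     C (i + 3) (i + 2) * B (i + 2) (i + 1) * B (i + 1) i"
  by (simp add: cubic_def mm_def tri_intD[OF tB] tri_intD[OF tC] algebra_simps)

lemma cubic_far_up:
  assumes tB: "tri_int B" and tC: "tri_int C"
  shows
  "cubic B C i (i + 3) = B i (i + 1) * B (i + 1) (i + 2) * C (i + 2) (i + 3) +
     2 * B i (i + 1) * C (i + 1) (i + 2) * B (i + 2) (i + 3) +
     C i (i + 1) * B (i + 1) (i + 2) * B (i + 2) (i + 3)"
  by (simp add: cubic_def mm_def tri_intD[OF tB] tri_intD[OF tC] algebra_simps)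

text \<open>With alternating sums, the diagonal entries of \<open>rel\<close> are a first-order
  recurrence for the products of opposite off-diagonal entries of \<open>B\<close>. The missing
  neighbour of index 0 starts it, and the missing neighbour of \<open>d\<close> closes it with a
  condition on \<open>m\<close> and \<open>e\<close>.\<close>

lemma bannai_ito_spectrum:
  fixes A B :: "int \<Rightarrow> int \<Rightarrow> 'k::field_char_0"
  assumes dA: "diag_int A" and irrB: "irr_tri_int d B" and d: "1 \<le> d"
    and supp: "B 0 (-1) = 0" "B (int d + 1) (int d) = 0"
    and sums': "\<forall>n<d. A (int n) (int n) + A (int n + 1) (int n + 1) = (- 1) ^ n * s"
    and s: "s \<noteq> 0" and rho: "\<rho> \<noteq> 0"
    and B0': "\<forall>i. i \<noteq> int d \<longrightarrow> B i i = 0"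
    and rel: "\<And>i j. cubic B A i j = \<rho> * A i j"
  defines "m \<equiv> 2 * A 0 0 / s" and "e \<equiv> B (int d) (int d)"
  shows "\<And>n. n \<le> d \<Longrightarrow> A (int n) (int n) = (- 1) ^ n * (s / 2) * (m - 2 * of_nat n)"
    and "\<And>n. n < d \<Longrightarrow> B (int n + 1) (int n) * B (int n) (int n + 1) =
        \<rho> / 4 * of_nat (n + 1) * (m - of_nat n)"
    and "e = 0 \<Longrightarrow> m = of_nat d"
    and "e \<noteq> 0 \<Longrightarrow> m = 2 * of_nat d + 1 \<and> e\<^sup>2 = \<rho> / 4 * (of_nat (d + 1))\<^sup>2"
proof -
  note sums = sums'[rule_format] and B0 = B0'[rule_format]
  define q where "q n = B (int n + 1) (int n) * B (int n) (int n + 1)" for n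
  note tB = irr_tri_int_tri[OF irrB]
  show th: "A (int n) (int n) = (- 1) ^ n * (s / 2) * (m - 2 * of_nat n)" if "n \<le> d" for n
    using that
  proof (induction n)
    case 0
    then show ?case using s by (simp add: m_def)
  next
    case (Suc n)
    have "A (int (Suc n)) (int (Suc n)) = (- 1) ^ n * s - A (int n) (int n)"
      using sums[of n] Suc.prems by (simp add: algebra_simps)
    also have "\<dots> = (- 1) ^ n * s - (- 1) ^ n * (s / 2) * (m - 2 * of_nat n)"
      using Suc by simp
    also have "\<dots> = (- 1) ^ Suc n * (s / 2) * (m - 2 * of_nat (Suc n))"
      by (simp add: field_simps)
    finally show ?case .
  qed
  have q: "q n = \<rho> / 4 * of_nat (n + 1) * (m - of_nat n)" if "n < d" for n
    using that
  proof (induction n)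
    case 0
    have "2 * s * q 0 = \<rho> * A 0 0"
    proof -
      have "A 0 0 + A 1 1 = s" using sums[of 0] 0 by simp
      moreover have "\<rho> * A 0 0 = 2 * (A 0 0 + A 1 1) * q 0"
        using cubic_diag[OF dA tB, of 0] rel[of 0 0] supp(1) B0[of 0] 0 by (simp add: q_def)
      ultimately show ?thesis by simp
    qed
    then show ?case using s by (simp add: m_def field_simps)
  next
    case (Suc n)
    have "2 * ((- 1) ^ n * s) * q n - 2 * ((- 1) ^ n * s) * q (Suc n) =
        \<rho> * A (int n + 1) (int n + 1)"
    proof -
      have "A (int n) (int n) + A (int n + 1) (int n + 1) = (- 1) ^ n * s"
        using sums[of n] Suc.prems by simp
      moreover have "A (int n + 1) (int n + 1) + A (int n + 2) (int n + 2) = - ((- 1) ^ n * s)"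
        using sums[of "Suc n"] Suc.prems by (simp add: add_ac)
      moreover have "\<rho> * A (int n + 1) (int n + 1) =
          2 * (A (int n) (int n) + A (int n + 1) (int n + 1)) * q n +
          2 * (A (int n + 1) (int n + 1) + A (int n + 2) (int n + 2)) * q (Suc n)"
        using cubic_diag[OF dA tB, of "int n + 1"] rel[of "int n + 1" "int n + 1"]
          B0[of "int n + 1"] Suc.prems
        by (simp add: q_def add_ac)
      ultimately show ?thesis by simp
    qed
    also have "A (int n + 1) (int n + 1) = - ((- 1) ^ n * (s / 2) * (m - 2 * of_nat n - 2))"
      using th[of "Suc n"] Suc.prems by (simp add: algebra_simps)
    finally have "(- 1) ^ n * (s * (4 * (q n - q (Suc n)) + \<rho> * (m - 2 * of_nat n - 2))) = 0"
      by (simp add: field_simps)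
    then have "s * (4 * (q n - q (Suc n)) + \<rho> * (m - 2 * of_nat n - 2)) = 0"
      by simp
    then have "4 * (q n - q (Suc n)) + \<rho> * (m - 2 * of_nat n - 2) = 0"
      using s by simp
    then have "q (Suc n) = q n + \<rho> / 4 * (m - 2 * of_nat n - 2)"
      by (simp add: field_simps)
    also have "q n = \<rho> / 4 * of_nat (n + 1) * (m - of_nat n)"
      using Suc by simp
    also have "\<rho> / 4 * of_nat (n + 1) * (m - of_nat n) + \<rho> / 4 * (m - 2 * of_nat n - 2) =
        \<rho> / 4 * of_nat (Suc n + 1) * (m - of_nat (Suc n))"
      by (simp add: field_simps)
    finally show ?case .
  qed
  then show "\<And>n. n < d \<Longrightarrow> B (int n + 1) (int n) * B (int n) (int n + 1) =
        \<rho> / 4 * of_nat (n + 1) * (m - of_nat n)"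
    by (simp add: q_def)
  obtain k where k: "d = Suc k" using d by (cases d) auto
  have thd: "A (int d) (int d) = - ((- 1) ^ k * (s / 2) * (m - 2 * of_nat k - 2))"
    using th[of d] k by (simp add: algebra_simps)
  \<comment> \<open>The closing equation: at \<open>d\<close> there is no product
    \<open>q d\<close>, but the square of the end entry contributes.\<close>
  have "2 * ((- 1) ^ k * s) * q k + 4 * A (int d) (int d) * e\<^sup>2 = \<rho> * A (int d) (int d)"
  proof -
    have "A (int k) (int k) + A (int k + 1) (int k + 1) = (- 1) ^ k * s"
      using sums[of k] k by simp
    moreover have "\<rho> * A (int d) (int d) =
        2 * (A (int k) (int k) + A (int k + 1) (int k + 1)) * q k + 4 * A (int d) (int d) * e\<^sup>2"
      using cubic_diag[OF dA tB, of "int d"] rel[of "int d" "int d"] supp(2) k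
      by (simp add: q_def e_def add_ac)
    ultimately show ?thesis by simp
  qed
  then have rel_d: "2 * ((- 1) ^ k * s) * q k + 4 * A (int d) (int d) * e\<^sup>2 - \<rho> * A (int d) (int d) = 0"
    by simp
  define X where "X = 4 * q k - 4 * (m - 2 * of_nat k - 2) * e\<^sup>2 + \<rho> * (m - 2 * of_nat k - 2)"
  have "(- 1) ^ k * (s * X) =
      2 * (2 * ((- 1) ^ k * s) * q k + 4 * A (int d) (int d) * e\<^sup>2 - \<rho> * A (int d) (int d))"
    unfolding thd X_def by (simp add: field_simps)
  then have "X = 0"
    using s rel_d by simp
  then have last: "4 * q k - 4 * (m - 2 * of_nat k - 2) * e\<^sup>2 + \<rho> * (m - 2 * of_nat k - 2) = 0"
    by (simp only: X_def)
  have qk: "4 * q k = \<rho> * (of_nat k + 1) * (m - of_nat k)"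
    using q[of k] k by (simp add: field_simps)
  show "m = of_nat d" if "e = 0"
  proof -
    \<comment> \<open>For \<open>e = 0\<close>, inserting the closed form of \<open>q k\<close>
      makes the closing equation factor; the factor \<open>of_nat k + 2\<close> is nonzero in
      characteristic zero.\<close>
    have "\<rho> * ((of_nat k + 2) * (m - of_nat k - 1)) = 0"
    proof -
      have "\<rho> * ((of_nat k + 2) * (m - of_nat k - 1)) =
          \<rho> * (of_nat k + 1) * (m - of_nat k) + \<rho> * (m - 2 * of_nat k - 2)"
        by (simp add: algebra_simps)
      also have "\<dots> = 0"
        using last that by (simp flip: qk)
      finally show ?thesis .
    qed
    moreover have "(of_nat k + 2 :: 'k) \<noteq> 0"
      by (metis of_nat_add of_nat_numeral of_nat_eq_0_iff add_is_0 zero_neq_numeral)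
    ultimately have "m - of_nat k - 1 = 0"
      using rho by (metis mult_eq_0_iff)
    then show ?thesis using k by (simp add: algebra_simps)
  qed
  show "m = 2 * of_nat d + 1 \<and> e\<^sup>2 = \<rho> / 4 * (of_nat (d + 1))\<^sup>2" if "e \<noteq> 0"
  proof -
    \<comment> \<open>Entry \<open>(d, d - 1)\<close> of the relation: its right side is zero
      because \<open>A\<close> is diagonal, and \<open>B\<close> has no diagonal entry at
      \<open>k\<close>. Thus a nonzero \<open>e\<close> ties the last two eigenvalues together and
      fixes \<open>m\<close>; the closing equation then gives \<open>e\<^sup>2\<close>.\<close>
    have "B (int d) (int k) * (e * (A (int k) (int k) + 3 * A (int d) (int d))) = 0"
      using cubic_subdiag[OF dA tB, of "int k"] rel[of "int d" "int k"] B0[of "int k"] k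
        diag_intD[OF dA, of "int d" "int k"]
      by (simp add: e_def add_ac)
    moreover have "B (int d) (int k) \<noteq> 0"
      using irrB k by (auto simp: irr_tri_int_def add_ac dest: spec[of _ "int k"])
    ultimately have "A (int k) (int k) + 3 * A (int d) (int d) = 0"
      using that by simp
    moreover have "A (int k) (int k) = (- 1) ^ k * (s / 2) * (m - 2 * of_nat k)"
      using th[of k] k by simp
    then have "(- 1) ^ k * (s * (m - 2 * of_nat k - 3)) = - (A (int k) (int k) + 3 * A (int d) (int d))"
      unfolding thd by (simp add: field_simps)
    ultimately have "(- 1) ^ k * (s * (m - 2 * of_nat k - 3)) = 0"
      by simp
    then have m: "m = 2 * of_nat k + 3" using s by (simp add: diff_eq_eq add.commute)
    have "4 * e\<^sup>2 = 4 * q k + \<rho>"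
      using last unfolding m by (simp add: algebra_simps)
    also have "\<dots> = \<rho> * (of_nat (d + 1))\<^sup>2"
      unfolding qk m k by (simp add: algebra_simps power2_eq_square)
    finally show ?thesis using m k by (simp add: field_simps)
  qed
qed

section \<open>Comparison of \<open>B\<close> and \<open>C\<close> in the eigenbasis of
  \<open>A\<close>\<close>

lemma cubic_skip:
  assumes tB: "tri_int B" and tC: "tri_int C"
    and "B i i = 0" "B (i + 1) (i + 1) = 0" "C i i = 0" "C (i + 1) (i + 1) = 0"
  shows "cubic B C (i + 2) i =
    B (i + 2) (i + 2) * (B (i + 2) (i + 1) * C (i + 1) i + 2 * C (i + 2) (i + 1) * B (i + 1) i) +
    C (i + 2) (i + 2) * B (i + 2) (i + 1) * B (i + 1) i"
  using assms(3-) by (simp add: cubic_def mm_def tri_intD[OF tB] tri_intD[OF tC] algebra_simps)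

text \<open>This entry involves sub- and superdiagonal entries of \<open>C\<close> together, so it
  can relate the two sequences of ratios between \<open>C\<close> and \<open>B\<close>.\<close>

lemma cubic_corner:
  assumes tB: "tri_int B" and tC: "tri_int C"
    and "B 0 0 = 0" "B 1 1 = 0" "C 0 0 = 0" "C 1 1 = 0" "B 0 (-1) = 0" "C 0 (-1) = 0"
  shows "cubic B C 1 0 = (B 1 0 * B 0 1 + B 1 2 * B 2 1) * C 1 0 +
    2 * (B 1 0 * C 0 1 * B 1 0 + B 1 2 * C 2 1 * B 1 0) +
    (C 1 0 * B 0 1 + C 1 2 * B 2 1) * B 1 0"
  using assms(3-) by (simp add: cubic_def mm_def tri_intD[OF tB] tri_intD[OF tC] algebra_simps)

text \<open>The recurrence makes both sequences alternating multiples of linear ones; a product of two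
  linear sequences is constant at three places only if both are constant.\<close>

lemma alternating_of_recurrence:
  fixes r t :: "nat \<Rightarrow> 'k::field_char_0"
  assumes r: "\<And>n. n + 2 < d \<Longrightarrow> r n + 2 * r (n + 1) + r (n + 2) = 0"
    and t: "\<And>n. n + 2 < d \<Longrightarrow> t n + 2 * t (n + 1) + t (n + 2) = 0"
    and prod: "\<And>n. n < d \<Longrightarrow> r n * t n = \<kappa>" and k: "\<kappa> \<noteq> 0" and d: "3 \<le> d"
  shows "n < d \<Longrightarrow> r n = (- 1) ^ n * r 0" "n < d \<Longrightarrow> t n = (- 1) ^ n * t 0"
proof -
  define b c where "b = r 1 + r 0" and "c = t 1 + t 0"
  have r12: "r 1 = b - r 0" "r 2 = r 0 - 2 * b"
    using r[of 0] d by (simp_all add: b_def algebra_simps numeral_2_eq_2 add_eq_0_iff)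
  have t12: "t 1 = c - t 0" "t 2 = t 0 - 2 * c"
    using t[of 0] d by (simp_all add: c_def algebra_simps numeral_2_eq_2 add_eq_0_iff)
  have 1: "b * c - (b * t 0 + r 0 * c) = 0"
  proof -
    have "b * c - (b * t 0 + r 0 * c) = r 1 * t 1 - r 0 * t 0"
      unfolding r12 t12 by (simp add: algebra_simps)
    then show ?thesis using prod d by simp
  qed
  have 2: "4 * (b * c) - 2 * (b * t 0 + r 0 * c) = 0"
  proof -
    have "4 * (b * c) - 2 * (b * t 0 + r 0 * c) = r 2 * t 2 - r 0 * t 0"
      unfolding r12 t12 by (simp add: algebra_simps)
    then show ?thesis using prod d by simp
  qed
  have "2 * (b * c) = (4 * (b * c) - 2 * (b * t 0 + r 0 * c)) - 2 * (b * c - (b * t 0 + r 0 * c))"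
    by (simp add: algebra_simps)
  then have bc: "b * c = 0"
    unfolding 1 2 by simp
  have "b * t 0 + r 0 * c = 0"
    using 1 unfolding bc by (simp only: diff_0 neg_equal_0_iff_equal)
  moreover have "r 0 * t 0 \<noteq> 0"
    using prod[of 0] k d by simp
  ultimately have bc0: "b = 0" "c = 0"
    using bc by auto
  have alt: "f n = (- 1) ^ n * f 0"
    if "\<And>n. n + 2 < d \<Longrightarrow> f n + 2 * f (n + 1) + f (n + 2) = 0" "f 1 = - f 0" "n < d"
    for f :: "nat \<Rightarrow> 'k" and n
    using that(3)
  proof (induction n rule: nat_less_induct)
    case (1 n)
    consider "n = 0" | "n = 1" | m where "n = Suc (Suc m)"
      by (metis One_nat_def not0_implies_Suc)
    then show ?case
    proof cases
      case 3
      then have "f n = - 2 * f (m + 1) - f m"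
        using that(1)[of m] 1(2) by (simp add: eq_neg_iff_add_eq_0 algebra_simps)
      also have "f (m + 1) = (- 1) ^ (m + 1) * f 0"
        using 1(2) 3 by (intro 1(1)[rule_format]) auto
      also have "f m = (- 1) ^ m * f 0"
        using 1(2) 3 by (intro 1(1)[rule_format]) auto
      finally show ?thesis using 3 by simp
    qed (use that(2) in auto)
  qed
  show "n < d \<Longrightarrow> r n = (- 1) ^ n * r 0" "n < d \<Longrightarrow> t n = (- 1) ^ n * t 0"
    using alt[of r n] alt[of t n] r t r12(1) t12(1) bc0 by auto
qed

text \<open>Since \<open>A i i + A j j\<close> alternates along the band, \<open>C\<close> must be
  obtained from \<open>B\<close> by the factors \<open>(- 1) ^ n * r 0\<close>. The relation
  \<open>BC\<close> supplies them: the entries at distance three from the diagonal give the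
  alternation, entry \<open>(1, 0)\<close> equates the constants below and above the diagonal, and
  entry \<open>(d, d - 2)\<close> settles the end entry.\<close>

lemma anticommutator_proportional:
  fixes A B C :: "int \<Rightarrow> int \<Rightarrow> 'k::field_char_0"
  assumes dA: "diag_int A" and irrB: "irr_tri_int d B" and irrC: "irr_tri_int d C" and d: "3 \<le> d"
    and suppB: "\<And>i j. \<not> (0 \<le> i \<and> i \<le> int d \<and> 0 \<le> j \<and> j \<le> int d) \<Longrightarrow> B i j = 0"
    and suppC: "\<And>i j. \<not> (0 \<le> i \<and> i \<le> int d \<and> 0 \<le> j \<and> j \<le> int d) \<Longrightarrow> C i j = 0"
    and sums': "\<forall>n<d. A (int n) (int n) + A (int n + 1) (int n + 1) = (- 1) ^ n * s"
    and s: "s \<noteq> 0" and rho: "\<rho> \<noteq> 0" and rho': "\<rho>' \<noteq> 0"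
    and B0': "\<forall>i. i \<noteq> int d \<longrightarrow> B i i = 0" and C0': "\<forall>i. i \<noteq> int d \<longrightarrow> C i i = 0"
    and BA: "\<And>i j. cubic B A i j = \<rho> * A i j" and CA: "\<And>i j. cubic C A i j = \<rho>' * A i j"
    and BC: "\<And>i j. cubic B C i j = \<rho> * C i j"
  shows "\<exists>\<nu>. \<nu> \<noteq> 0 \<and> (\<forall>i j. (A i i + A j j) * B i j = \<nu> * C i j)"
proof -
  note sums = sums'[rule_format] and B0 = B0'[rule_format] and C0 = C0'[rule_format]
  note tB = irr_tri_int_tri[OF irrB] and tC = irr_tri_int_tri[OF irrC]
  define m where "m = 2 * A 0 0 / s"
  have d1: "1 \<le> d" using d by simp
  have supp: "B 0 (-1) = 0" "B (int d + 1) (int d) = 0" "C 0 (-1) = 0" "C (int d + 1) (int d) = 0"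
    using suppB suppC by auto
  note specB = bannai_ito_spectrum[OF dA irrB d1 supp(1,2) sums' s rho B0' BA, folded m_def]
    and specC = bannai_ito_spectrum[OF dA irrC d1 supp(3,4) sums' s rho' C0' CA, folded m_def]
  have B_nz: "B (int n + 1) (int n) \<noteq> 0" "B (int n) (int n + 1) \<noteq> 0" if "n < d" for n
    using irrB that by (auto simp: irr_tri_int_def)
  have C_nz: "C (int n + 1) (int n) \<noteq> 0" if "n < d" for n
    using irrC that by (auto simp: irr_tri_int_def)
  define r t where "r n = C (int n + 1) (int n) / B (int n + 1) (int n)"
    and "t n = C (int n) (int n + 1) / B (int n) (int n + 1)" for n
  have Cr: "C (int n + 1) (int n) = r n * B (int n + 1) (int n)"
    and Ct: "C (int n) (int n + 1) = t n * B (int n) (int n + 1)" if "n < d" for n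
    using B_nz[OF that] by (simp_all add: r_def t_def)
  \<comment> \<open>The products for \<open>B\<close> and \<open>C\<close> have the same shape with
    the same \<open>m\<close>, as \<open>m\<close> is computed from \<open>A\<close> alone.\<close>
  have rt: "r n * t n = \<rho>' / \<rho>" if "n < d" for n
  proof -
    have "B (int n + 1) (int n) * B (int n) (int n + 1) \<noteq> 0"
      using B_nz[OF that] by simp
    then have "of_nat (n + 1) * (m - of_nat n) \<noteq> 0"
      using specB(2)[OF that] by auto
    moreover have "r n * t n = (C (int n + 1) (int n) * C (int n) (int n + 1)) /
        (B (int n + 1) (int n) * B (int n) (int n + 1))"
      by (simp add: r_def t_def)
    ultimately show ?thesis
      unfolding specB(2)[OF that] specC(2)[OF that] by simp
  qed
  have r: "r n + 2 * r (n + 1) + r (n + 2) = 0" if n: "n + 2 < d" for n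
  proof -
    have "C (int n + 2) (int n + 1) = r (n + 1) * B (int n + 2) (int n + 1)"
      "C (int n + 3) (int n + 2) = r (n + 2) * B (int n + 3) (int n + 2)"
      using Cr[of "n + 1"] Cr[of "n + 2"] n by (simp_all add: add_ac)
    moreover have "C (int n + 1) (int n) = r n * B (int n + 1) (int n)"
      using Cr[of n] n by simp
    ultimately have "cubic B C (int n + 3) (int n) = (r n + 2 * r (n + 1) + r (n + 2)) *
        (B (int n + 1) (int n) * B (int n + 2) (int n + 1) * B (int n + 3) (int n + 2))"
      unfolding cubic_far_down[OF tB tC] by (simp add: algebra_simps)
    moreover have "cubic B C (int n + 3) (int n) = 0"
      using BC tri_intD[OF tC] by simp
    moreover have "B (int n + 1) (int n) * B (int n + 2) (int n + 1) * B (int n + 3) (int n + 2) \<noteq> 0"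
      using B_nz[of n] B_nz[of "n + 1"] B_nz[of "n + 2"] n by (simp add: add_ac)
    ultimately show ?thesis by simp
  qed
  have t: "t n + 2 * t (n + 1) + t (n + 2) = 0" if n: "n + 2 < d" for n
  proof -
    have "C (int n + 1) (int n + 2) = t (n + 1) * B (int n + 1) (int n + 2)"
      "C (int n + 2) (int n + 3) = t (n + 2) * B (int n + 2) (int n + 3)"
      using Ct[of "n + 1"] Ct[of "n + 2"] n by (simp_all add: add_ac)
    moreover have "C (int n) (int n + 1) = t n * B (int n) (int n + 1)"
      using Ct[of n] n by simp
    ultimately have "cubic B C (int n) (int n + 3) = (t n + 2 * t (n + 1) + t (n + 2)) *
        (B (int n) (int n + 1) * B (int n + 1) (int n + 2) * B (int n + 2) (int n + 3))"
      unfolding cubic_far_up[OF tB tC] by (simp add: algebra_simps)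
    moreover have "cubic B C (int n) (int n + 3) = 0"
      using BC tri_intD[OF tC] by simp
    moreover have "B (int n) (int n + 1) * B (int n + 1) (int n + 2) * B (int n + 2) (int n + 3) \<noteq> 0"
      using B_nz[of n] B_nz[of "n + 1"] B_nz[of "n + 2"] n by (simp add: add_ac)
    ultimately show ?thesis by simp
  qed
  have alt: "r n = (- 1) ^ n * r 0" "t n = (- 1) ^ n * t 0" if "n < d" for n
    using alternating_of_recurrence[OF r t rt _ d that] rho rho' by auto
  have r0: "r 0 \<noteq> 0"
    using C_nz[of 0] B_nz[of 0] d by (simp add: r_def)
  have t0: "t 0 = r 0"
  proof -
    define p q where "p = B 1 0 * B 0 1" and "q = B 2 1 * B 1 2"
    have "C 1 0 = r 0 * B 1 0" "C 0 1 = t 0 * B 0 1" "C 2 1 = - r 0 * B 2 1" "C 1 2 = - t 0 * B 1 2"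
      using Cr[of 0] Cr[of 1] Ct[of 0] Ct[of 1] alt[of 1] d by simp_all
    then have "cubic B C 1 0 = (r 0 + t 0) * (2 * p - q) * B 1 0"
      using d by (subst cubic_corner[OF tB tC])
        (auto simp: B0 C0 supp p_def q_def algebra_simps)
    moreover have "cubic B C 1 0 = \<rho> * r 0 * B 1 0"
      using BC[of 1 0] \<open>C 1 0 = r 0 * B 1 0\<close> by simp
    \<comment> \<open>In this combination of the first two products \<open>m\<close> cancels, which
      leaves \<open>(r 0 + t 0) / 2 = r 0\<close>.\<close>
    moreover have pq: "2 * p - q = \<rho> / 2"
      using specB(2)[of 0] specB(2)[of 1] d by (simp add: p_def q_def field_simps)
    ultimately have "(r 0 + t 0) * (\<rho> / 2) * B 1 0 = \<rho> * r 0 * B 1 0"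
      by (simp only: pq)
    then have "(\<rho> * B 1 0) * ((r 0 + t 0) / 2) = (\<rho> * B 1 0) * r 0"
      by (simp only: times_divide_eq_right times_divide_eq_left mult_ac)
    moreover have "\<rho> * B 1 0 \<noteq> 0"
      using rho B_nz[of 0] d by simp
    ultimately have "(r 0 + t 0) / 2 = r 0"
      by (metis mult_left_cancel)
    then show ?thesis by (simp add: field_simps)
  qed
  \<comment> \<open>Here \<open>r (k + 1) = - r k\<close>, so the weights 1 and 2 of the terms with
    the end entry of \<open>B\<close> combine to \<open>- r k\<close>. The sign is right because
    \<open>d = k + 2\<close> has the parity of \<open>k\<close>.\<close>
  have Cd: "C (int d) (int d) = (- 1) ^ d * r 0 * B (int d) (int d)"
  proof -
    obtain k where k: "d = k + 2" using d by (metis le_add_diff_inverse2 add_leD2 numeral_3_eq_3 numeral_2_eq_2 Suc_leD)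
    have "C (int k + 1) (int k) = (- 1) ^ k * r 0 * B (int k + 1) (int k)"
      "C (int k + 2) (int k + 1) = - ((- 1) ^ k * r 0) * B (int k + 2) (int k + 1)"
      using Cr[of k] Cr[of "k + 1"] alt(1)[of k] alt(1)[of "k + 1"] k by (simp_all add: add_ac)
    then have "cubic B C (int k + 2) (int k) =
        (C (int d) (int d) - (- 1) ^ k * r 0 * B (int d) (int d)) *
        (B (int k + 2) (int k + 1) * B (int k + 1) (int k))"
      using k by (subst cubic_skip[OF tB tC]) (auto simp: B0 C0 algebra_simps)
    moreover have "cubic B C (int k + 2) (int k) = 0"
      using BC tri_intD[OF tC] by simp
    moreover have "B (int k + 2) (int k + 1) * B (int k + 1) (int k) \<noteq> 0"
      using B_nz[of k] B_nz[of "k + 1"] k by (simp add: add_ac)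
    ultimately show ?thesis using k by simp
  qed
  have "(A i i + A j j) * B i j = (s / r 0) * C i j" for i j
  proof -
    consider (out) "\<not> (0 \<le> i \<and> i \<le> int d \<and> 0 \<le> j \<and> j \<le> int d)"
      | (far) "1 < \<bar>i - j\<bar>" | (diag) "i = j" "i \<noteq> int d" | (last) "i = int d" "j = int d"
      | (down) n where "n < d" "i = int n + 1" "j = int n"
      | (up) n where "n < d" "i = int n" "j = int n + 1"
    proof -
      assume *: thesis if "\<not> (0 \<le> i \<and> i \<le> int d \<and> 0 \<le> j \<and> j \<le> int d)"
      assume **: thesis if "1 < \<bar>i - j\<bar>"
      assume 3: thesis if "i = j" "i \<noteq> int d"
      assume 4: thesis if "i = int d" "j = int d"
      assume 5: thesis if "n < d" "i = int n + 1" "j = int n" for n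
      assume 6: thesis if "n < d" "i = int n" "j = int n + 1" for n
      show thesis
        using * ** 3 4 5[of "nat j"] 6[of "nat i"] by linarith
    qed
    then show ?thesis
    proof cases
      case out
      then show ?thesis by (simp add: suppB suppC)
    next
      case far
      then show ?thesis by (simp add: tri_intD[OF tB] tri_intD[OF tC])
    next
      case diag
      then show ?thesis by (simp add: B0 C0)
    next
      case last
      show ?thesis
      proof (cases "B (int d) (int d) = 0")
        case False
        have m1: "m = 2 * of_nat d + 1"
          using specB(4)[OF False] by simp
        \<comment> \<open>For this \<open>m\<close> the alternating pattern of sums continues as if
          \<open>d\<close> were its own successor.\<close>
        have "2 * A (int d) (int d) = (- 1) ^ d * s"
          unfolding specB(1)[OF order_refl] m1 by simp
        then show ?thesis using last r0 by (simp add: Cd flip: mult_2)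
      qed (use last Cd in simp)
    next
      case down
      then show ?thesis
        using sums[of n] Cr[of n] alt(1)[of n] r0 by (simp add: add.commute)
    next
      case up
      then show ?thesis
        using sums[of n] Ct[of n] alt(2)[of n] r0 t0 by simp
    qed
  qed
  moreover have "s / r 0 \<noteq> 0" using s r0 by simp
  ultimately show ?thesis by blast
qed

subsection \<open>Relations of a Leonard pair of Bannai/Ito type\<close>

context vspace
begin

text \<open>The operator form {X, {X, Y}} = \<rho> Y of the relation whose entries
  \<open>cubic\<close> computes.\<close>

definition quad :: "('b \<Rightarrow> 'b) \<Rightarrow> ('b \<Rightarrow> 'b) \<Rightarrow> 'a \<Rightarrow> bool" where
  "quad X Y \<rho> \<longleftrightarrow> (\<forall>x. X (X (Y x)) + scale 2 (X (Y (X x))) + Y (X (X x)) = scale \<rho> (Y x))"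

lemma quad_unique:
  assumes "quad X Y \<rho>" "quad X Y \<rho>'" "Y x \<noteq> 0"
  shows "\<rho> = \<rho>'"
  using assms unfolding quad_def by (metis scale_right_imp_eq)

text \<open>The second part of \<open>half_askey_wilson\<close>, with the two maps exchanged, says
  that the two sums of neighbouring eigenvalues of \<open>A\<close> are opposite. The first part
  then loses its linear term, and its constant becomes the square of one sum.\<close>

lemma bannai_ito_relation:
  assumes bv: "vbasis scale d v" and bw: "vbasis scale d w"
    and linA: "lin A" and linB: "lin B" and d: "3 \<le> d"
    and dA: "diag_int (vbasis.M scale d v A)" and tB: "irr_tri_int d (vbasis.M scale d v B)"
    and dB: "diag_int (vbasis.M scale d w B)" and tA: "irr_tri_int d (vbasis.M scale d w A)"
    and th: "\<And>i. \<theta> i = vbasis.M scale d v A i i"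
    and bi: "\<And>i. 2 \<le> i \<Longrightarrow> i + 1 \<le> int d \<Longrightarrow> \<theta> (i - 2) + \<theta> (i - 1) = \<theta> i + \<theta> (i + 1)"
    and th': "\<And>i. \<theta>' i = vbasis.M scale d w B i i"
    and bi': "\<And>i. 2 \<le> i \<Longrightarrow> i + 1 \<le> int d \<Longrightarrow> \<theta>' (i - 2) + \<theta>' (i - 1) = \<theta>' i + \<theta>' (i + 1)"
    and p: "\<And>i. i \<noteq> p \<Longrightarrow> vbasis.M scale d v B i i = 0"
    and p': "\<And>i. i \<noteq> p' \<Longrightarrow> vbasis.M scale d w A i i = 0"
  shows "\<theta> 0 + \<theta> 1 \<noteq> 0" "quad A B ((\<theta> 0 + \<theta> 1)\<^sup>2)"
    "\<forall>n<d. \<theta> (int n) + \<theta> (int n + 1) = (- 1) ^ n * (\<theta> 0 + \<theta> 1)"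
proof -
  interpret V: vbasis scale d v by fact
  interpret W: vbasis scale d w by fact
  define s where "s = \<theta> 0 + \<theta> 1"
  have 0: "\<theta> 0 + 2 * \<theta> 1 + \<theta> 2 = 0"
    using half_askey_wilson(2)[where \<theta> = \<theta>', OF bw bv linB linA d dB tA dA tB th' bi' p'] by (simp add: th)
  have "\<theta> 1 + \<theta> 2 + s = \<theta> 0 + 2 * \<theta> 1 + \<theta> 2"
    by (simp add: s_def algebra_simps)
  then have s2: "\<theta> 1 + \<theta> 2 = - s"
    unfolding 0 by (simp only: eq_neg_iff_add_eq_0)
  have half: "A (A (B x)) + scale 2 (A (B (A x))) + B (A (A x))
      - scale (s + - s) (A (B x) + B (A x)) + scale (s * - s) (B x) = 0" for x
    using half_askey_wilson(1)[where \<theta> = \<theta>, OF bv bw linA linB d dA tB dB tA th bi p, folded s_def, unfolded s2] .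
  have "A (A (B x)) + scale 2 (A (B (A x))) + B (A (A x)) = scale (s\<^sup>2) (B x)" for x
    using half[of x] by (simp add: power2_eq_square)
  then show "quad A B ((\<theta> 0 + \<theta> 1)\<^sup>2)"
    unfolding quad_def s_def by blast
  have sums: "\<theta> (int n) + \<theta> (int n + 1) = (- 1) ^ n * s" if "n < d" for n
    using bannai_ito_sums[of d \<theta> n, OF bi that] s2 by (auto simp: s_def)
  then show "\<forall>n<d. \<theta> (int n) + \<theta> (int n + 1) = (- 1) ^ n * (\<theta> 0 + \<theta> 1)"
    by (simp add: s_def)
  \<comment> \<open>Otherwise all eigenvalues are \<open>\<theta> 0\<close> up to sign and
    \<open>A\<^sup>2\<close> is scalar, against the entry \<open>(0, 2)\<close> of
    \<open>A\<^sup>2\<close> in the second basis, a product of two superdiagonal entries.\<close>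
  have "s \<noteq> 0"
  proof
    assume s0: "s = 0"
    have pm: "\<theta> (int n) = (- 1) ^ n * \<theta> 0" if "n \<le> d" for n
      using that
    proof (induction n)
      case (Suc n)
      then have "\<theta> (int n + 1) = - \<theta> (int n)"
        using sums[of n] s0 by (simp add: eq_neg_iff_add_eq_0 add.commute)
      then show ?case using Suc by (simp add: add.commute)
    qed simp
    have "(\<lambda>x. A (A x)) = (\<lambda>x. scale ((\<theta> 0)\<^sup>2) x)"
    proof (rule V.M_eqI[OF lin_comp[OF linA linA]])
      show "lin (\<lambda>x. scale ((\<theta> 0)\<^sup>2) x)"
        by (simp add: lin_iff scale_right_distrib mult.commute)
      show "V.M (\<lambda>x. A (A x)) i j = V.M (\<lambda>x. scale ((\<theta> 0)\<^sup>2) x) i j" for i j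
      proof (cases "0 \<le> i \<and> i \<le> int d \<and> 0 \<le> j \<and> j \<le> int d")
        case True
        have "\<theta> i * \<theta> i = (\<theta> 0)\<^sup>2"
        proof -
          have "\<theta> i = (- 1) ^ nat i * \<theta> 0"
            using pm[of "nat i"] True by (simp add: nat_le_iff)
          then have "(\<theta> i)\<^sup>2 = (\<theta> 0)\<^sup>2"
            by (simp add: power_mult_distrib flip: power_mult)
          then show ?thesis by (simp add: power2_eq_square)
        qed
        then show ?thesis
          using True by (cases "i = j")
            (auto simp: V.M_comp_diag_left[OF linA dA, of A] diag_intD[OF dA] V.M_def[of "\<lambda>x. scale _ x"]
              V.mat_of_co V.co_basis eq_nat_nat_iff simp flip: th)
      qed (simp_all add: V.M_outside)
    qed
    then have "W.M (\<lambda>x. A (A x)) 0 2 = W.M (\<lambda>x. scale ((\<theta> 0)\<^sup>2) x) 0 2"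
      by simp
    also have "\<dots> = 0"
      using d by (simp add: W.M_def W.mat_of_co W.co_basis)
    finally have "W.M A 0 1 * W.M A 1 2 = 0"
      using W.M_comp_tri_left[OF linA irr_tri_int_tri[OF tA], of A 0 2]
      by (simp add: tri_intD[OF irr_tri_int_tri[OF tA]])
    moreover have "W.M A 0 1 \<noteq> 0" "W.M A 1 2 \<noteq> 0"
      using tA d by (auto simp: irr_tri_int_def dest: spec[of _ 0] spec[of _ 1])
    ultimately show False by simp
  qed
  then show "\<theta> 0 + \<theta> 1 \<noteq> 0" by (simp add: s_def)
qed

end

context vbasis
begin

lemma M_cubic:
  assumes "lin X" "lin Y" "tri_int (M X)" "tri_int (M Y)" "quad X Y \<rho>"
  shows "cubic (M X) (M Y) i j = \<rho> * M Y i j"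
proof -
  note X = M_comp_tri_left[OF assms(1,3), folded mm_def] and Y = M_comp_tri_left[OF assms(2,4), folded mm_def]
  have 1: "M (\<lambda>x. X (Y x)) = mm (M X) (M Y)" "M (\<lambda>x. Y (X x)) = mm (M Y) (M X)"
    "M (\<lambda>x. X (X x)) = mm (M X) (M X)"
    by (intro ext X Y)+
  have 2: "M (\<lambda>x. X (X (Y x))) i j = mm (M X) (mm (M X) (M Y)) i j"
    "M (\<lambda>x. X (Y (X x))) i j = mm (M X) (mm (M Y) (M X)) i j"
    "M (\<lambda>x. Y (X (X x))) i j = mm (M Y) (mm (M X) (M X)) i j"
    using X[of "\<lambda>x. X (Y x)" i j] X[of "\<lambda>x. Y (X x)" i j] Y[of "\<lambda>x. X (X x)" i j]
    unfolding 1 mm_def by simp_all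
  have "M (\<lambda>x. X (X (Y x)) + scale 2 (X (Y (X x))) + Y (X (X x))) i j = M (\<lambda>x. scale \<rho> (Y x)) i j"
    using assms(5) by (simp add: quad_def)
  then show ?thesis
    unfolding M_add M_scale 2 cubic_def .
qed

lemma lin_basis_image:
  assumes "lin X" "tri_int (M X)" "i \<le> d"
  shows "X (v i) = scale (M X (int i - 1) (int i)) (if i = 0 then 0 else v (i - 1)) +
    scale (M X (int i) (int i)) (v i) +
    scale (M X (int i + 1) (int i)) (if i = d then 0 else v (i + 1))"
proof (rule co_eqI)
  fix k assume k: "k \<le> d"
  have co_X: "co (X (v i)) k = M X (int k) (int i)"
    using k assms(3) by (simp add: M_nat mat_of_co)
  have far: "M X (int k) (int i) = 0" if "\<not> (k = i \<or> k + 1 = i \<or> k = i + 1)"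
    using that by (intro tri_intD[OF assms(2)]) auto
  show "co (X (v i)) k = co (scale (M X (int i - 1) (int i)) (if i = 0 then 0 else v (i - 1)) +
    scale (M X (int i) (int i)) (v i) +
    scale (M X (int i + 1) (int i)) (if i = d then 0 else v (i + 1))) k"
  proof -
    have lo: "co (if i = 0 then 0 else v (i - 1)) k = (if k + 1 = i then 1 else 0)"
      and md: "co (v i) k = (if k = i then 1 else 0)"
      and up: "co (if i = d then 0 else v (i + 1)) k = (if k = i + 1 then 1 else 0)"
      using k assms(3) by (auto simp: co_basis)
    consider "k + 1 = i" | "k = i" | "k = i + 1" | "\<not> (k = i \<or> k + 1 = i \<or> k = i + 1)"
      by blast
    then show ?thesis
      using far unfolding co_X co_add co_scale lo md up by cases (auto simp: add.commute)
  qed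
qed

section \<open>Rescaling and reversing a basis; invariant subspaces\<close>

lemma indexed_basis_scale:
  assumes "\<And>i. i \<le> d \<Longrightarrow> k i \<noteq> 0"
  shows "indexed_basis scale d (\<lambda>i. scale (k i) (v i))"
proof -
  let ?u = "\<lambda>i. scale (k i) (v i)"
  have inj: "inj_on ?u {..d}"
  proof (rule inj_onI)
    fix i j assume ij: "i \<in> {..d}" "j \<in> {..d}" and "?u i = ?u j"
    then have "co (?u i) i = co (?u j) i" by simp
    then show "i = j" using assms ij by (auto simp: co_basis split: if_splits)
  qed
  have "v i \<in> span (?u ` {..d})" if "i \<le> d" for i
  proof -
    have "scale (inverse (k i)) (?u i) \<in> span (?u ` {..d})"
      using that by (intro span_scale span_base) auto
    then show ?thesis using assms[OF that] by simp
  qed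
  then have "span (v ` {..d}) \<subseteq> span (?u ` {..d})"
    by (intro span_minimal subspace_span) auto
  then have sp: "span (?u ` {..d}) = UNIV"
    using span_v by auto
  have "independent (?u ` {..d})"
  proof (rule independent_if_scalars_zero)
    fix f x assume "(\<Sum>x\<in>?u ` {..d}. scale (f x) x) = 0" and "x \<in> ?u ` {..d}"
    then obtain i where i: "x = ?u i" "i \<le> d" by auto
    have "0 = co (\<Sum>x\<in>?u ` {..d}. scale (f x) x) i"
      using \<open>_ = 0\<close> by simp
    also have "\<dots> = (\<Sum>j\<le>d. f (?u j) * (k j * (if i = j then 1 else 0)))"
      using i by (subst sum.reindex[OF inj]) (simp add: co_basis mult.assoc)
    also have "\<dots> = f (?u i) * k i"
      using i by (simp add: if_distrib cong: if_cong)
    finally show "f x = 0" using i assms by simp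
  qed simp
  with inj sp show ?thesis by (simp add: indexed_basis_def)
qed

lemma image_rev: "(\<lambda>i. v (d - i)) ` {..d} = v ` {..d}"
proof -
  have "x \<in> (\<lambda>i. d - i) ` {..d}" if "x \<le> d" for x
    using that by (intro image_eqI[of _ _ "d - x"]) auto
  then have "(\<lambda>i. d - i) ` {..d} = {..d}"
    by auto
  then show ?thesis
    by (metis image_image)
qed

lemma indexed_basis_rev: "indexed_basis scale d (\<lambda>i. v (d - i))"
proof -
  have "inj_on (\<lambda>i. v (d - i)) {..d}"
  proof (rule inj_onI)
    fix x y assume "x \<in> {..d}" "y \<in> {..d}" "v (d - x) = v (d - y)"
    then show "x = y"
      using inj_onD[OF inj_v, of "d - x" "d - y"] by auto
  qed
  then show ?thesis
    using indep_v span_v by (simp add: indexed_basis_def image_rev)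
qed

lemma mat_of_rev:
  "mat_of scale d (\<lambda>i. v (d - i)) X i j = mat_of scale d v X (d - i) (d - j)"
  by (simp add: mat_of_def image_rev)

text \<open>The scalars \<open>k i\<close> normalise the subdiagonal; the superdiagonal is then forced by the products.\<close>

lemma rescaled_basis:
  assumes linX: "lin X" and irr: "irr_tri_int d (M X)" and h: "\<eta> \<noteq> 0"
    and q: "\<And>n. n < d \<Longrightarrow> M X (int n + 1) (int n) * M X (int n) (int n + 1) = \<eta>\<^sup>2 * of_nat (n + 1) * (m - of_nat n)"
  obtains k where "\<And>i. i \<le> d \<Longrightarrow> k i \<noteq> 0"
    "\<And>i. i \<le> d \<Longrightarrow> X (scale (k i) (v i)) =
      scale (\<eta> * (m + 1 - of_nat i)) (if i = 0 then 0 else scale (k (i - 1)) (v (i - 1))) +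
      scale (M X (int i) (int i)) (scale (k i) (v i)) +
      scale (\<eta> * of_nat (i + 1)) (if i = d then 0 else scale (k (i + 1)) (v (i + 1)))"
proof -
  have nz: "M X (int n + 1) (int n) \<noteq> 0" "M X (int n) (int n + 1) \<noteq> 0" if "n < d" for n
    using irr that by (auto simp: irr_tri_int_def)
  \<comment> \<open>The characteristic is arbitrary here; the nonzero product on the left of
    \<open>q\<close> rules out a vanishing factor.\<close>
  have c: "(of_nat (n + 1) :: 'a) \<noteq> 0" if "n < d" for n
    using q[OF that] nz[OF that] by auto
  define k where "k i = (\<Prod>n<i. M X (int n + 1) (int n) / (\<eta> * of_nat (n + 1)))" for i
  have k_Suc: "k (Suc n) = k n * M X (int n + 1) (int n) / (\<eta> * of_nat (n + 1))" for n
    by (simp add: k_def)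
  have k_nz: "k i \<noteq> 0" if "i \<le> d" for i
    using that nz c h by (auto simp: k_def simp del: of_nat_add of_nat_Suc)
  have up: "k i * M X (int i + 1) (int i) = \<eta> * of_nat (i + 1) * k (i + 1)" if "i < d" for i
    using c[OF that] h by (simp add: k_Suc del: of_nat_add of_nat_Suc)
  have down: "k (Suc n) * M X (int n) (int n + 1) = \<eta> * (m - of_nat n) * k n" if "n < d" for n
  proof -
    have "k (Suc n) * M X (int n) (int n + 1) =
        k n * (M X (int n + 1) (int n) * M X (int n) (int n + 1)) / (\<eta> * of_nat (n + 1))"
      by (simp add: k_Suc)
    also have "\<dots> = \<eta> * (m - of_nat n) * k n"
      unfolding q[OF that] using c[OF that] h
      by (simp add: power2_eq_square del: of_nat_add of_nat_Suc)
    finally show ?thesis .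
  qed
  show thesis
  proof (rule that[OF k_nz])
    fix i assume i: "i \<le> d"
    have X: "X (scale (k i) (v i)) = scale (k i) (X (v i))"
      using linX by (simp add: lin_iff)
    show "X (scale (k i) (v i)) =
      scale (\<eta> * (m + 1 - of_nat i)) (if i = 0 then 0 else scale (k (i - 1)) (v (i - 1))) +
      scale (M X (int i) (int i)) (scale (k i) (v i)) +
      scale (\<eta> * of_nat (i + 1)) (if i = d then 0 else scale (k (i + 1)) (v (i + 1)))"
    proof -
      have "scale (k i * M X (int i - 1) (int i)) (if i = 0 then 0 else v (i - 1)) =
          scale (\<eta> * (m + 1 - of_nat i)) (if i = 0 then 0 else scale (k (i - 1)) (v (i - 1)))"
        using down[of "i - 1"] i by (cases i) (auto simp: add.commute)
      moreover have "scale (k i * M X (int i + 1) (int i)) (if i = d then 0 else v (i + 1)) =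
          scale (\<eta> * of_nat (i + 1)) (if i = d then 0 else scale (k (i + 1)) (v (i + 1)))"
        using up[of i] i by auto
      ultimately show ?thesis
        unfolding X lin_basis_image[OF linX irr_tri_int_tri[OF irr] i] scale_right_distrib scale_scale
        by (simp add: mult.commute)
    qed
  qed
qed

text \<open>Applying \<open>A - \<theta>\<^sub>l\<close> for all \<open>l \<noteq> i\<close> in turn
  kills every coordinate except the one at \<open>i\<close>, which is only multiplied by the nonzero
  numbers \<open>\<theta>\<^sub>i - \<theta>\<^sub>l\<close>.\<close>

lemma eigenvector_in_invariant_subspace:
  assumes linA: "lin A" and dA: "diag_int (M A)"
    and distinct: "\<And>i j. i \<le> d \<Longrightarrow> j \<le> d \<Longrightarrow> M A (int i) (int i) = M A (int j) (int j) \<Longrightarrow> i = j"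
    and W: "subspace W" "\<And>w. w \<in> W \<Longrightarrow> A w \<in> W"
    and w: "w \<in> W" "co w i \<noteq> 0" and i: "i \<le> d"
  shows "v i \<in> W"
proof -
  define th where "th j = M A (int j) (int j)" for j
  have coA: "co (A x) j = th j * co x j" if "j \<le> d" for x j
  proof -
    have "co (A x) j = (\<Sum>l\<le>d. M A (int j) (int l) * co x l)"
      using that by (simp add: co_lin[OF linA] M_nat)
    also have "\<dots> = (\<Sum>l\<le>d. if l = j then th j * co x j else 0)"
      by (intro sum.cong) (auto simp: diag_intD[OF dA] th_def)
    finally show ?thesis using that by simp
  qed
  have "\<exists>x\<in>W. co x i \<noteq> 0 \<and> (\<forall>j\<le>d. j \<in> S \<longrightarrow> co x j = 0)" if "finite S" "i \<notin> S" "S \<subseteq> {..d}" for S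
    using that
  proof (induction S rule: finite_induct)
    case empty
    then show ?case using w by auto
  next
    case (insert l S)
    then obtain x where x: "x \<in> W" "co x i \<noteq> 0" "\<And>j. j \<le> d \<Longrightarrow> j \<in> S \<Longrightarrow> co x j = 0"
      by auto
    have "A x - scale (th l) x \<in> W"
      using W x(1) by (intro subspace_diff subspace_scale) auto
    moreover have "th i \<noteq> th l"
      using distinct[of i l] insert.prems i by (auto simp: th_def)
    ultimately show ?case
      using x(2,3) insert.prems i
      by (intro bexI[of _ "A x - scale (th l) x"]) (auto simp: coA simp flip: left_diff_distrib)
  qed
  from this[of "{..d} - {i}"] obtain x where x: "x \<in> W" "co x i \<noteq> 0" "\<And>j. j \<le> d \<Longrightarrow> j \<noteq> i \<Longrightarrow> co x j = 0"
    by auto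
  have "v i = scale (inverse (co x i)) x"
    using x i by (intro co_eqI) (auto simp: co_basis)
  then show ?thesis using W(1) x(1) by (simp add: subspace_scale)
qed

text \<open>A nonzero invariant subspace contains some eigenvector \<open>v i\<close> of
  \<open>A\<close>. The image of \<open>v n\<close> under \<open>B\<close> has nonzero coordinates
  at both neighbours of \<open>n\<close>, so membership spreads along the whole basis.\<close>

lemma irreducible_invariant_subspace:
  assumes linA: "lin A" and linB: "lin B" and dA: "diag_int (M A)" and irrB: "irr_tri_int d (M B)"
    and distinct: "\<And>i j. i \<le> d \<Longrightarrow> j \<le> d \<Longrightarrow> M A (int i) (int i) = M A (int j) (int j) \<Longrightarrow> i = j"
    and W: "subspace W" "\<And>w. w \<in> W \<Longrightarrow> A w \<in> W" "\<And>w. w \<in> W \<Longrightarrow> B w \<in> W"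
  shows "W = {0} \<or> W = UNIV"
proof (cases "W = {0}")
  case False
  then obtain w where "w \<in> W" "w \<noteq> 0"
    using subspace_0[OF W(1)] by auto
  then obtain i where i: "i \<le> d" "co w i \<noteq> 0"
    using co_eqI[of w 0] by auto
  note ev = eigenvector_in_invariant_subspace[OF linA dA distinct W(1,2)]
  have vi: "v i \<in> W"
    using ev[OF _ _ _ _ \<open>w \<in> W\<close> i(2,1)] .
  have coB: "co (B (v n)) k = M B (int k) (int n)" if "n \<le> d" "k \<le> d" for n k
    using that by (simp add: M_nat mat_of_co)
  have nz: "M B (int n + 1) (int n) \<noteq> 0" "M B (int n) (int n + 1) \<noteq> 0" if "n < d" for n
    using irrB that by (auto simp: irr_tri_int_def)
  have up: "v (Suc n) \<in> W" if "v n \<in> W" "n < d" for n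
  proof (rule ev[OF _ _ _ _ W(3)[OF that(1)]])
    show "co (B (v n)) (Suc n) \<noteq> 0"
      using nz[OF that(2)] that(2) by (simp add: coB add.commute)
  qed (use that in auto)
  have down: "v n \<in> W" if "v (Suc n) \<in> W" "n < d" for n
  proof (rule ev[OF _ _ _ _ W(3)[OF that(1)]])
    show "co (B (v (Suc n))) n \<noteq> 0"
      using nz[OF that(2)] that(2) by (simp add: coB add.commute)
  qed (use that in auto)
  have "v n \<in> W" if "n \<le> d" for n
  proof (cases "n \<le> i")
    case True
    then show ?thesis
      using vi i(1) by (induction rule: inc_induct) (auto intro: down)
  next
    case False
    then have "i \<le> n" by simp
    then show ?thesis
      using vi that by (induction rule: dec_induct) (auto intro: up)
  qed
  then have "span (v ` {..d}) \<subseteq> W"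
    using W(1) by (intro span_minimal) auto
  then show ?thesis using span_v by auto
qed simp

end

subsection \<open>Leonard triples\<close>

text \<open>The common weakening of the two diagonal conditions, strong enough for the relations
  between two maps; it lets both cases of the theorem share the argument up to the value of the end
  entry.\<close>

lemma (in vbasis) diag_end_vanishing:
  assumes "bipartite_mat d (mat_of scale d v X) \<or> almost_bipartite_mat d (mat_of scale d v X)"
  shows "\<exists>p\<in>{0, int d}. \<forall>i. i \<noteq> p \<longrightarrow> M X i i = 0"
proof -
  have "\<exists>p\<in>{0, d}. \<forall>i\<le>d. i \<noteq> p \<longrightarrow> mat_of scale d v X i i = 0"
    using assms
  proof
    assume "almost_bipartite_mat d (mat_of scale d v X)"
    then have 1: "(mat_of scale d v X 0 0 \<noteq> 0) \<noteq> (mat_of scale d v X d d \<noteq> 0)"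
      and 2: "1 \<le> i \<Longrightarrow> i < d \<Longrightarrow> mat_of scale d v X i i = 0" for i
      by (auto simp: almost_bipartite_mat_def)
    have 3: "mat_of scale d v X i i = 0" if "i \<le> d" "i \<noteq> 0" "i \<noteq> d" for i
      using that by (intro 2) auto
    show ?thesis
    proof (cases "mat_of scale d v X 0 0 = 0")
      case True
      then show ?thesis using 3 by (metis insertI1 insert_commute)
    next
      case False
      then show ?thesis using 1 3 by (metis insertI1)
    qed
  qed (auto simp: bipartite_mat_def)
  then obtain p where "p \<in> {0, d}" and p: "\<And>i. i \<le> d \<Longrightarrow> i \<noteq> p \<Longrightarrow> mat_of scale d v X i i = 0"
    by blast
  have "M X i i = 0" if "i \<noteq> int p" for i
    unfolding M_def using p[of "nat i"] that by auto
  then show ?thesis using \<open>p \<in> {0, d}\<close> by (intro bexI[of _ "int p"]) auto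
qed

context vspace
begin

lemma leonard_basisD:
  assumes "leonard_basis scale X Y v"
  shows "vbasis scale (diameter scale) v"
    "diag_int (vbasis.M scale (diameter scale) v X)"
    "irr_tri_int (diameter scale) (vbasis.M scale (diameter scale) v Y)"
proof -
  show v: "vbasis scale (diameter scale) v"
    using assms by unfold_locales (simp add: leonard_basis_def)
  show "diag_int (vbasis.M scale (diameter scale) v X)"
    "irr_tri_int (diameter scale) (vbasis.M scale (diameter scale) v Y)"
    using assms by (auto simp: leonard_basis_def vbasis.diag_int_M[OF v] vbasis.irr_tri_int_M[OF v])
qed

lemma bannai_ito_pairD:
  assumes bi: "bannai_ito_pair scale X Y"
    and v: "leonard_basis scale X Y v" and w: "leonard_basis scale Y X w"
    and i: "2 \<le> i" "i + 1 \<le> int (diameter scale)"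
  defines "\<theta> \<equiv> \<lambda>i. vbasis.M scale (diameter scale) v X i i"
    and "\<theta>' \<equiv> \<lambda>i. vbasis.M scale (diameter scale) w Y i i"
  shows "\<theta> (i - 2) + \<theta> (i - 1) = \<theta> i + \<theta> (i + 1)" "\<theta>' (i - 2) + \<theta>' (i - 1) = \<theta>' i + \<theta>' (i + 1)"
    "\<theta> (i - 1) \<noteq> \<theta> i"
proof -
  interpret V: vbasis scale "diameter scale" v using leonard_basisD(1)[OF v] .
  interpret W: vbasis scale "diameter scale" w using leonard_basisD(1)[OF w] .
  define n where "n = nat i"
  have n: "2 \<le> n" "n + 1 \<le> diameter scale" "i = int n"
    using i by (auto simp: n_def)
  have "\<theta> (int k) = mat_of scale (diameter scale) v X k k"
    "\<theta>' (int k) = mat_of scale (diameter scale) w Y k k" if "k \<le> diameter scale" for k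
    using that by (simp_all add: \<theta>_def \<theta>'_def V.M_nat W.M_nat)
  note t = this[of "n - 2"] this[of "n + 1"] this[of "n - 1"] this[of n]
  have le: "n - 2 \<le> diameter scale" "n - 1 \<le> diameter scale" "n \<le> diameter scale"
    using n(2) by auto
  note t = t(1,2)[OF le(1)] t(3,4)[OF n(2)] t(5,6)[OF le(2)] t(7,8)[OF le(3)]
  have th: "(\<theta> (int (n - 2)) - \<theta> (int (n + 1))) / (\<theta> (int (n - 1)) - \<theta> (int n)) = - 1"
    "(\<theta>' (int (n - 2)) - \<theta>' (int (n + 1))) / (\<theta>' (int (n - 1)) - \<theta>' (int n)) = - 1"
    unfolding t using bi v w n(1,2) unfolding bannai_ito_pair_def Let_def by blast+
  have "int (n - 2) = i - 2" "int (n + 1) = i + 1" "int (n - 1) = i - 1" "int n = i"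
    using n by auto
  note th = th[unfolded this]
  have *: "a + c = e + b" "c \<noteq> e" if "(a - b) / (c - e) = - 1" for a b c e :: 'a
  proof -
    \<comment> \<open>Division by zero yields 0, not -1, so the condition carries the nonvanishing
      of its denominator.\<close>
    show ne: "c \<noteq> e" using that by auto
    then have "a - b = - (c - e)" using that by (simp add: divide_eq_eq)
    then show "a + c = e + b" by (simp add: algebra_simps)
  qed
  show "\<theta> (i - 2) + \<theta> (i - 1) = \<theta> i + \<theta> (i + 1)" "\<theta>' (i - 2) + \<theta>' (i - 1) = \<theta>' i + \<theta>' (i + 1)"
    "\<theta> (i - 1) \<noteq> \<theta> i"
    using *[OF th(1)] *[OF th(2)] by simp_all
qed

lemma leonard_relation:
  assumes bi: "bannai_ito_pair scale X Y"
    and v: "leonard_basis scale X Y v" and w: "leonard_basis scale Y X w" and d: "3 \<le> diameter scale"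
    and p: "\<exists>p\<in>S. \<forall>i. i \<noteq> p \<longrightarrow> vbasis.M scale (diameter scale) v Y i i = 0"
    and p': "\<exists>p\<in>S'. \<forall>i. i \<noteq> p \<longrightarrow> vbasis.M scale (diameter scale) w X i i = 0"
  defines "\<theta> \<equiv> \<lambda>i. vbasis.M scale (diameter scale) v X i i"
  shows "\<theta> 0 + \<theta> 1 \<noteq> 0" "quad X Y ((\<theta> 0 + \<theta> 1)\<^sup>2)"
    "\<forall>n<diameter scale. \<theta> (int n) + \<theta> (int n + 1) = (- 1) ^ n * (\<theta> 0 + \<theta> 1)"
proof -
  have lin: "lin X" "lin Y"
    using bi by (auto simp: bannai_ito_pair_def leonard_pair_def)
  obtain p where p: "\<And>i. i \<noteq> p \<Longrightarrow> vbasis.M scale (diameter scale) v Y i i = 0"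
    using p by blast
  obtain p' where p': "\<And>i. i \<noteq> p' \<Longrightarrow> vbasis.M scale (diameter scale) w X i i = 0"
    using p' by blast
  define \<theta>' where "\<theta>' = (\<lambda>i. vbasis.M scale (diameter scale) w Y i i)"
  note V = leonard_basisD[OF v] and W = leonard_basisD[OF w]
  have th: "\<theta> i = vbasis.M scale (diameter scale) v X i i"
    "\<theta>' i = vbasis.M scale (diameter scale) w Y i i" for i
    by (simp_all add: \<theta>_def \<theta>'_def)
  have bi: "\<theta> (i - 2) + \<theta> (i - 1) = \<theta> i + \<theta> (i + 1)" "\<theta>' (i - 2) + \<theta>' (i - 1) = \<theta>' i + \<theta>' (i + 1)"
    if "2 \<le> i" "i + 1 \<le> int (diameter scale)" for i
    using bannai_ito_pairD(1,2)[OF assms(1) v w that] by (simp_all add: th)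
  show "\<theta> 0 + \<theta> 1 \<noteq> 0" "quad X Y ((\<theta> 0 + \<theta> 1)\<^sup>2)"
    "\<forall>n<diameter scale. \<theta> (int n) + \<theta> (int n + 1) = (- 1) ^ n * (\<theta> 0 + \<theta> 1)"
    by (rule bannai_ito_relation[where \<theta> = \<theta> and \<theta>' = \<theta>' and p = p and p' = p' and A = X and B = Y,
          OF V(1) W(1) lin d V(2,3) W(2,3)]; (fact th bi | erule p p'))+
qed

lemma leonard_basis_rev:
  assumes "leonard_basis scale X Y v"
  shows "leonard_basis scale X Y (\<lambda>i. v (diameter scale - i))"
proof -
  let ?d = "diameter scale"
  interpret V: vbasis scale ?d v using leonard_basisD(1)[OF assms] .
  note rev = V.mat_of_rev
  have X: "diagonal_mat ?d (mat_of scale ?d v X)"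
    and Y: "tridiagonal_mat ?d (mat_of scale ?d v Y)"
      "\<And>i. i < ?d \<Longrightarrow> mat_of scale ?d v Y (i + 1) i \<noteq> 0 \<and> mat_of scale ?d v Y i (i + 1) \<noteq> 0"
    using assms by (auto simp: leonard_basis_def irreducible_tridiagonal_mat_def)
  have "diagonal_mat ?d (mat_of scale ?d (\<lambda>i. v (?d - i)) X)"
    using X unfolding diagonal_mat_def rev by auto
  moreover have "tridiagonal_mat ?d (mat_of scale ?d (\<lambda>i. v (?d - i)) Y)"
    unfolding tridiagonal_mat_def rev
  proof (intro allI impI)
    fix i j assume "i \<le> ?d" "j \<le> ?d" "i + 1 < j \<or> j + 1 < i"
    then have "?d - i + 1 < ?d - j \<or> ?d - j + 1 < ?d - i" by auto
    then show "mat_of scale ?d v Y (?d - i) (?d - j) = 0"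
      using Y(1) by (auto simp: tridiagonal_mat_def)
  qed
  moreover have "mat_of scale ?d v Y (?d - (i + 1)) (?d - i) \<noteq> 0 \<and>
      mat_of scale ?d v Y (?d - i) (?d - (i + 1)) \<noteq> 0" if "i < ?d" for i
    using Y(2)[of "?d - (i + 1)"] that by (simp add: Suc_diff_Suc)
  ultimately show ?thesis
    using V.indexed_basis_rev
    by (simp add: leonard_basis_def irreducible_tridiagonal_mat_def rev)
qed

end

locale bannai_ito_leonard_triple = vspace scale
  for scale :: "'a::field_char_0 \<Rightarrow> 'b::ab_group_add \<Rightarrow> 'b" +
  fixes A B C :: "'b \<Rightarrow> 'b"
  assumes bi: "bannai_ito_triple scale A B C"
    and diam: "3 \<le> diameter scale"
    and total: "totally_bipartite scale A B C \<or> totally_almost_bipartite scale A B C"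
begin

abbreviation d :: nat where "d \<equiv> diameter scale"
abbreviation Mat :: "(nat \<Rightarrow> 'b) \<Rightarrow> ('b \<Rightarrow> 'b) \<Rightarrow> int \<Rightarrow> int \<Rightarrow> 'a" where
  "Mat v \<equiv> vbasis.M scale d v"

lemma lins: "lin A" "lin B" "lin C"
  using bi by (auto simp: bannai_ito_triple_def leonard_triple_def)

lemma diag_ends:
  "triple_basis scale A B C v \<Longrightarrow> \<exists>p\<in>{0, int d}. \<forall>i. i \<noteq> p \<longrightarrow> Mat v B i i = 0"
  "triple_basis scale A B C v \<Longrightarrow> \<exists>p\<in>{0, int d}. \<forall>i. i \<noteq> p \<longrightarrow> Mat v C i i = 0"
  "triple_basis scale B C A v \<Longrightarrow> \<exists>p\<in>{0, int d}. \<forall>i. i \<noteq> p \<longrightarrow> Mat v C i i = 0"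
  "triple_basis scale B C A v \<Longrightarrow> \<exists>p\<in>{0, int d}. \<forall>i. i \<noteq> p \<longrightarrow> Mat v A i i = 0"
  "triple_basis scale C A B v \<Longrightarrow> \<exists>p\<in>{0, int d}. \<forall>i. i \<noteq> p \<longrightarrow> Mat v A i i = 0"
  "triple_basis scale C A B v \<Longrightarrow> \<exists>p\<in>{0, int d}. \<forall>i. i \<noteq> p \<longrightarrow> Mat v B i i = 0"
proof -
  have ends: "all_triple_mats scale (\<lambda>d M. bipartite_mat d M \<or> almost_bipartite_mat d M) A B C"
    using total unfolding totally_bipartite_def totally_almost_bipartite_def all_triple_mats_def by blast
  have vb: "vbasis scale d v" if "triple_basis scale X Y Z v" for X Y Z
    using that leonard_basisD(1) by (auto simp: triple_basis_def)
  note * = vbasis.diag_end_vanishing[OF vb] ends[unfolded all_triple_mats_def]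
  show
    "triple_basis scale A B C v \<Longrightarrow> \<exists>p\<in>{0, int d}. \<forall>i. i \<noteq> p \<longrightarrow> Mat v B i i = 0"
    "triple_basis scale A B C v \<Longrightarrow> \<exists>p\<in>{0, int d}. \<forall>i. i \<noteq> p \<longrightarrow> Mat v C i i = 0"
    using *(1)[of A B C] *(2) by blast+
  show
    "triple_basis scale B C A v \<Longrightarrow> \<exists>p\<in>{0, int d}. \<forall>i. i \<noteq> p \<longrightarrow> Mat v C i i = 0"
    "triple_basis scale B C A v \<Longrightarrow> \<exists>p\<in>{0, int d}. \<forall>i. i \<noteq> p \<longrightarrow> Mat v A i i = 0"
    using *(1)[of B C A] *(2) by blast+
  show
    "triple_basis scale C A B v \<Longrightarrow> \<exists>p\<in>{0, int d}. \<forall>i. i \<noteq> p \<longrightarrow> Mat v A i i = 0"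
    "triple_basis scale C A B v \<Longrightarrow> \<exists>p\<in>{0, int d}. \<forall>i. i \<noteq> p \<longrightarrow> Mat v B i i = 0"
    using *(1)[of C A B] *(2) by blast+
qed

lemma obtain_bases:
  obtains v w u where "triple_basis scale A B C v" "triple_basis scale B C A w" "triple_basis scale C A B u"
  using bi by (auto simp: bannai_ito_triple_def leonard_triple_def)

text \<open>One constant serves \<open>B\<close> and \<open>C\<close> alike, because it depends only
  on the eigenvalues of \<open>A\<close> in a basis that suits both pairs.\<close>

lemma relation_A:
  assumes v: "triple_basis scale A B C v"
  defines "s \<equiv> Mat v A 0 0 + Mat v A 1 1"
  shows "s \<noteq> 0" "quad A B (s\<^sup>2)" "quad A C (s\<^sup>2)"
    "\<forall>n<d. Mat v A (int n) (int n) + Mat v A (int n + 1) (int n + 1) = (- 1) ^ n * s"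
    "\<And>i. 2 \<le> i \<Longrightarrow> i + 1 \<le> int d \<Longrightarrow> Mat v A (i - 1) (i - 1) \<noteq> Mat v A i i"
proof -
  obtain w u where w: "triple_basis scale B C A w" and u: "triple_basis scale C A B u"
    using obtain_bases by blast
  have AB: "bannai_ito_pair scale A B" "leonard_basis scale A B v" "leonard_basis scale B A w"
    and AC: "bannai_ito_pair scale A C" "leonard_basis scale A C v" "leonard_basis scale C A u"
    using bi v w u by (auto simp: bannai_ito_triple_def triple_basis_def)
  show "s \<noteq> 0" "quad A B (s\<^sup>2)"
    "\<forall>n<d. Mat v A (int n) (int n) + Mat v A (int n + 1) (int n + 1) = (- 1) ^ n * s"
    using leonard_relation[OF AB diam diag_ends(1)[OF v] diag_ends(4)[OF w]] by (simp_all add: s_def)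
  show "quad A C (s\<^sup>2)"
    using leonard_relation[OF AC diam diag_ends(2)[OF v] diag_ends(5)[OF u]] by (simp add: s_def)
  show "Mat v A (i - 1) (i - 1) \<noteq> Mat v A i i" if "2 \<le> i" "i + 1 \<le> int d" for i
    using bannai_ito_pairD(3)[OF AB that] .
qed

lemma relation_BC:
  obtains \<rho> \<rho>' where "\<rho> \<noteq> 0" "quad B A (\<rho>\<^sup>2)" "quad B C (\<rho>\<^sup>2)" "\<rho>' \<noteq> 0" "quad C A (\<rho>'\<^sup>2)"
proof -
  obtain v w u where v: "triple_basis scale A B C v" and w: "triple_basis scale B C A w"
    and u: "triple_basis scale C A B u"
    using obtain_bases by blast
  have BA: "bannai_ito_pair scale B A" "leonard_basis scale B A w" "leonard_basis scale A B v"
    and BC: "bannai_ito_pair scale B C" "leonard_basis scale B C w" "leonard_basis scale C B u"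
    and CA: "bannai_ito_pair scale C A" "leonard_basis scale C A u" "leonard_basis scale A C v"
    using bi v w u by (auto simp: bannai_ito_triple_def triple_basis_def)
  show thesis
    using that leonard_relation(1,2)[OF BA diam diag_ends(4)[OF w] diag_ends(1)[OF v]]
      leonard_relation(2)[OF BC diam diag_ends(3)[OF w] diag_ends(6)[OF u]]
      leonard_relation(1,2)[OF CA diam diag_ends(5)[OF u] diag_ends(2)[OF v]]
    by blast
qed

text \<open>Fixes the orientation of the eigenbasis: a nonzero diagonal entry of \<open>B\<close>
  may stand only at \<open>d\<close>, where the convention \<open>v (d + 1) = v d\<close> of type AB
  produces it.\<close>

definition normal_basis :: "(nat \<Rightarrow> 'b) \<Rightarrow> bool" where
  "normal_basis v \<longleftrightarrow> triple_basis scale A B C v \<and> (\<forall>i. i \<noteq> int d \<longrightarrow> Mat v B i i = 0)"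

lemma triple_basis_rev:
  "triple_basis scale A B C v \<Longrightarrow> triple_basis scale A B C (\<lambda>i. v (d - i))"
  by (simp add: triple_basis_def leonard_basis_rev)

lemma Mat_rev:
  assumes "triple_basis scale A B C v"
  shows "Mat (\<lambda>i. v (d - i)) X i j = Mat v X (int d - i) (int d - j)"
proof -
  have v: "leonard_basis scale A B v" using assms by (simp add: triple_basis_def)
  interpret V: vbasis scale d v using leonard_basisD(1)[OF v] .
  interpret R: vbasis scale d "\<lambda>i. v (d - i)" using leonard_basisD(1)[OF leonard_basis_rev[OF v]] .
  show ?thesis
    unfolding V.M_def R.M_def by (auto simp: V.mat_of_rev nat_diff_distrib)
qed

lemma normal_basis_exists: obtains v where "normal_basis v"
proof -
  obtain v where v: "triple_basis scale A B C v"
    using obtain_bases by blast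
  obtain p where p: "p \<in> {0, int d}" "\<And>i. i \<noteq> p \<Longrightarrow> Mat v B i i = 0"
    using diag_ends(1)[OF v] by blast
  show thesis
  proof (cases "p = int d")
    case True
    then show ?thesis using p v that by (auto simp: normal_basis_def)
  next
    case False
    then have "Mat (\<lambda>i. v (d - i)) B i i = 0" if "i \<noteq> int d" for i
      using p that by (simp add: Mat_rev[OF v])
    then show ?thesis using triple_basis_rev[OF v] that by (auto simp: normal_basis_def)
  qed
qed

lemma normal_basisD:
  assumes "normal_basis v"
  shows "triple_basis scale A B C v" "vbasis scale d v" "diag_int (Mat v A)"
    "irr_tri_int d (Mat v B)" "irr_tri_int d (Mat v C)" "\<forall>i. i \<noteq> int d \<longrightarrow> Mat v B i i = 0"
  using assms leonard_basisD by (auto simp: normal_basis_def triple_basis_def)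

lemma spectrum:
  assumes v: "normal_basis v" and BA: "quad B A \<rho>" "\<rho> \<noteq> 0"
  defines "s \<equiv> Mat v A 0 0 + Mat v A 1 1" and "e \<equiv> Mat v B (int d) (int d)"
  obtains m where
    "\<And>n. n \<le> d \<Longrightarrow> Mat v A (int n) (int n) = (- 1) ^ n * (s / 2) * (m - 2 * of_nat n)"
    "\<And>n. n < d \<Longrightarrow> Mat v B (int n + 1) (int n) * Mat v B (int n) (int n + 1) =
        \<rho> / 4 * of_nat (n + 1) * (m - of_nat n)"
    "e = 0 \<Longrightarrow> m = of_nat d"
    "e \<noteq> 0 \<Longrightarrow> m = 2 * of_nat d + 1 \<and> e\<^sup>2 = \<rho> / 4 * (of_nat (d + 1))\<^sup>2"
proof -
  note v' = normal_basisD[OF v]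
  interpret V: vbasis scale d v by (fact v'(2))
  note rA = relation_A[OF v'(1), folded s_def]
  have "cubic (Mat v B) (Mat v A) i j = \<rho> * Mat v A i j" for i j
    using lins BA by (intro V.M_cubic irr_tri_int_tri[OF v'(4)] diag_int_tri[OF v'(3)])
  moreover have "1 \<le> d" using diam by simp
  moreover have "Mat v B 0 (-1) = 0" "Mat v B (int d + 1) (int d) = 0"
    by (simp_all add: V.M_outside)
  ultimately show thesis
    using that[of "2 * Mat v A 0 0 / s"]
      bannai_ito_spectrum[OF v'(3,4) _ _ _ rA(4) rA(1) BA(2) v'(6)] unfolding e_def by blast
qed

text \<open>In a normal basis the entry of \<open>B\<close> at index 0 vanishes, so the exclusive
  alternative in \<open>almost_bipartite_mat\<close> falls on \<open>d\<close>.\<close>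

lemma end_nonzero:
  assumes "normal_basis v"
  shows "totally_bipartite scale A B C \<Longrightarrow> Mat v B (int d) (int d) = 0"
    "totally_almost_bipartite scale A B C \<Longrightarrow> Mat v B (int d) (int d) \<noteq> 0"
proof -
  note v = normal_basisD[OF assms]
  interpret V: vbasis scale d v by (fact v(2))
  show "totally_bipartite scale A B C \<Longrightarrow> Mat v B (int d) (int d) = 0"
    using v(1) V.M_nat[of d d B]
    by (simp add: totally_bipartite_def all_triple_mats_def bipartite_mat_def)
  show "totally_almost_bipartite scale A B C \<Longrightarrow> Mat v B (int d) (int d) \<noteq> 0"
    using v(1) v(6)[rule_format, of 0] diam V.M_nat[of d d B] V.M_nat[of 0 0 B]
    by (auto simp: totally_almost_bipartite_def all_triple_mats_def almost_bipartite_mat_def)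
qed

text \<open>A nonzero entry of \<open>C\<close> at 0 would force
  \<open>3 * \<theta>\<^sub>0 + \<theta>\<^sub>1 = 0\<close> through entry \<open>(1, 0)\<close> of
  the relation of \<open>C\<close> with \<open>A\<close>. It would also exclude the bipartite case,
  so that \<open>B\<close> fixes \<open>m = 2 * d + 1\<close> and this combination equals
  \<open>s * (2 * d + 2)\<close>.\<close>

lemma normal_basis_C:
  assumes v: "normal_basis v"
  shows "\<forall>i. i \<noteq> int d \<longrightarrow> Mat v C i i = 0"
proof -
  note v' = normal_basisD[OF v]
  interpret V: vbasis scale d v by (fact v'(2))
  obtain p where p: "p \<in> {0, int d}" "\<And>i. i \<noteq> p \<Longrightarrow> Mat v C i i = 0"
    using diag_ends(2)[OF v'(1)] by blast
  have "Mat v C 0 0 = 0"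
  proof (rule ccontr)
    assume C0: "Mat v C 0 0 \<noteq> 0"
    then have "p = 0" using p(2)[of 0] by auto
    then have C1: "Mat v C 1 1 = 0" using p(2)[of 1] by simp
    have "\<not> totally_bipartite scale A B C"
      using C0 v'(1) V.M_nat[of 0 0 C]
      by (auto simp: totally_bipartite_def all_triple_mats_def bipartite_mat_def)
    then have e: "Mat v B (int d) (int d) \<noteq> 0"
      using total end_nonzero(2)[OF v] by blast
    obtain \<rho> \<rho>' where rho: "\<rho> \<noteq> 0" "quad B A (\<rho>\<^sup>2)" "quad C A (\<rho>'\<^sup>2)"
      using relation_BC by blast
    define s where "s = Mat v A 0 0 + Mat v A 1 1"
    obtain m where th: "\<And>n. n \<le> d \<Longrightarrow> Mat v A (int n) (int n) = (- 1) ^ n * (s / 2) * (m - 2 * of_nat n)"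
      and m: "m = 2 * of_nat d + 1"
      using spectrum[OF v rho(2)] rho(1) e unfolding s_def by (metis power_eq_0_iff)
    have "cubic (Mat v C) (Mat v A) 1 0 = \<rho>'\<^sup>2 * Mat v A 1 0"
      using lins rho(3) by (intro V.M_cubic irr_tri_int_tri[OF v'(5)] diag_int_tri[OF v'(3)])
    then have "Mat v C 1 0 * (Mat v C 0 0 * (3 * Mat v A 0 0 + Mat v A 1 1)) = 0"
      using cubic_subdiag[OF v'(3) irr_tri_int_tri[OF v'(5)], of 0] C1 diag_intD[OF v'(3)] by simp
    moreover have "Mat v C 1 0 \<noteq> 0"
      using v'(5) diam by (auto simp: irr_tri_int_def dest: spec[of _ 0])
    moreover have "3 * Mat v A 0 0 + Mat v A 1 1 = s * of_nat (2 * d + 2)"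
    proof -
      have "Mat v A 0 0 = s / 2 * m" "Mat v A 1 1 = - (s / 2 * (m - 2))"
        using th[of 0] th[of 1] diam by simp_all
      show ?thesis unfolding \<open>Mat v A 0 0 = _\<close> \<open>Mat v A 1 1 = _\<close> m by (simp add: field_simps)
    qed
    ultimately have "s * of_nat (2 * d + 2) = 0"
      using C0 by (metis mult_eq_0_iff)
    then show False
      using relation_A(1)[OF v'(1), folded s_def] unfolding mult_eq_0_iff of_nat_eq_0_iff by simp
  qed
  then show ?thesis using p by (metis empty_iff insert_iff)
qed

lemma anticommutator:
  obtains \<nu> where "\<nu> \<noteq> 0" "\<And>x. A (B x) + B (A x) = scale \<nu> (C x)"
proof -
  obtain v where v: "normal_basis v" using normal_basis_exists by blast
  note v' = normal_basisD[OF v]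
  interpret V: vbasis scale d v by (fact v'(2))
  obtain \<rho> \<rho>' where rho: "\<rho> \<noteq> 0" "quad B A (\<rho>\<^sup>2)" "quad B C (\<rho>\<^sup>2)" "\<rho>' \<noteq> 0" "quad C A (\<rho>'\<^sup>2)"
    using relation_BC by blast
  note tri = diag_int_tri[OF v'(3)] irr_tri_int_tri[OF v'(4)] irr_tri_int_tri[OF v'(5)]
  note cub = V.M_cubic[OF lins(2,1) tri(2,1) rho(2)] V.M_cubic[OF lins(3,1) tri(3,1) rho(5)]
    V.M_cubic[OF lins(2,3) tri(2,3) rho(3)]
  have "\<exists>\<nu>. \<nu> \<noteq> 0 \<and> (\<forall>i j. (Mat v A i i + Mat v A j j) * Mat v B i j = \<nu> * Mat v C i j)"
    by (rule anticommutator_proportional[OF v'(3,4,5) diam V.M_outside V.M_outside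
          relation_A(4)[OF v'(1)] relation_A(1)[OF v'(1)] _ _ v'(6) normal_basis_C[OF v] cub])
      (use rho in auto)
  then obtain \<nu> where nu: "\<nu> \<noteq> 0" "\<And>i j. (Mat v A i i + Mat v A j j) * Mat v B i j = \<nu> * Mat v C i j"
    by blast
  have "(\<lambda>x. A (B x) + B (A x)) = (\<lambda>x. scale \<nu> (C x))"
  proof (rule V.M_eqI)
    show "lin (\<lambda>x. A (B x) + B (A x))"
      by (rule lin_add[OF lin_comp[OF lins(1,2)] lin_comp[OF lins(2,1)]])
    show "lin (\<lambda>x. scale \<nu> (C x))"
      by (rule lin_scale[OF lins(3)])
    show "V.M (\<lambda>x. A (B x) + B (A x)) i j = V.M (\<lambda>x. scale \<nu> (C x)) i j" for i j
      unfolding V.M_add V.M_scale V.M_comp_diag_left[OF lins(1) v'(3), of B]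
        V.M_comp_diag_right[OF lins(2) v'(3)] nu(2)[symmetric]
      by (simp add: algebra_simps)
  qed
  then show thesis using nu(1) that by meson
qed

end

subsection \<open>Realizations\<close>

text \<open>The four values of \<open>n\<close> realise exactly the triples of signs with product
  1.\<close>

lemma exists_hat:
  fixes a b :: "'k::field"
  assumes "a = 1 \<or> a = - 1" "b = 1 \<or> b = - 1"
  shows "\<exists>n. hat GX n = a \<and> hat GY n = b \<and> hat GZ n = a * b"
proof -
  consider "a = 1" "b = 1" | "a = 1" "b = - 1" | "a = - 1" "b = 1" | "a = - 1" "b = - 1"
    using assms by blast
  then show ?thesis
  proof cases
    case 1
    then show ?thesis by (intro exI[of _ None]) (simp add: hat_def)
  next
    case 2
    then show ?thesis by (intro exI[of _ "Some GX"]) (simp add: hat_def)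
  next
    case 3
    then show ?thesis by (intro exI[of _ "Some GY"]) (simp add: hat_def)
  next
    case 4
    then show ?thesis by (intro exI[of _ "Some GZ"]) (simp add: hat_def)
  qed
qed

text \<open>On eigenvectors of \<open>x\<close> the anticommutator multiplies each component of
  \<open>y u\<close> by a sum of two eigenvalues. The neighbours \<open>lo\<close> and
  \<open>up\<close> are arbitrary vectors, so that they may be zero, or equal to \<open>u\<close>,
  at the ends of a basis.\<close>

lemma (in vspace) anticommutator_of_shift:
  assumes "lin x" "lin y" "x u = scale a u" "y u = scale p lo + scale q up"
    and "x lo = scale l lo" "x up = scale r up"
  shows "x (y u) + y (x u) = scale (p * (a + l)) lo + scale (q * (a + r)) up"
  using assms by (simp add: lin_iff scale_right_distrib scale_left_distrib distrib_left mult.commute add_ac)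

context bannai_ito_leonard_triple
begin

lemma nonzero_maps: "\<exists>x. A x \<noteq> 0" "\<exists>x. B x \<noteq> 0" "\<exists>x. C x \<noteq> 0"
proof -
  have *: "\<exists>x. Y x \<noteq> 0" if "leonard_basis scale X Y v" for X Y v
  proof -
    interpret V: vbasis scale d v using leonard_basisD(1)[OF that] .
    have "V.M Y 1 0 \<noteq> 0"
      using leonard_basisD(3)[OF that] diam by (auto simp: irr_tri_int_def dest: spec[of _ 0])
    then have "Y (v 0) \<noteq> 0"
      by (auto simp: V.M_def V.mat_of_co split: if_splits)
    then show ?thesis by blast
  qed
  obtain v w where "triple_basis scale A B C v" "triple_basis scale B C A w"
    using obtain_bases by blast
  then show "\<exists>x. A x \<noteq> 0" "\<exists>x. B x \<noteq> 0" "\<exists>x. C x \<noteq> 0"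
    using * by (auto simp: triple_basis_def)
qed

text \<open>Substituting AB + BA = \<nu> C into {B, {B, A}} = \<tau>^2 A and {A, {A, B}} =
  \<sigma>^2 B turns these into the two remaining anticommutators.\<close>

lemma anticommutators:
  obtains \<sigma> \<tau> \<nu> where "\<sigma> \<noteq> 0" "\<tau> \<noteq> 0" "\<nu> \<noteq> 0" "quad A B (\<sigma>\<^sup>2)" "quad B A (\<tau>\<^sup>2)"
    "\<And>x. A (B x) + B (A x) = scale \<nu> (C x)"
    "\<And>x. B (C x) + C (B x) = scale (\<tau>\<^sup>2 / \<nu>) (A x)"
    "\<And>x. C (A x) + A (C x) = scale (\<sigma>\<^sup>2 / \<nu>) (B x)"
proof -
  obtain v where "triple_basis scale A B C v"
    using obtain_bases by blast
  then obtain \<sigma> where A: "\<sigma> \<noteq> 0" "quad A B (\<sigma>\<^sup>2)"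
    using relation_A(1,2) by blast
  obtain \<tau> where B: "\<tau> \<noteq> 0" "quad B A (\<tau>\<^sup>2)"
    using relation_BC by blast
  obtain \<nu> where nu: "\<nu> \<noteq> 0" "\<And>x. A (B x) + B (A x) = scale \<nu> (C x)"
    using anticommutator by blast
  have *: "Y (Z x) + Z (Y x) = scale (\<rho> / \<nu>) (X x)"
    if q: "quad Y X \<rho>" and Z: "\<And>x. X (Y x) + Y (X x) = scale \<nu> (Z x)" and lin: "lin Y" for X Y Z \<rho> x
  proof -
    have two: "scale 2 z = z + z" for z
      using scale_left_distrib[of 1 1 z] by simp
    have "scale \<nu> (Y (Z x) + Z (Y x)) = Y (scale \<nu> (Z x)) + scale \<nu> (Z (Y x))"
      using lin by (simp add: lin_iff scale_right_distrib)
    also have "\<dots> = Y (Y (X x)) + (Y (X (Y x)) + Y (X (Y x))) + X (Y (Y x))"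
      using lin by (simp add: lin_iff add_ac flip: Z)
    also have "\<dots> = scale \<rho> (X x)"
      using q two unfolding quad_def by metis
    finally have "scale (1 / \<nu>) (scale \<nu> (Y (Z x) + Z (Y x))) = scale (1 / \<nu>) (scale \<rho> (X x))"
      by simp
    then show ?thesis using nu(1) by simp
  qed
  show thesis
  proof (rule that[OF A(1) B(1) nu(1) A(2) B(2) nu(2)])
    show "B (C x) + C (B x) = scale (\<tau>\<^sup>2 / \<nu>) (A x)" for x
      using *[OF B(2) nu(2) lins(2)] .
    show "C (A x) + A (C x) = scale (\<sigma>\<^sup>2 / \<nu>) (B x)" for x
      using *[OF A(2) _ lins(1), of C x] nu(2) by (simp add: add.commute)
  qed
qed

text \<open>For \<open>d = 2 * k + 1\<close> and \<open>m = d\<close> the two middle eigenvalues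
  coincide, which the nonzero denominators in the Bannai/Ito condition exclude.\<close>

lemma even_diameter:
  assumes v: "normal_basis v" and e: "Mat v B (int d) (int d) = 0"
  shows "even d"
proof (rule ccontr)
  assume "odd d"
  then obtain k where k: "d = 2 * k + 1" by (elim oddE)
  obtain \<tau> where B: "\<tau> \<noteq> 0" "quad B A (\<tau>\<^sup>2)"
    using relation_BC by blast
  define s where "s = Mat v A 0 0 + Mat v A 1 1"
  obtain m where th: "\<And>n. n \<le> d \<Longrightarrow> Mat v A (int n) (int n) = (- 1) ^ n * (s / 2) * (m - 2 * of_nat n)"
    and m: "m = of_nat d"
    using spectrum[OF v B(2)] B(1) e unfolding s_def by (metis power_eq_0_iff)
  have m': "m = 2 * of_nat k + 1"
    using m k by simp
  have "Mat v A (int k) (int k) = Mat v A (int (k + 1)) (int (k + 1))"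
  proof -
    have "k \<le> d" "k + 1 \<le> d" using k by auto
    then show ?thesis unfolding th[OF \<open>k \<le> d\<close>] th[OF \<open>k + 1 \<le> d\<close>] m' by simp
  qed
  then show False
    using relation_A(5)[OF normal_basisD(1)[OF v], of "int k + 1"] diam k by (simp add: add.commute)
qed

text \<open>Up to sign the eigenvalues form an arithmetic progression, so only indices of opposite
  parity can clash, and then \<open>m = i + j\<close>. For \<open>m = d\<close> this contradicts the
  evenness of \<open>d\<close>, for \<open>m = 2 * d + 1\<close> the bound
  \<open>i + j \<le> 2 * d\<close>.\<close>

lemma distinct_eigenvalues:
  assumes v: "normal_basis v" and ij: "i \<le> d" "j \<le> d"
    and eq: "Mat v A (int i) (int i) = Mat v A (int j) (int j)"
  shows "i = j"
proof -
  obtain \<tau> where B: "\<tau> \<noteq> 0" "quad B A (\<tau>\<^sup>2)"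
    using relation_BC by blast
  define s where "s = Mat v A 0 0 + Mat v A 1 1"
  obtain m where th: "\<And>n. n \<le> d \<Longrightarrow> Mat v A (int n) (int n) = (- 1) ^ n * (s / 2) * (m - 2 * of_nat n)"
    and m: "Mat v B (int d) (int d) = 0 \<Longrightarrow> m = of_nat d"
      "Mat v B (int d) (int d) \<noteq> 0 \<Longrightarrow> m = 2 * of_nat d + 1"
    using spectrum[OF v B(2)] B(1) unfolding s_def by (metis power_eq_0_iff)
  have s: "s \<noteq> 0"
    using relation_A(1)[OF normal_basisD(1)[OF v]] by (simp add: s_def)
  have "(s / 2) * ((- 1) ^ i * (m - 2 * of_nat i)) = (s / 2) * ((- 1) ^ j * (m - 2 * of_nat j))"
    using eq th[OF ij(1)] th[OF ij(2)] by (simp only: mult_ac)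
  then have e: "(- 1) ^ i * (m - 2 * of_nat i) = (- 1) ^ j * (m - 2 * of_nat j)"
    using s by simp
  show ?thesis
  proof (cases "even i = even j")
    case True
    then have "m - 2 * of_nat i = m - 2 * of_nat j"
      using e by (cases "even i") auto
    then show ?thesis by simp
  next
    case False
    then have "m - 2 * of_nat i = - (m - 2 * of_nat j)"
      using e by (cases "even i") auto
    then have "2 * m = 2 * of_nat (i + j)"
      by (simp add: algebra_simps)
    then have mij: "m = of_nat (i + j)"
      by (metis mult_left_cancel zero_neq_numeral)
    show ?thesis
    proof (cases "Mat v B (int d) (int d) = 0")
      case True
      then have "d = i + j"
        using m(1) mij of_nat_eq_iff by metis
      then show ?thesis using even_diameter[OF v True] False by simp
    next
      case F: False
      then have "(of_nat (2 * d + 1) :: 'a) = of_nat (i + j)"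
        using m(2) mij by simp
      then have "2 * d + 1 = i + j"
        by (simp only: of_nat_eq_iff)
      then show ?thesis using ij by simp
    qed
  qed
qed

section \<open>Module structures with prescribed scalars\<close>

definition gens :: "'a \<Rightarrow> 'a \<Rightarrow> 'a \<Rightarrow> gen \<Rightarrow> 'b \<Rightarrow> 'b" where
  "gens \<xi> \<xi>s \<xi>e g = (case g of GX \<Rightarrow> \<lambda>x. scale (1 / \<xi>) (A x)
     | GY \<Rightarrow> \<lambda>x. scale (1 / \<xi>s) (B x) | GZ \<Rightarrow> \<lambda>x. scale (1 / \<xi>e) (C x))"

lemma lin_gens: "lin (gens \<xi> \<xi>s \<xi>e g)"
  using lins by (cases g) (auto simp: gens_def intro: lin_scale)

lemma realization_acs_eval:
  assumes "(\<xi>, \<xi>s, \<xi>e, act) \<in> realizations scale A B C"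
  shows "act = acs_eval (gens \<xi> \<xi>s \<xi>e)" "acs_rels (gens \<xi> \<xi>s \<xi>e)"
    "\<And>g. act (acs_gen g) = gens \<xi> \<xi>s \<xi>e g"
proof -
  have act: "acs_module scale act" and nz: "\<xi> \<noteq> 0" "\<xi>s \<noteq> 0" "\<xi>e \<noteq> 0"
    and eq: "\<And>v. A v = scale \<xi> (act acs_x v)" "\<And>v. B v = scale \<xi>s (act acs_y v)"
      "\<And>v. C v = scale \<xi>e (act acs_z v)"
    using assms by (auto simp: realizations_def irreducible_acs_module_def)
  show gens: "act (acs_gen g) = gens \<xi> \<xi>s \<xi>e g" for g
    using nz by (cases g) (simp_all add: gens_def eq fun_eq_iff)
  show rels: "acs_rels (gens \<xi> \<xi>s \<xi>e)"
    using acs_rels_acs_module[OF act] by (simp only: gens)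
  show "act = acs_eval (gens \<xi> \<xi>s \<xi>e)"
    by (rule acs_module_eqI[OF act acs_module_acs_eval[OF lin_gens rels]])
      (simp add: gens acs_eval_gen[OF lin_gens rels])
qed

lemma irreducible_acs_eval:
  assumes rels: "acs_rels (gens \<xi> \<xi>s \<xi>e)" and nz: "\<xi> \<noteq> 0" "\<xi>s \<noteq> 0"
  shows "irreducible_acs_module scale (acs_eval (gens \<xi> \<xi>s \<xi>e))"
proof -
  let ?act = "acs_eval (gens \<xi> \<xi>s \<xi>e)"
  note gen = acs_eval_gen[OF lin_gens rels]
  obtain v where v: "normal_basis v" using normal_basis_exists by blast
  note v' = normal_basisD[OF v]
  interpret V: vbasis scale d v by (fact v'(2))
  have "W = {0} \<or> W = UNIV" if W: "subspace W" and inv: "\<forall>a. \<forall>w\<in>W. ?act a w \<in> W" for W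
  proof (rule V.irreducible_invariant_subspace[OF lins(1,2) v'(3,4) distinct_eigenvalues[OF v] W])
    show "A w \<in> W" if "w \<in> W" for w
    proof -
      have "scale \<xi> (?act acs_x w) \<in> W"
        using inv that W by (intro subspace_scale) auto
      then show ?thesis using nz by (simp add: gen gens_def)
    qed
    show "B w \<in> W" if "w \<in> W" for w
    proof -
      have "scale \<xi>s (?act acs_y w) \<in> W"
        using inv that W by (intro subspace_scale) auto
      then show ?thesis using nz by (simp add: gen gens_def)
    qed
  qed
  moreover have "(UNIV :: 'b set) \<noteq> {0}"
    using nonzero_maps(1) by blast
  ultimately show ?thesis
    using acs_module_acs_eval[OF lin_gens rels] by (simp add: irreducible_acs_module_def)
qed

text \<open>After substitution of the rescaled maps each defining relation compares two multiples of
  the same nonzero map. The relation for \<open>z\<close> determines \<open>\<xi>e\<close>; once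
  \<open>\<xi>e\<close> is eliminated, \<open>\<nu>\<close> drops out of the other two, which leaves
  the squares of \<open>\<xi>s\<close> and \<open>\<xi>\<close>.\<close>

lemma realization_iff:
  assumes nz: "\<sigma> \<noteq> 0" "\<tau> \<noteq> 0" "\<nu> \<noteq> 0"
    and AB: "\<And>x. A (B x) + B (A x) = scale \<nu> (C x)"
    and BC: "\<And>x. B (C x) + C (B x) = scale (\<tau>\<^sup>2 / \<nu>) (A x)"
    and CA: "\<And>x. C (A x) + A (C x) = scale (\<sigma>\<^sup>2 / \<nu>) (B x)"
  shows "(\<xi>, \<xi>s, \<xi>e, act) \<in> realizations scale A B C \<longleftrightarrow>
    (2 * \<xi>)\<^sup>2 = \<sigma>\<^sup>2 \<and> (2 * \<xi>s)\<^sup>2 = \<tau>\<^sup>2 \<and> \<xi>e = 2 * \<xi> * \<xi>s / \<nu> \<and> act = acs_eval (gens \<xi> \<xi>s \<xi>e)"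
    (is "_ \<longleftrightarrow> ?rhs")
proof
  assume r: "(\<xi>, \<xi>s, \<xi>e, act) \<in> realizations scale A B C"
  then have z: "\<xi> \<noteq> 0" "\<xi>s \<noteq> 0" "\<xi>e \<noteq> 0"
    by (auto simp: realizations_def)
  have linA: "A (scale c x) = scale c (A x)" "B (scale c x) = scale c (B x)" "C (scale c x) = scale c (C x)" for c x
    using lins by (auto simp: lin_iff)
  have rel: "scale (1 / (\<xi> * \<xi>s)) (A (B x) + B (A x)) = scale (2 / \<xi>e) (C x)"
    "scale (1 / (\<xi>s * \<xi>e)) (B (C x) + C (B x)) = scale (2 / \<xi>) (A x)"
    "scale (1 / (\<xi>e * \<xi>)) (C (A x) + A (C x)) = scale (2 / \<xi>s) (B x)" for x
    using realization_acs_eval(2)[OF r]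
    by (simp_all add: acs_rels_def gens_def linA scale_right_distrib mult.commute)
  obtain x y z where xyz: "A x \<noteq> 0" "B y \<noteq> 0" "C z \<noteq> 0"
    using nonzero_maps by blast
  have "1 / (\<xi> * \<xi>s) * \<nu> = 2 / \<xi>e"
    using rel(1)[of z] xyz(3) unfolding AB scale_scale by (rule scale_right_imp_eq[rotated])
  then have 1: "\<xi>e = 2 * \<xi> * \<xi>s / \<nu>"
    using z nz by (simp add: field_simps)
  have "1 / (\<xi>s * \<xi>e) * (\<tau>\<^sup>2 / \<nu>) = 2 / \<xi>"
    using rel(2)[of x] xyz(1) unfolding BC scale_scale by (rule scale_right_imp_eq[rotated])
  then have 2: "(2 * \<xi>s)\<^sup>2 = \<tau>\<^sup>2"
    unfolding 1 using z nz by (simp add: field_simps power2_eq_square)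
  have "1 / (\<xi>e * \<xi>) * (\<sigma>\<^sup>2 / \<nu>) = 2 / \<xi>s"
    using rel(3)[of y] xyz(2) unfolding CA scale_scale by (rule scale_right_imp_eq[rotated])
  then have 3: "(2 * \<xi>)\<^sup>2 = \<sigma>\<^sup>2"
    unfolding 1 using z nz by (simp add: field_simps power2_eq_square)
  show ?rhs using 1 2 3 realization_acs_eval(1)[OF r] by blast
next
  assume r: ?rhs
  then have x2: "\<sigma>\<^sup>2 = 4 * \<xi>\<^sup>2" and y2: "\<tau>\<^sup>2 = 4 * \<xi>s\<^sup>2" and e: "\<xi>e = 2 * \<xi> * \<xi>s / \<nu>"
    by (auto simp: power_mult_distrib)
  have z: "\<xi> \<noteq> 0" "\<xi>s \<noteq> 0" "\<xi>e \<noteq> 0"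
    using x2 y2 e nz by auto
  have linA: "A (scale c x) = scale c (A x)" "B (scale c x) = scale c (B x)" "C (scale c x) = scale c (C x)" for c x
    using lins by (auto simp: lin_iff)
  have rel: "scale (1 / (\<xi> * \<xi>s)) (A (B x) + B (A x)) = scale (2 / \<xi>e) (C x)"
    "scale (1 / (\<xi>s * \<xi>e)) (B (C x) + C (B x)) = scale (2 / \<xi>) (A x)"
    "scale (1 / (\<xi>e * \<xi>)) (C (A x) + A (C x)) = scale (2 / \<xi>s) (B x)" for x
    unfolding AB BC CA scale_scale x2 y2
    using z nz by (simp_all add: e power2_eq_square)
  have rels: "acs_rels (gens \<xi> \<xi>s \<xi>e)"
    using rel by (simp add: acs_rels_def gens_def linA scale_right_distrib mult.commute)
  have act: "act = acs_eval (gens \<xi> \<xi>s \<xi>e)"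
    using r by blast
  show "(\<xi>, \<xi>s, \<xi>e, act) \<in> realizations scale A B C"
    unfolding act using z irreducible_acs_eval[OF rels z(1,2)]
    by (simp add: realizations_def acs_eval_gen[OF lin_gens rels] gens_def)
qed

end

section \<open>Identification of the module types and counting\<close>

context bannai_ito_leonard_triple
begin

lemma realization_module:
  assumes "(\<xi>, \<xi>s, \<xi>e, act) \<in> realizations scale A B C"
  shows "irreducible_acs_module scale act" "\<xi> \<noteq> 0" "\<xi>s \<noteq> 0" "lin (act a)"
    "act acs_x v = scale (1 / \<xi>) (A v)" "act acs_y v = scale (1 / \<xi>s) (B v)"
    "act acs_z v = scale (1 / 2) (act acs_x (act acs_y v) + act acs_y (act acs_x v))"
proof -
  show "irreducible_acs_module scale act" "\<xi> \<noteq> 0" "\<xi>s \<noteq> 0" "lin (act a)"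
    using assms by (auto simp: realizations_def irreducible_acs_module_def acs_module_def)
  show "act acs_x v = scale (1 / \<xi>) (A v)" "act acs_y v = scale (1 / \<xi>s) (B v)"
    using realization_acs_eval(3)[OF assms] by (simp_all add: gens_def)
  show "act acs_z v = scale (1 / 2) (act acs_x (act acs_y v) + act acs_y (act acs_x v))"
    using acs_rels_acs_module[of act] assms
    by (simp add: acs_rels_def realizations_def irreducible_acs_module_def)
qed

text \<open>The scalars are controlled by constants from some eigenbasis; since \<open>B\<close> is
  nonzero, \<open>quad_unique\<close> identifies them with the constant of the given one.\<close>

lemma realization_scalars:
  assumes r: "(\<xi>, \<xi>s, \<xi>e, act) \<in> realizations scale A B C" and v: "normal_basis v"
  shows "(Mat v A 0 0 + Mat v A 1 1)\<^sup>2 = (2 * \<xi>)\<^sup>2" "quad B A ((2 * \<xi>s)\<^sup>2)"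
proof -
  obtain \<sigma> \<tau> \<nu> where *: "\<sigma> \<noteq> 0" "\<tau> \<noteq> 0" "\<nu> \<noteq> 0" and q: "quad A B (\<sigma>\<^sup>2)" "quad B A (\<tau>\<^sup>2)"
    and rel: "\<And>x. A (B x) + B (A x) = scale \<nu> (C x)"
    "\<And>x. B (C x) + C (B x) = scale (\<tau>\<^sup>2 / \<nu>) (A x)"
    "\<And>x. C (A x) + A (C x) = scale (\<sigma>\<^sup>2 / \<nu>) (B x)"
    using anticommutators by blast
  have sq: "(2 * \<xi>)\<^sup>2 = \<sigma>\<^sup>2" "(2 * \<xi>s)\<^sup>2 = \<tau>\<^sup>2"
    using realization_iff[OF * rel] r by blast+
  obtain x where "B x \<noteq> 0" using nonzero_maps by blast
  then show "(Mat v A 0 0 + Mat v A 1 1)\<^sup>2 = (2 * \<xi>)\<^sup>2"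
    using quad_unique[OF relation_A(2)[OF normal_basisD(1)[OF v]] q(1)] sq by simp
  show "quad B A ((2 * \<xi>s)\<^sup>2)"
    using q(2) sq by simp
qed

lemma eigen_basis:
  assumes v: "normal_basis v" and i: "i \<le> d"
  shows "A (v i) = scale (Mat v A (int i) (int i)) (v i)"
proof -
  note v' = normal_basisD[OF v]
  interpret V: vbasis scale d v by (fact v'(2))
  show ?thesis
    unfolding V.lin_basis_image[OF lins(1) diag_int_tri[OF v'(3)] i]
    by (simp add: diag_intD[OF v'(3)])
qed

text \<open>With all diagonal entries of \<open>B\<close> zero, the reversed basis is again normal,
  and as \<open>d\<close> is even the reversal changes the sign of the sum.\<close>

lemma normal_basis_bipartite:
  assumes tb: "totally_bipartite scale A B C" and r: "(\<xi>, \<xi>s, \<xi>e, act) \<in> realizations scale A B C"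
  obtains v where "normal_basis v" "Mat v A 0 0 + Mat v A 1 1 = 2 * \<xi>"
proof -
  obtain v where v: "normal_basis v" using normal_basis_exists by blast
  note v' = normal_basisD[OF v]
  define s where "s = Mat v A 0 0 + Mat v A 1 1"
  have e: "Mat v B (int d) (int d) = 0"
    using end_nonzero(1)[OF v tb] .
  have "s = 2 * \<xi> \<or> s = - (2 * \<xi>)"
    using realization_scalars(1)[OF r v] unfolding power2_eq_iff s_def .
  then show thesis
  proof
    assume "s = - (2 * \<xi>)"
    obtain k where k: "d = Suc k" using diam by (cases d) auto
    have "Mat v B i i = 0" for i
      using v'(6) e by (cases "i = int d") auto
    then have n: "normal_basis (\<lambda>i. v (d - i))"
      using triple_basis_rev[OF v'(1)] by (simp add: normal_basis_def Mat_rev[OF v'(1)])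
    have "Mat v A (int k) (int k) + Mat v A (int d) (int d) = (- 1) ^ k * s"
      using relation_A(4)[OF v'(1)] k by (simp add: s_def add.commute)
    also have "\<dots> = - s"
      using even_diameter[OF v e] k by simp
    finally have "Mat (\<lambda>i. v (d - i)) A 0 0 + Mat (\<lambda>i. v (d - i)) A 1 1 = 2 * \<xi>"
      unfolding Mat_rev[OF v'(1)] using \<open>s = - (2 * \<xi>)\<close> k by (simp add: add.commute)
    then show thesis using that n by blast
  qed (use that v in \<open>auto simp: s_def\<close>)
qed

lemma realization_type_B:
  assumes tb: "totally_bipartite scale A B C" and r: "(\<xi>, \<xi>s, \<xi>e, act) \<in> realizations scale A B C"
  shows "module_type_B scale act"
proof -
  obtain v where v: "normal_basis v" and s: "Mat v A 0 0 + Mat v A 1 1 = 2 * \<xi>"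
    using normal_basis_bipartite[OF tb r] by blast
  note v' = normal_basisD[OF v]
  interpret V: vbasis scale d v by (fact v'(2))
  have e: "Mat v B (int d) (int d) = 0"
    using end_nonzero(1)[OF v tb] .
  then have B0: "Mat v B (int i) (int i) = 0" for i
    using v'(6) by (cases "i = d") auto
  note R = realization_module[OF r]
  have "(2 * \<xi>s)\<^sup>2 \<noteq> 0" using R(3) by simp
  then obtain m where th: "\<And>n. n \<le> d \<Longrightarrow> Mat v A (int n) (int n) = (- 1) ^ n * (2 * \<xi> / 2) * (m - 2 * of_nat n)"
    and q: "\<And>n. n < d \<Longrightarrow> Mat v B (int n + 1) (int n) * Mat v B (int n) (int n + 1) =
        (2 * \<xi>s)\<^sup>2 / 4 * of_nat (n + 1) * (m - of_nat n)" and m: "m = of_nat d"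
    using spectrum[OF v realization_scalars(2)[OF r v]] e unfolding s by metis
  have "(2 * \<xi>s)\<^sup>2 / 4 = \<xi>s\<^sup>2" by (simp add: power2_eq_square)
  note q = q[unfolded this]
  obtain k where k: "\<And>i. i \<le> d \<Longrightarrow> k i \<noteq> 0" and
    Bk: "\<And>i. i \<le> d \<Longrightarrow> B (scale (k i) (v i)) =
      scale (\<xi>s * (m + 1 - of_nat i)) (if i = 0 then 0 else scale (k (i - 1)) (v (i - 1))) +
      scale (Mat v B (int i) (int i)) (scale (k i) (v i)) +
      scale (\<xi>s * of_nat (i + 1)) (if i = d then 0 else scale (k (i + 1)) (v (i + 1)))"
    using V.rescaled_basis[OF lins(2) v'(4) R(3) q] by blast
  define u where "u i = scale (k i) (v i)" for i
  define lo where "lo i = (if i = 0 then 0 else u (i - 1))" for i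
  define up where "up i = (if i = d then 0 else u (i + 1))" for i
  have x: "act acs_x (u i) = scale ((- 1) ^ i * (of_nat d - 2 * of_nat i)) (u i)" if "i \<le> d" for i
    using R(2) lins(1) that
    by (simp add: R(5) u_def lin_iff eigen_basis[OF v that] th[OF that] m mult_ac)
  have y: "act acs_y (u i) = scale (of_nat (d - i + 1)) (lo i) + scale (of_nat (i + 1)) (up i)"
    if "i \<le> d" for i
  proof -
    have "of_nat (d - i + 1) = m + 1 - (of_nat i :: 'a)"
      using that by (simp add: m of_nat_diff)
    then show ?thesis
      using R(3) unfolding R(6) u_def lo_def up_def Bk[OF that] B0
      by (simp add: scale_right_distrib)
  qed
  \<comment> \<open>Where the neighbour is missing the vector is 0, so the eigenvalue formula of the
    neighbouring index may be used there too.\<close>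
  have xlo: "act acs_x (lo i) = scale ((- 1) ^ (i + 1) * (of_nat d - 2 * of_nat i + 2)) (lo i)" if "i \<le> d" for i
    using x[of "i - 1"] that lin_0[OF R(4)] by (cases i) (auto simp: lo_def algebra_simps)
  have xup: "act acs_x (up i) = scale ((- 1) ^ (i + 1) * (of_nat d - 2 * of_nat i - 2)) (up i)" if "i \<le> d" for i
    using x[of "i + 1"] that lin_0[OF R(4)] by (cases "i = d") (auto simp: up_def algebra_simps)
  have z: "act acs_z (u i) = scale ((- 1) ^ (i + 1) * of_nat (d - i + 1)) (lo i) +
      scale ((- 1) ^ i * of_nat (i + 1)) (up i)" if "i \<le> d" for i
  proof -
    \<comment> \<open>Neighbouring eigenvalues of \<open>x\<close> add up to 2 or -2, which cancels
      the factor 1/2 in the action of \<open>z\<close>.\<close>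
    have l: "(- 1) ^ i * (of_nat d - 2 * of_nat i) + (- 1) ^ (i + 1) * (of_nat d - 2 * of_nat i + 2)
        = (2 * (- 1) ^ (i + 1) :: 'a)"
      and r: "(- 1) ^ i * (of_nat d - 2 * of_nat i) + (- 1) ^ (i + 1) * (of_nat d - 2 * of_nat i - 2)
        = (2 * (- 1) ^ i :: 'a)"
      by (simp_all add: algebra_simps)
    show ?thesis
      unfolding R(7) anticommutator_of_shift[OF R(4) R(4) x[OF that] y[OF that] xlo[OF that] xup[OF that]] l r
        scale_right_distrib scale_scale
      by (simp add: mult.commute)
  qed
  have "indexed_basis scale d u"
    unfolding u_def using k by (rule V.indexed_basis_scale)
  then have "module_type_B_at scale d act"
    unfolding module_type_B_at_def Let_def using R(1) x y z unfolding lo_def up_def by blast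
  then show ?thesis
    using even_diameter[OF v e] by (auto simp: module_type_B_def)
qed

text \<open>The end entry of \<open>B\<close> fixes the orientation, so the sign \<open>a\<close> of
  \<open>s\<close> relative to \<open>2 * \<xi>\<close> and the sign \<open>b\<close> of the end
  entry relative to \<open>\<xi>s * of_nat (d + 1)\<close> cannot be normalised away; they determine
  \<open>n\<close>.\<close>

lemma realization_type_AB:
  assumes tb: "totally_almost_bipartite scale A B C" and r: "(\<xi>, \<xi>s, \<xi>e, act) \<in> realizations scale A B C"
  shows "module_type_AB scale act"
proof -
  obtain v where v: "normal_basis v"
    using normal_basis_exists by blast
  note v' = normal_basisD[OF v]
  interpret V: vbasis scale d v by (fact v'(2))
  define s e where "s = Mat v A 0 0 + Mat v A 1 1" and "e = Mat v B (int d) (int d)"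
  have e0: "e \<noteq> 0"
    using end_nonzero(2)[OF v tb] by (simp add: e_def)
  note R = realization_module[OF r]
  have "(2 * \<xi>s)\<^sup>2 \<noteq> 0" using R(3) by simp
  then obtain m where th: "\<And>n. n \<le> d \<Longrightarrow> Mat v A (int n) (int n) = (- 1) ^ n * (s / 2) * (m - 2 * of_nat n)"
    and q: "\<And>n. n < d \<Longrightarrow> Mat v B (int n + 1) (int n) * Mat v B (int n) (int n + 1) =
        (2 * \<xi>s)\<^sup>2 / 4 * of_nat (n + 1) * (m - of_nat n)" and m: "m = 2 * of_nat d + 1"
    and e2: "e\<^sup>2 = (2 * \<xi>s)\<^sup>2 / 4 * (of_nat (d + 1))\<^sup>2"
    using spectrum[OF v realization_scalars(2)[OF r v]] e0 unfolding s_def e_def by metis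
  have sq: "(2 * \<xi>s)\<^sup>2 / 4 = \<xi>s\<^sup>2" by (simp add: power2_eq_square)
  define b where "b = (if e = \<xi>s * of_nat (d + 1) then 1 else - 1 :: 'a)"
  have b: "b = 1 \<or> b = - 1" by (simp add: b_def)
  have "e = \<xi>s * of_nat (d + 1) \<or> e = - (\<xi>s * of_nat (d + 1))"
    using e2 unfolding sq power_mult_distrib[symmetric] power2_eq_iff .
  then have e: "e = \<xi>s * b * of_nat (d + 1)"
    by (auto simp: b_def)
  define a where "a = (if s = 2 * \<xi> then 1 else - 1 :: 'a)"
  have a: "a = 1 \<or> a = - 1" by (simp add: a_def)
  have s: "s = 2 * \<xi> * a"
    using realization_scalars(1)[OF r v] unfolding power2_eq_iff s_def[symmetric] by (auto simp: a_def)
  have "(b * \<xi>s)\<^sup>2 = \<xi>s\<^sup>2" using b by auto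
  then have q: "\<And>n. n < d \<Longrightarrow> Mat v B (int n + 1) (int n) * Mat v B (int n) (int n + 1) =
        (b * \<xi>s)\<^sup>2 * of_nat (n + 1) * (m - of_nat n)"
    using q unfolding sq by simp
  have "b * \<xi>s \<noteq> 0" using b R(3) by auto
  \<comment> \<open>Rescaling with \<open>b * \<xi>s\<close> rather than \<open>\<xi>s\<close> makes
    the end entry equal to the coefficient \<open>b * \<xi>s * of_nat (d + 1)\<close> of the missing
    vector at \<open>d + 1\<close>, as the convention \<open>v (d + 1) = v d\<close>
    demands.\<close>
  then obtain k where k: "\<And>i. i \<le> d \<Longrightarrow> k i \<noteq> 0" and
    Bk: "\<And>i. i \<le> d \<Longrightarrow> B (scale (k i) (v i)) =
      scale (b * \<xi>s * (m + 1 - of_nat i)) (if i = 0 then 0 else scale (k (i - 1)) (v (i - 1))) +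
      scale (Mat v B (int i) (int i)) (scale (k i) (v i)) +
      scale (b * \<xi>s * of_nat (i + 1)) (if i = d then 0 else scale (k (i + 1)) (v (i + 1)))"
    using V.rescaled_basis[OF lins(2) v'(4) _ q] by blast
  define p where "p = ((- 1) ^ d :: 'a)"
  have p: "p * p = 1" "p = 1 \<or> p = - 1"
    unfolding p_def by (simp_all flip: power_mult_distrib) (metis minus_one_power_iff)
  \<comment> \<open>The formulas of type AB carry the sign \<open>(- 1) ^ d\<close> for
    \<open>x\<close> and \<open>y\<close> but not for \<open>z\<close>; the two copies of
    \<open>p\<close> compensate it and cancel in the sign of \<open>z\<close>.\<close>
  obtain n where n: "hat GX n = a * p" "hat GY n = b * p" "hat GZ n = a * p * (b * p)"
    using exists_hat[of "a * p" "b * p"] a b p(2) by auto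
  define u where "u i = scale (k i) (v i)" for i
  define lo where "lo i = (if i = 0 then 0 else u (i - 1))" for i
  define up where "up i = (if i = d then u d else u (i + 1))" for i
  have x: "act acs_x (u i) = scale (a * (- 1) ^ i * (2 * of_nat d - 2 * of_nat i + 1)) (u i)"
    if "i \<le> d" for i
    using R(2) lins(1) that
    by (simp add: R(5) u_def lin_iff eigen_basis[OF v that] th[OF that] m s mult_ac algebra_simps)
  have y: "act acs_y (u i) = scale (b * of_nat (2 * d - i + 2)) (lo i) + scale (b * of_nat (i + 1)) (up i)"
    if "i \<le> d" for i
  proof -
    have "of_nat (2 * d - i + 2) = m + 1 - (of_nat i :: 'a)"
      using that by (simp add: m of_nat_diff)
    then have "B (u i) = scale (b * \<xi>s * of_nat (2 * d - i + 2)) (lo i) + scale (b * \<xi>s * of_nat (i + 1)) (up i)"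
      using v'(6) e Bk[OF that] unfolding u_def lo_def up_def e_def
      by (cases "i = d") (auto simp: mult_ac)
    then show ?thesis
      using R(3) unfolding R(6) by (simp add: scale_right_distrib)
  qed
  have xlo: "act acs_x (lo i) = scale (a * (- 1) ^ (i + 1) * (2 * of_nat d - 2 * of_nat i + 3)) (lo i)"
    if "i \<le> d" for i
    using x[of "i - 1"] that lin_0[OF R(4)] by (cases i) (auto simp: lo_def algebra_simps)
  \<comment> \<open>For \<open>i = d\<close> this vector is \<open>u d\<close> itself, and the
    eigenvalue formula continued to index \<open>d + 1\<close> returns the eigenvalue of
    \<open>u d\<close>.\<close>
  have xup: "act acs_x (up i) = scale (a * (- 1) ^ (i + 1) * (2 * of_nat d - 2 * of_nat i - 1)) (up i)"
    if "i \<le> d" for i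
    using x[of "i + 1"] x[of d] that by (cases "i = d") (auto simp: up_def algebra_simps)
  have z: "act acs_z (u i) = scale (a * b * (- 1) ^ (i + 1) * of_nat (2 * d - i + 2)) (lo i) +
      scale (a * b * (- 1) ^ i * of_nat (i + 1)) (up i)" if "i \<le> d" for i
  proof -
    have l: "a * (- 1) ^ i * (2 * of_nat d - 2 * of_nat i + 1) + a * (- 1) ^ (i + 1) * (2 * of_nat d - 2 * of_nat i + 3)
        = 2 * (a * (- 1) ^ (i + 1))"
      and r: "a * (- 1) ^ i * (2 * of_nat d - 2 * of_nat i + 1) + a * (- 1) ^ (i + 1) * (2 * of_nat d - 2 * of_nat i - 1)
        = 2 * (a * (- 1) ^ i)"
      by (simp_all add: algebra_simps)
    show ?thesis
      unfolding R(7) anticommutator_of_shift[OF R(4) R(4) x[OF that] y[OF that] xlo[OF that] xup[OF that]] l r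
        scale_right_distrib scale_scale
      by (simp add: mult_ac)
  qed
  have pp: "a * p * (b * p) = a * b" "b * p * p = b" "a * p * (p * c) = a * c" for c
    using p(1) by (metis mult.assoc mult.left_commute mult.right_neutral)+
  have "indexed_basis scale d u"
    unfolding u_def using k by (rule V.indexed_basis_scale)
  moreover have "act acs_x (u i) = scale (hat GX n * (- 1) ^ (d + i) * (2 * of_nat d - 2 * of_nat i + 1)) (u i)"
    "act acs_y (u i) = scale (hat GY n * (- 1) ^ d)
       (scale (of_nat (2 * d - i + 2)) (lo i) + scale (of_nat (i + 1)) (up i))"
    "act acs_z (u i) = scale (hat GZ n) (scale ((- 1) ^ (i + 1) * of_nat (2 * d - i + 2)) (lo i) +
       scale ((- 1) ^ i * of_nat (i + 1)) (up i))" if "i \<le> d" for i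
    unfolding n power_add x[OF that] y[OF that] z[OF that] p_def[symmetric] pp scale_right_distrib scale_scale
    by (simp_all add: mult.assoc)
  ultimately have "module_type_AB_at scale d n act"
    unfolding module_type_AB_at_def Let_def using R(1) unfolding lo_def up_def by blast
  then show ?thesis
    by (auto simp: module_type_AB_def)
qed

text \<open>By \<open>realization_iff\<close> a realization is an independent choice of
  \<open>\<xi>\<close> from plus or minus \<open>\<sigma> / 2\<close> and of \<open>\<xi>s\<close>
  from plus or minus \<open>\<tau> / 2\<close>; the remaining two components are functions of
  these.\<close>

lemma card_realizations: "card (realizations scale A B C) = 4"
  and realizations_unique:
    "(\<xi>, \<xi>s, \<xi>e, act) \<in> realizations scale A B C \<Longrightarrow> (\<xi>', \<xi>s', \<xi>e', act') \<in> realizations scale A B C \<Longrightarrow>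
      (\<xi>' = \<xi> \<or> \<xi>' = - \<xi>) \<and> (\<xi>s' = \<xi>s \<or> \<xi>s' = - \<xi>s) \<and>
      (\<xi>' = \<xi> \<and> \<xi>s' = \<xi>s \<longrightarrow> \<xi>e' = \<xi>e \<and> act' = act)"
proof -
  obtain \<sigma> \<tau> \<nu> where nz: "\<sigma> \<noteq> 0" "\<tau> \<noteq> 0" "\<nu> \<noteq> 0"
    and "quad A B (\<sigma>\<^sup>2)" "quad B A (\<tau>\<^sup>2)" and rel: "\<And>x. A (B x) + B (A x) = scale \<nu> (C x)"
    "\<And>x. B (C x) + C (B x) = scale (\<tau>\<^sup>2 / \<nu>) (A x)"
    "\<And>x. C (A x) + A (C x) = scale (\<sigma>\<^sup>2 / \<nu>) (B x)"
    using anticommutators by blast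
  note iff = realization_iff[OF nz rel]
  have sq: "(2 * c)\<^sup>2 = g\<^sup>2 \<longleftrightarrow> c \<in> {g / 2, - g / 2}" for c g :: 'a
    unfolding power2_eq_iff by (auto simp: field_simps)
  define F where "F = (\<lambda>(a, b). (a, b, 2 * a * b / \<nu>, acs_eval (gens a b (2 * a * b / \<nu>))))"
  have img: "(a, b, c, act) \<in> F ` (S \<times> T) \<longleftrightarrow>
      a \<in> S \<and> b \<in> T \<and> c = 2 * a * b / \<nu> \<and> act = acs_eval (gens a b c)" for a b c act S T
    by (force simp: F_def)
  have "realizations scale A B C = F ` ({\<sigma> / 2, - \<sigma> / 2} \<times> {\<tau> / 2, - \<tau> / 2})"
    unfolding set_eq_iff
  proof (clarify)
    fix a b c act
    show "(a, b, c, act) \<in> realizations scale A B C \<longleftrightarrow>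
        (a, b, c, act) \<in> F ` ({\<sigma> / 2, - \<sigma> / 2} \<times> {\<tau> / 2, - \<tau> / 2})"
      unfolding iff sq img by (rule refl)
  qed
  moreover have "inj_on F S" for S
    by (auto simp: F_def inj_on_def)
  moreover have "card {g / 2, - g / 2} = 2" if "g \<noteq> 0" for g :: 'a
    using that by (simp add: eq_neg_iff_add_eq_0)
  ultimately show "card (realizations scale A B C) = 4"
    using nz by (simp only: card_image card_cartesian_product) simp
  show "(\<xi>, \<xi>s, \<xi>e, act) \<in> realizations scale A B C \<Longrightarrow> (\<xi>', \<xi>s', \<xi>e', act') \<in> realizations scale A B C \<Longrightarrow>
      (\<xi>' = \<xi> \<or> \<xi>' = - \<xi>) \<and> (\<xi>s' = \<xi>s \<or> \<xi>s' = - \<xi>s) \<and>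
      (\<xi>' = \<xi> \<and> \<xi>s' = \<xi>s \<longrightarrow> \<xi>e' = \<xi>e \<and> act' = act)"
    unfolding iff sq by auto
qed

end

theorem theorem9p5:
  fixes scale :: "'k::{alg_closed_field, field_char_0} \<Rightarrow> 'v::ab_group_add \<Rightarrow> 'v"
    and Basis :: "'v set"
    and A As Ae :: "'v \<Rightarrow> 'v"
  assumes "finite_dimensional_vector_space scale Basis"
    and "vector_space.dim scale (UNIV :: 'v set) > 0"
    and "leonard_triple scale A As Ae"
    and "bannai_ito_triple scale A As Ae"
    and "diameter scale \<ge> 3"
    and "totally_bipartite scale A As Ae \<or>
         totally_almost_bipartite scale A As Ae"
  shows "realizations scale A As Ae \<noteq> {} \<and>
    (totally_bipartite scale A As Ae \<longrightarrow>
      (\<forall>(\<xi>, \<xi>s, \<xi>e, act) \<in> realizations scale A As Ae.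
        module_type_B scale act)) \<and>
    (totally_almost_bipartite scale A As Ae \<longrightarrow>
      (\<forall>(\<xi>, \<xi>s, \<xi>e, act) \<in> realizations scale A As Ae.
        module_type_AB scale act)) \<and>
    card (realizations scale A As Ae) = 4 \<and>
    (\<forall>(\<xi>, \<xi>s, \<xi>e, act) \<in> realizations scale A As Ae.
      \<forall>(\<xi>', \<xi>s', \<xi>e', act') \<in> realizations scale A As Ae.
        (\<xi>' = \<xi> \<or> \<xi>' = - \<xi>) \<and> (\<xi>s' = \<xi>s \<or> \<xi>s' = - \<xi>s) \<and>
        (\<xi>' = \<xi> \<and> \<xi>s' = \<xi>s \<longrightarrow> \<xi>e' = \<xi>e \<and> act' = act))"
proof -
  interpret finite_dimensional_vector_space scale Basis by fact
  interpret T: bannai_ito_leonard_triple scale A As Ae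
    using assms(4-6) by unfold_locales
  have "realizations scale A As Ae \<noteq> {}"
    using T.card_realizations by (metis card.empty zero_neq_numeral)
  moreover have "\<forall>(\<xi>, \<xi>s, \<xi>e, act) \<in> realizations scale A As Ae.
      \<forall>(\<xi>', \<xi>s', \<xi>e', act') \<in> realizations scale A As Ae.
        (\<xi>' = \<xi> \<or> \<xi>' = - \<xi>) \<and> (\<xi>s' = \<xi>s \<or> \<xi>s' = - \<xi>s) \<and>
        (\<xi>' = \<xi> \<and> \<xi>s' = \<xi>s \<longrightarrow> \<xi>e' = \<xi>e \<and> act' = act)"
    by (clarify, rule T.realizations_unique)
  ultimately show ?thesis
    using T.card_realizations T.realization_type_B T.realization_type_AB by auto
qed

end
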